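(* For all $t\in\mathbb{C}\setminus\{0\}$, the assignment $\mathcal{G}_t:=\mathcal{G}$ defines an equivalence of monoidal categories $\mathcal{D}(t)\to\underline{\mathrm{Rep}}(S_{t^2}^+)$.
   Context: For $k,l\in\mathbb{N}_0$ let $P(k,l)$ be the set of set partitions of $\{1,\dots,k,1',\dots,l'\}$ ($k$ upper points, $l$ lower points). Operations: the tensor product $p\otimes q$ is horizontal concatenation; the involution $p^*\in P(l,k)$ swaps upper and lower points; for $p\in P(k,l)$, $q\in P(l,m)$, stack $p$ above $q$, identifying the lower points of $p$ with the upper points of $q$; $q\cdot p\in P(k,m)$ is the induced partition of the outer points by connected components, and $\ell(q,p)$ is the number of connected components containing only middle points. $NC$ denotes the non-crossing partitions (with points ordered $1,\dots,k,l',\dots,1'$ there are no $a<b<c<d$ with $a,c$ in one block and $b,d$ in a different block), $NC_2$ those with all blocks of size two. Both are closed under the operations. For $\mathcal{C}\in\{NC,NC_2\}$ and $t\in\mathbb{C}$, $\underline{\mathrm{Rep}}_0(\mathcal{C},t)$ is the $\mathbb{C}$-linear monoidal category with objects $[k]$, $k\in\mathbb{N}_0$, $\mathrm{Hom}([k],[l])=\mathbb{C}\,\mathcal{C}(k,l)$, composition extending $qp:=t^{\ell(q,p)}\,q\cdot p$, and tensor product $[k]\otimes[l]=[k+l]$ given on morphisms by $\otimes$ of partitions; $\underline{\mathrm{Rep}}(\mathcal{C},t)$ is its Karoubi envelope (idempotent completion of the additive completion). Put $\underline{\mathrm{Rep}}(S_t^+):=\underline{\mathrm{Rep}}(NC,t)$,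 $\underline{\mathrm{Rep}}(O_t^+):=\underline{\mathrm{Rep}}(NC_2,t)$. For a partition $p\in\mathcal{C}(k,k)$ its trace is $t^{c}$, where $c$ is the number of connected components obtained from $p$ by identifying $i$ with $i'$ for all $i$; write $\mathrm{tr}$ for the trace in $\underline{\mathrm{Rep}}(O_t^+)$ and $\mathrm{tr}_2$ for the trace in $\underline{\mathrm{Rep}}(S_{t^2}^+)$ (so $t$ is replaced by $t^2$). $\mathcal{D}(t)$ is the full subcategory of $\underline{\mathrm{Rep}}(O_t^+)$ on the objects $(A,e)$ (image of the idempotent $e\in\mathrm{End}(A)$) with $A=\bigoplus_{i}[k_i]$ a finite direct sum with all $k_i$ even; equivalently, the Karoubi envelope of the full subcategory of $\underline{\mathrm{Rep}}_0(NC_2,t)$ on the $[k]$ with $k$ even. Fattening: for $p\in NC_2(2k,2l)$ define $\widehat p\in NC(k,l)$ as follows. Insert a new upper point $x_i$ between $2i-1$ and $2i$ ($1\le i\le k$) and a new lower point $y_j$ between $(2j-1)'$ and $(2j)'$ ($1\le j\le l$), and order all points linearly as $1,x_1,2,3,x_2,4,\dots,2k-1,x_k,2k,(2l)',y_l,(2l-1)',\dots,2',y_1,1'$. Two new points are declared equivalent if no block of $p$ contains both an old point lying between them in this order and an old point not lying between them. $\widehat p$ is the partition into equivalence classes, with $x_i$ identified with the upper point $i$ and $y_j$ with the lower point $j'$. The map $NC_2(2k,2l)\to NC(k,l)$, $p\mapsto\widehat p$, is a bijection. The functor: fix a square root $\sqrt t$ of $t$. Set $\mathcal{G}([2k]):=[k]$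 and $\mathcal{G}(p):=a(p)\,\widehat p$ for $p\in NC_2(2k,2l)$, where $$a(p):=(\sqrt t)^{|k-l|}\,\frac{\mathrm{tr}(p')}{\mathrm{tr}_2(\widehat{p'})},\qquad p':=\begin{cases}p\otimes\sqcup^{\otimes(l-k)}\in NC_2(2l,2l)&l\ge k,\\ p\otimes\sqcap^{\otimes(k-l)}\in NC_2(2k,2k)&k\ge l,\end{cases}$$ with $\sqcup=\{\{1,2\}\}\in P(2,0)$ and $\sqcap=\{\{1',2'\}\}\in P(0,2)$; $\mathcal{G}$ is extended linearly, additively, and to images of idempotents. *)

theory Defs
  imports Complex_Main "HOL-Library.Disjoint_Sets" "HOL-Library.Poly_Mapping"
    "Jordan_Normal_Form.Matrix"
begin

section \<open>Categories, strict monoidal categories, equivalences\<close>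

text \<open>
  A category is given by a family of hom-sets. Hom-sets of different pairs of objects need not be
  disjoint; therefore the arrow part of a functor takes the source and the target as arguments.
\<close>

record ('o, 'm) cat =
  Obj :: "'o set"
  Hom :: "'o \<Rightarrow> 'o \<Rightarrow> 'm set"
  Ident :: "'o \<Rightarrow> 'm"
  Comp :: "'m \<Rightarrow> 'm \<Rightarrow> 'm"  (infixr "\<cdot>\<index>" 70)

record ('o, 'm) mcat = "('o, 'm) cat" +
  TensO :: "'o \<Rightarrow> 'o \<Rightarrow> 'o"  (infixr "\<boxdot>\<index>" 75)
  TensM :: "'m \<Rightarrow> 'm \<Rightarrow> 'm"  (infixr "\<boxtimes>\<index>" 75)
  UnitO :: "'o"  ("\<I>\<index>")

locale category =
  fixes C :: "('o, 'm, 'z) cat_scheme" (structure)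
  assumes Ident_in_Hom: "X \<in> Obj C \<Longrightarrow> Ident C X \<in> Hom C X X"
    and Comp_in_Hom:
      "\<lbrakk>X \<in> Obj C; Y \<in> Obj C; Z \<in> Obj C; f \<in> Hom C X Y; g \<in> Hom C Y Z\<rbrakk>
        \<Longrightarrow> g \<cdot> f \<in> Hom C X Z"
    and Comp_assoc:
      "\<lbrakk>W \<in> Obj C; X \<in> Obj C; Y \<in> Obj C; Z \<in> Obj C;
        f \<in> Hom C W X; g \<in> Hom C X Y; h \<in> Hom C Y Z\<rbrakk>
        \<Longrightarrow> h \<cdot> (g \<cdot> f) = (h \<cdot> g) \<cdot> f"
    and Ident_left: "\<lbrakk>X \<in> Obj C; Y \<in> Obj C; f \<in> Hom C X Y\<rbrakk> \<Longrightarrow> Ident C Y \<cdot> f = f"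
    and Ident_right: "\<lbrakk>X \<in> Obj C; Y \<in> Obj C; f \<in> Hom C X Y\<rbrakk> \<Longrightarrow> f \<cdot> Ident C X = f"

text \<open>Monoidal categories whose associators and unitors are identities.\<close>

locale strict_monoidal_category = category C
  for C :: "('o, 'm, 'z) mcat_scheme" (structure) +
  assumes UnitO_in_Obj: "\<I> \<in> Obj C"
    and TensO_in_Obj: "\<lbrakk>X \<in> Obj C; Y \<in> Obj C\<rbrakk> \<Longrightarrow> X \<boxdot> Y \<in> Obj C"
    and TensM_in_Hom:
      "\<lbrakk>X \<in> Obj C; Y \<in> Obj C; X' \<in> Obj C; Y' \<in> Obj C; f \<in> Hom C X Y; f' \<in> Hom C X' Y'\<rbrakk>
        \<Longrightarrow> f \<boxtimes> f' \<in> Hom C (X \<boxdot> X') (Y \<boxdot> Y')"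
    and TensM_Ident:
      "\<lbrakk>X \<in> Obj C; Y \<in> Obj C\<rbrakk> \<Longrightarrow> Ident C X \<boxtimes> Ident C Y = Ident C (X \<boxdot> Y)"
    and interchange:
      "\<lbrakk>X \<in> Obj C; Y \<in> Obj C; Z \<in> Obj C; X' \<in> Obj C; Y' \<in> Obj C; Z' \<in> Obj C;
        f \<in> Hom C X Y; g \<in> Hom C Y Z; f' \<in> Hom C X' Y'; g' \<in> Hom C Y' Z'\<rbrakk>
        \<Longrightarrow> (g \<cdot> f) \<boxtimes> (g' \<cdot> f') = (g \<boxtimes> g') \<cdot> (f \<boxtimes> f')"
    and TensO_assoc:
      "\<lbrakk>X \<in> Obj C; Y \<in> Obj C; Z \<in> Obj C\<rbrakk> \<Longrightarrow> (X \<boxdot> Y) \<boxdot> Z = X \<boxdot> (Y \<boxdot> Z)"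
    and TensO_unit: "X \<in> Obj C \<Longrightarrow> \<I> \<boxdot> X = X" "X \<in> Obj C \<Longrightarrow> X \<boxdot> \<I> = X"
    and TensM_assoc:
      "\<lbrakk>X \<in> Obj C; Y \<in> Obj C; X' \<in> Obj C; Y' \<in> Obj C; X'' \<in> Obj C; Y'' \<in> Obj C;
        f \<in> Hom C X Y; f' \<in> Hom C X' Y'; f'' \<in> Hom C X'' Y''\<rbrakk>
        \<Longrightarrow> (f \<boxtimes> f') \<boxtimes> f'' = f \<boxtimes> (f' \<boxtimes> f'')"
    and TensM_unit:
      "\<lbrakk>X \<in> Obj C; Y \<in> Obj C; f \<in> Hom C X Y\<rbrakk> \<Longrightarrow> Ident C \<I> \<boxtimes> f = f"
      "\<lbrakk>X \<in> Obj C; Y \<in> Obj C; f \<in> Hom C X Y\<rbrakk> \<Longrightarrow> f \<boxtimes> Ident C \<I> = f"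

definition is_iso :: "('o, 'm, 'z) cat_scheme \<Rightarrow> 'o \<Rightarrow> 'o \<Rightarrow> 'm \<Rightarrow> bool" where
  "is_iso C X Y f \<longleftrightarrow> f \<in> Hom C X Y \<and>
    (\<exists>g\<in>Hom C Y X. Comp C g f = Ident C X \<and> Comp C f g = Ident C Y)"

definition full_subcategory :: "('o, 'm, 'z) cat_scheme \<Rightarrow> ('o \<Rightarrow> bool) \<Rightarrow> ('o, 'm, 'z) cat_scheme"
  where "full_subcategory C P = C\<lparr>Obj := {X \<in> Obj C. P X}\<rparr>"

record ('o, 'm, 'p, 'n) func =
  FO :: "'o \<Rightarrow> 'p"
  FM :: "'o \<Rightarrow> 'o \<Rightarrow> 'm \<Rightarrow> 'n"

locale cat_functor =
  fixes C :: "('o, 'm, 'z) cat_scheme" and D :: "('p, 'n, 'w) cat_scheme"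
    and F :: "('o, 'm, 'p, 'n, 'f) func_scheme"
  assumes FO_in_Obj: "X \<in> Obj C \<Longrightarrow> FO F X \<in> Obj D"
    and FM_in_Hom:
      "\<lbrakk>X \<in> Obj C; Y \<in> Obj C; f \<in> Hom C X Y\<rbrakk> \<Longrightarrow> FM F X Y f \<in> Hom D (FO F X) (FO F Y)"
    and FM_Ident: "X \<in> Obj C \<Longrightarrow> FM F X X (Ident C X) = Ident D (FO F X)"
    and FM_Comp:
      "\<lbrakk>X \<in> Obj C; Y \<in> Obj C; Z \<in> Obj C; f \<in> Hom C X Y; g \<in> Hom C Y Z\<rbrakk>
        \<Longrightarrow> FM F X Z (Comp C g f) = Comp D (FM F Y Z g) (FM F X Y f)"

definition id_functor :: "('o, 'm, 'o, 'm) func" where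
  "id_functor = \<lparr>FO = (\<lambda>X. X), FM = (\<lambda>X Y f. f)\<rparr>"

definition comp_functor ::
  "('p, 'n, 'q, 'r, 'g) func_scheme \<Rightarrow> ('o, 'm, 'p, 'n, 'f) func_scheme \<Rightarrow> ('o, 'm, 'q, 'r) func"
  where "comp_functor G F =
    \<lparr>FO = (\<lambda>X. FO G (FO F X)), FM = (\<lambda>X Y f. FM G (FO F X) (FO F Y) (FM F X Y f))\<rparr>"

definition naturally_isomorphic ::
  "('o, 'm, 'z) cat_scheme \<Rightarrow> ('p, 'n, 'w) cat_scheme \<Rightarrow>
   ('o, 'm, 'p, 'n, 'f) func_scheme \<Rightarrow> ('o, 'm, 'p, 'n, 'g) func_scheme \<Rightarrow> bool" where
  "naturally_isomorphic C D F G \<longleftrightarrow> (\<exists>\<eta>.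
     (\<forall>X\<in>Obj C. is_iso D (FO F X) (FO G X) (\<eta> X)) \<and>
     (\<forall>X\<in>Obj C. \<forall>Y\<in>Obj C. \<forall>f\<in>Hom C X Y.
        Comp D (\<eta> Y) (FM F X Y f) = Comp D (FM G X Y f) (\<eta> X)))"

definition cat_equivalence ::
  "('o, 'm, 'z) cat_scheme \<Rightarrow> ('p, 'n, 'w) cat_scheme \<Rightarrow> ('o, 'm, 'p, 'n, 'f) func_scheme \<Rightarrow> bool"
  where "cat_equivalence C D F \<longleftrightarrow> cat_functor C D F \<and>
    (\<exists>H :: ('p, 'n, 'o, 'm) func. cat_functor D C H \<and>
       naturally_isomorphic C C (comp_functor H F) id_functor \<and>
       naturally_isomorphic D D (comp_functor F H) id_functor)"

text \<open>
  A (strong) monoidal functor carries invertible coherence morphisms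
  \<open>coh_mult X Y : F X \<boxdot> F Y \<rightarrow> F (X \<boxdot> Y)\<close> and \<open>coh_unit : \<I> \<rightarrow> F \<I>\<close>. The coherence axioms are the usual
  ones, with the identity associators and unitors of strict monoidal categories omitted.
\<close>

record ('o, 'm, 'p, 'n) mfunc = "('o, 'm, 'p, 'n) func" +
  coh_mult :: "'o \<Rightarrow> 'o \<Rightarrow> 'n"
  coh_unit :: "'n"

locale monoidal_functor = cat_functor C D F
  for C :: "('o, 'm, 'z) mcat_scheme" and D :: "('p, 'n, 'w) mcat_scheme"
    and F :: "('o, 'm, 'p, 'n, 'f) mfunc_scheme" +
  assumes mu_iso:
      "\<lbrakk>X \<in> Obj C; Y \<in> Obj C\<rbrakk>
        \<Longrightarrow> is_iso D (TensO D (FO F X) (FO F Y)) (FO F (TensO C X Y)) (coh_mult F X Y)"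
    and eps_iso: "is_iso D (UnitO D) (FO F (UnitO C)) (coh_unit F)"
    and mu_natural:
      "\<lbrakk>X \<in> Obj C; Y \<in> Obj C; X' \<in> Obj C; Y' \<in> Obj C; f \<in> Hom C X Y; f' \<in> Hom C X' Y'\<rbrakk>
        \<Longrightarrow> Comp D (coh_mult F Y Y') (TensM D (FM F X Y f) (FM F X' Y' f'))
          = Comp D (FM F (TensO C X X') (TensO C Y Y') (TensM C f f')) (coh_mult F X X')"
    and mu_assoc:
      "\<lbrakk>X \<in> Obj C; Y \<in> Obj C; Z \<in> Obj C\<rbrakk>
        \<Longrightarrow> Comp D (coh_mult F (TensO C X Y) Z) (TensM D (coh_mult F X Y) (Ident D (FO F Z)))
          = Comp D (coh_mult F X (TensO C Y Z)) (TensM D (Ident D (FO F X)) (coh_mult F Y Z))"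
    and mu_unit_left:
      "X \<in> Obj C \<Longrightarrow> Comp D (coh_mult F (UnitO C) X) (TensM D (coh_unit F) (Ident D (FO F X)))
          = Ident D (FO F X)"
    and mu_unit_right:
      "X \<in> Obj C \<Longrightarrow> Comp D (coh_mult F X (UnitO C)) (TensM D (Ident D (FO F X)) (coh_unit F))
          = Ident D (FO F X)"

definition monoidal_equivalence ::
  "('o, 'm, 'z) mcat_scheme \<Rightarrow> ('p, 'n, 'w) mcat_scheme \<Rightarrow> ('o, 'm, 'p, 'n, 'f) mfunc_scheme \<Rightarrow> bool"
  where "monoidal_equivalence C D F \<longleftrightarrow>
    strict_monoidal_category C \<and> strict_monoidal_category D \<and>
    monoidal_functor C D F \<and> cat_equivalence C D F"


section \<open>Karoubi envelope\<close>

text \<open>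
  The list \<open>[X\<^sub>0, \<dots>, X\<^sub>n\<^sub>-\<^sub>1]\<close> stands for the formal direct sum of the \<open>X\<^sub>i\<close>. The entry \<open>(i, j)\<close> of a
  matrix is the component from the \<open>j\<close>-th summand of the source to the \<open>i\<close>-th summand of the target.
  In a tensor product, summands are ordered lexicographically, so \<open>TensM\<close> is the Kronecker product
  and strictness is preserved.
\<close>

definition additive_completion ::
  "('o, 'm::comm_monoid_add, 'z) mcat_scheme \<Rightarrow> ('o list, 'm mat) mcat" where
  "additive_completion C = \<lparr>
     Obj = {A. set A \<subseteq> Obj C},
     Hom = (\<lambda>A B. {M \<in> carrier_mat (length B) (length A).
              \<forall>i<length B. \<forall>j<length A. M $$ (i, j) \<in> Hom C (A ! j) (B ! i)}),
     Ident = (\<lambda>A. mat (length A) (length A) (\<lambda>(i, j). if i = j then Ident C (A ! i) else 0)),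
     Comp = (\<lambda>N M. mat (dim_row N) (dim_col M)
              (\<lambda>(i, j). \<Sum>k<dim_row M. Comp C (N $$ (i, k)) (M $$ (k, j)))),
     TensO = (\<lambda>A B. [TensO C X Y. X \<leftarrow> A, Y \<leftarrow> B]),
     TensM = (\<lambda>M N. mat (dim_row M * dim_row N) (dim_col M * dim_col N)
              (\<lambda>(i, j). TensM C (M $$ (i div dim_row N, j div dim_col N))
                               (N $$ (i mod dim_row N, j mod dim_col N)))),
     UnitO = [UnitO C]\<rparr>"

definition idempotent_completion ::
  "('o, 'm, 'z) mcat_scheme \<Rightarrow> ('o \<times> 'm, 'm) mcat" where
  "idempotent_completion C = \<lparr>
     Obj = {(A, e). A \<in> Obj C \<and> e \<in> Hom C A A \<and> Comp C e e = e},
     Hom = (\<lambda>(A, e) (B, f). {m \<in> Hom C A B. Comp C f m = m \<and> Comp C m e = m}),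
     Ident = snd,
     Comp = Comp C,
     TensO = (\<lambda>(A, e) (B, f). (TensO C A B, TensM C e f)),
     TensM = TensM C,
     UnitO = (UnitO C, Ident C (UnitO C))\<rparr>"

definition karoubi_envelope ::
  "('o, 'm::comm_monoid_add, 'z) mcat_scheme \<Rightarrow> ('o list \<times> 'm mat, 'm mat) mcat" where
  "karoubi_envelope C = idempotent_completion (additive_completion C)"


section \<open>Partitions\<close>

text \<open>\<open>Up i\<close> is the upper point \<open>i\<close>, \<open>Low j\<close> is the lower point \<open>j'\<close>; both are counted from 1.\<close>

datatype point = Up nat | Low nat

text \<open>
  Partitions carry their numbers of upper and lower points.
\<close>

datatype diagram = Diagram (nup: nat) (nlow: nat) (blocks: "point set set")

definition points :: "nat \<Rightarrow> nat \<Rightarrow> point set" where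
  "points k l = Up ` {1..k} \<union> Low ` {1..l}"

definition Part :: "nat \<Rightarrow> nat \<Rightarrow> diagram set" where
  "Part k l = {Diagram k l b | b. partition_on (points k l) b}"

text \<open>The position of a point in the order \<open>1, \<dots>, k, l', \<dots>, 1'\<close>.\<close>

fun pos :: "nat \<Rightarrow> nat \<Rightarrow> point \<Rightarrow> nat" where
  "pos k l (Up i) = i"
| "pos k l (Low j) = k + (l + 1 - j)"

definition noncrossing :: "diagram \<Rightarrow> bool" where
  "noncrossing p \<longleftrightarrow> (let \<pi> = pos (nup p) (nlow p) in
     \<not> (\<exists>B\<in>blocks p. \<exists>B'\<in>blocks p. B \<noteq> B' \<and>
         (\<exists>a\<in>B. \<exists>c\<in>B. \<exists>b\<in>B'. \<exists>d\<in>B'. \<pi> a < \<pi> b \<and> \<pi> b < \<pi> c \<and> \<pi> c < \<pi> d)))"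

definition NC :: "nat \<Rightarrow> nat \<Rightarrow> diagram set" where
  "NC k l = {p \<in> Part k l. noncrossing p}"

definition NC2 :: "nat \<Rightarrow> nat \<Rightarrow> diagram set" where
  "NC2 k l = {p \<in> NC k l. \<forall>B\<in>blocks p. card B = 2}"

definition id_diagram :: "nat \<Rightarrow> diagram" where
  "id_diagram k = Diagram k k ((\<lambda>i. {Up i, Low i}) ` {1..k})"

fun shift :: "nat \<Rightarrow> nat \<Rightarrow> point \<Rightarrow> point" where
  "shift k l (Up i) = Up (k + i)"
| "shift k l (Low j) = Low (l + j)"

definition tensor :: "diagram \<Rightarrow> diagram \<Rightarrow> diagram" where
  "tensor p q = Diagram (nup p + nup q) (nlow p + nlow q)
     (blocks p \<union> (`) (shift (nup p) (nlow p)) ` blocks q)"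

primrec tensor_power :: "diagram \<Rightarrow> nat \<Rightarrow> diagram" where
  "tensor_power p 0 = id_diagram 0"
| "tensor_power p (Suc n) = tensor (tensor_power p n) p"

text \<open>
  Connected components of the union of the members of \<open>S\<close>, where the points of each member of \<open>S\<close>
  are connected to each other.
\<close>

definition components :: "'a set set \<Rightarrow> 'a set set" where
  "components S = \<Union>S // {(x, y). \<exists>B\<in>S. x \<in> B \<and> y \<in> B}\<^sup>+"

text \<open>
  In the stack of \<open>p\<close> above \<open>q\<close>, the lower points of \<open>p\<close> and the upper points of \<open>q\<close> become the
  middle points.
\<close>

datatype stack_point = Top nat | Mid nat | Bot nat

fun upper_part :: "point \<Rightarrow> stack_point" where
  "upper_part (Up i) = Top i"
| "upper_part (Low j) = Mid j"

fun lower_part :: "point \<Rightarrow> stack_point" where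
  "lower_part (Up i) = Mid i"
| "lower_part (Low j) = Bot j"

fun outer :: "point \<Rightarrow> stack_point" where
  "outer (Up i) = Top i"
| "outer (Low j) = Bot j"

definition stack_components :: "diagram \<Rightarrow> diagram \<Rightarrow> stack_point set set" where
  "stack_components q p =
     components ((`) upper_part ` blocks p \<union> (`) lower_part ` blocks q)"

definition compose_diagram :: "diagram \<Rightarrow> diagram \<Rightarrow> diagram" where
  "compose_diagram q p = Diagram (nup p) (nlow q) ((\<lambda>K. outer -` K) ` stack_components q p - {{}})"

definition loops :: "diagram \<Rightarrow> diagram \<Rightarrow> nat" where
  "loops q p = card {K \<in> stack_components q p. K \<subseteq> range Mid}"

text \<open>For \<open>p\<close> with as many upper as lower points.\<close>

definition tr :: "complex \<Rightarrow> diagram \<Rightarrow> complex" where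
  "tr t p = t ^ card (components (blocks p \<union> (\<lambda>i. {Up i, Low i}) ` {1..nup p}))"


section \<open>The categories\<close>

text \<open>
  Formal linear combinations of partitions are finitely supported functions; \<open>single p c\<close> is \<open>c p\<close>.
\<close>

definition Rep0 :: "(nat \<Rightarrow> nat \<Rightarrow> diagram set) \<Rightarrow> complex \<Rightarrow> (nat, diagram \<Rightarrow>\<^sub>0 complex) mcat" where
  "Rep0 \<C> t = \<lparr>
     Obj = UNIV,
     Hom = (\<lambda>k l. {f. Poly_Mapping.keys f \<subseteq> \<C> k l}),
     Ident = (\<lambda>k. Poly_Mapping.single (id_diagram k) 1),
     Comp = (\<lambda>g f. \<Sum>q\<in>Poly_Mapping.keys g. \<Sum>p\<in>Poly_Mapping.keys f.
        Poly_Mapping.single (compose_diagram q p)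
          (Poly_Mapping.lookup g q * Poly_Mapping.lookup f p * t ^ loops q p)),
     TensO = (+),
     TensM = (\<lambda>f g. \<Sum>p\<in>Poly_Mapping.keys f. \<Sum>q\<in>Poly_Mapping.keys g.
        Poly_Mapping.single (tensor p q) (Poly_Mapping.lookup f p * Poly_Mapping.lookup g q)),
     UnitO = 0\<rparr>"

type_synonym rep_object = "nat list \<times> (diagram \<Rightarrow>\<^sub>0 complex) mat"
type_synonym rep_morphism = "(diagram \<Rightarrow>\<^sub>0 complex) mat"

definition Rep :: "(nat \<Rightarrow> nat \<Rightarrow> diagram set) \<Rightarrow> complex \<Rightarrow> (rep_object, rep_morphism) mcat" where
  "Rep \<C> t = karoubi_envelope (Rep0 \<C> t)"

definition Rep_S :: "complex \<Rightarrow> (rep_object, rep_morphism) mcat" where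
  "Rep_S t = Rep NC t"

definition Rep_O :: "complex \<Rightarrow> (rep_object, rep_morphism) mcat" where
  "Rep_O t = Rep NC2 t"

definition Rep_O_even :: "complex \<Rightarrow> (rep_object, rep_morphism) mcat" where
  "Rep_O_even t = full_subcategory (Rep_O t) (\<lambda>(A, e). \<forall>k\<in>set A. even k)"


section \<open>Fattening and the functor\<close>

text \<open>
  The order \<open>1, x\<^sub>1, 2, 3, x\<^sub>2, 4, \<dots>, 2k-1, x\<^sub>k, 2k, (2l)', y\<^sub>l, (2l-1)', \<dots>, 2', y\<^sub>1, 1'\<close>: the old points
  occupy the even positions, each new point the odd position directly after the old point that
  precedes it. \<open>Up i\<close> stands for \<open>x\<^sub>i\<close> and \<open>Low j\<close> for \<open>y\<^sub>j\<close> as new points.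
\<close>

definition old_pos :: "nat \<Rightarrow> nat \<Rightarrow> point \<Rightarrow> nat" where
  "old_pos k l z = 2 * pos (2 * k) (2 * l) z"

fun new_pos :: "nat \<Rightarrow> nat \<Rightarrow> point \<Rightarrow> nat" where
  "new_pos k l (Up i) = old_pos k l (Up (2 * i - 1)) + 1"
| "new_pos k l (Low j) = old_pos k l (Low (2 * j)) + 1"

definition lies_between :: "nat \<Rightarrow> nat \<Rightarrow> point \<Rightarrow> point \<Rightarrow> point \<Rightarrow> bool" where
  "lies_between k l u v z \<longleftrightarrow>
     min (new_pos k l u) (new_pos k l v) < old_pos k l z \<and>
     old_pos k l z < max (new_pos k l u) (new_pos k l v)"

definition fatten :: "diagram \<Rightarrow> diagram" where
  "fatten p = (let k = nup p div 2; l = nlow p div 2 in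
     Diagram k l (points k l // {(u, v). u \<in> points k l \<and> v \<in> points k l \<and>
       \<not> (\<exists>B\<in>blocks p. (\<exists>z\<in>B. lies_between k l u v z) \<and> (\<exists>z\<in>B. \<not> lies_between k l u v z))}))"

definition pair_upper :: diagram where
  "pair_upper = Diagram 2 0 {{Up 1, Up 2}}"

definition pair_lower :: diagram where
  "pair_lower = Diagram 0 2 {{Low 1, Low 2}}"

text \<open>\<open>square p\<close> is \<open>p'\<close>.\<close>

definition square :: "diagram \<Rightarrow> diagram" where
  "square p = (let k = nup p div 2; l = nlow p div 2 in
     if k \<le> l then tensor p (tensor_power pair_upper (l - k))
     else tensor p (tensor_power pair_lower (k - l)))"

text \<open>Here and below, \<open>s\<close> is the chosen square root of \<open>t\<close>.\<close>

definition coeff_a :: "complex \<Rightarrow> complex \<Rightarrow> diagram \<Rightarrow> complex" where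
  "coeff_a t s p = (let k = nup p div 2; l = nlow p div 2 in
     s ^ nat \<bar>int k - int l\<bar> * (tr t (square p) / tr (t\<^sup>2) (fatten (square p))))"

definition G_lin :: "complex \<Rightarrow> complex \<Rightarrow> (diagram \<Rightarrow>\<^sub>0 complex) \<Rightarrow> (diagram \<Rightarrow>\<^sub>0 complex)" where
  "G_lin t s f = (\<Sum>p\<in>Poly_Mapping.keys f.
     Poly_Mapping.single (fatten p) (coeff_a t s p * Poly_Mapping.lookup f p))"

definition G_obj :: "complex \<Rightarrow> complex \<Rightarrow> rep_object \<Rightarrow> rep_object" where
  "G_obj t s = (\<lambda>(A, e). (map (\<lambda>k. k div 2) A, map_mat (G_lin t s) e))"

text \<open>
  The functor preserves tensor products of objects on the nose, so its coherence morphisms are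
  identities.
\<close>

definition G_functor :: "complex \<Rightarrow> complex \<Rightarrow> (rep_object, rep_morphism, rep_object, rep_morphism) mfunc" where
  "G_functor t s = \<lparr>
     FO = G_obj t s,
     FM = (\<lambda>X Y. map_mat (G_lin t s)),
     coh_mult = (\<lambda>X Y. Ident (Rep_S (t\<^sup>2)) (G_obj t s (TensO (Rep_O_even t) X Y))),
     coh_unit = Ident (Rep_S (t\<^sup>2)) (UnitO (Rep_S (t\<^sup>2)))\<rparr>"

end

theory Submission
  imports Defs
begin

text \<open>
  The functor is an isomorphism of categories: fattening is a bijection, so \<open>[2k] \<mapsto> [k]\<close> and
  \<open>p \<mapsto> a(p)\<close> times the fattening of \<open>p\<close> have inverses, and these extend to matrices and idempotents.
  Compatibility with composition is a statement about planar surfaces. Thicken the blocks of the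
  fattening of \<open>p\<close> to disks; then the strings of \<open>p\<close> are their boundary, and the fattening identifies
  the points \<open>2i - 1\<close> and \<open>2i\<close>. With \<open>b(p)\<close> the number of blocks of the fattening, an Euler
  characteristic count in a stack of \<open>p \<in> NC\<^sub>2(2k, 2l)\<close> above \<open>q \<in> NC\<^sub>2(2l, 2m)\<close> relates the loops of the
  strings to those of the disks, \<open>\<ell>(q, p) + b(p) + b(q) = l + b(q \<cdot> p) + 2 \<ell>(q', p')\<close> with \<open>p', q'\<close> the
  fattenings, and the same count for closures gives \<open>a(p) = s\<^sup>k\<^sup>+\<^sup>l\<^sup>-\<^sup>2\<^sup>b\<^sup>(\<^sup>p\<^sup>)\<close>. Both counts are
  proved by bending the diagrams to a line and capping off one pair of adjacent points after the
  other, where planarity enters only through the fact that adjacent points of the same fattened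
  block are joined by a string.
\<close>

text \<open>The relation between the loops comes from gluing the disks of \<open>p\<close> and
  \<open>q\<close> along the \<open>l\<close> middle intervals. The resulting surface has Euler
  characteristic \<open>b(p) + b(q) - l\<close>. Its components are planar, and a connected planar
  surface with \<open>h\<close> boundary circles has Euler characteristic \<open>2 - h\<close>. The
  outer points of a component lie on one of its circles and all other circles are closed strings, so
  there are \<open>loops q p + b(qp)\<close> circles on \<open>b(qp) + loops q' p'\<close>
  components. Comparing both values gives the relation. With \<open>t = s^2\<close> it is the
  equality of exponents behind \<open>a(qp) * t^loops = a(q) * a(p) * (t^2)^loops'\<close>; a root
  \<open>s\<close> occurs because \<open>k + l\<close> may be odd. The obstacle is to use planarity
  without surfaces. Two descriptions of fattening are played against each other: the order-theoretic
  one of the definition, suited to crossings, and the gluing of adjacent old points, suited to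
  stacking. Closure of the even pairings, and then of \<open>NC\<close>, under composition falls out
  of the same capping induction.\<close>

section \<open>Connected components\<close>

lemma Union_image_image: "\<Union>((`) f ` S) = f ` \<Union>S"
  by auto

lemma partition_on_unique:
  assumes "partition_on A P" "B \<in> P" "C \<in> P" "z \<in> B" "z \<in> C"
  shows "B = C"
proof (rule ccontr)
  assume "B \<noteq> C"
  then have "B \<inter> C = {}" using assms(1-3) by (simp add: partition_on_def disjoint_def)
  then show False using assms(4,5) by blast
qed

lemma partition_on_ex: "partition_on A P \<Longrightarrow> x \<in> A \<Longrightarrow> \<exists>B\<in>P. x \<in> B"
  unfolding partition_on_def by blast

lemma partition_on_Un:
  assumes P: "partition_on A P" and Q: "partition_on B Q" and AB: "A \<inter> B = {}"
  shows "partition_on (A \<union> B) (P \<union> Q)"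
proof (rule partition_onI)
  show "\<Union>(P \<union> Q) = A \<union> B" "{} \<notin> P \<union> Q" using P Q by (auto simp: partition_on_def)
  have "C \<inter> D = {}" if "C \<in> P" "D \<in> Q" for C D
    using that P Q AB by (auto simp: partition_on_def)
  moreover have "C \<inter> D = {}" if "C \<in> P" "D \<in> P" "C \<noteq> D" for C D
    using that P by (simp add: partition_on_def disjoint_def)
  moreover have "C \<inter> D = {}" if "C \<in> Q" "D \<in> Q" "C \<noteq> D" for C D
    using that Q by (simp add: partition_on_def disjoint_def)
  ultimately show "disjnt C D" if "C \<in> P \<union> Q" "D \<in> P \<union> Q" "C \<noteq> D" for C D
    using that unfolding disjnt_def by (metis Int_commute Un_iff)
qed

lemma partition_on_imageI:
  assumes f: "inj_on f A" and P: "partition_on A P"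
  shows "partition_on (f ` A) ((`) f ` P)"
proof (rule partition_onI)
  show "\<Union>((`) f ` P) = f ` A" using P by (simp add: partition_on_def Union_image_image)
  show "{} \<notin> (`) f ` P" using P by (auto simp: partition_on_def)
  fix p q assume "p \<in> (`) f ` P" "q \<in> (`) f ` P" "p \<noteq> q"
  then obtain B C where BC: "B \<in> P" "C \<in> P" "p = f ` B" "q = f ` C" "B \<noteq> C" by blast
  then have "B \<inter> C = {}" "B \<subseteq> A" "C \<subseteq> A" using P by (auto simp: partition_on_def disjoint_def)
  then show "disjnt p q" using BC inj_on_image_Int[OF f, of B C] by (simp add: disjnt_def)
qed

section \<open>Connectivity through a family of sets\<close>

text \<open>The relation inside \<open>components\<close>. A transitive closure is enough: the
  relation of lying in a common member of \<open>S\<close> is already symmetric, and reflexive on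
  the union of \<open>S\<close>.\<close>

definition conn :: "'a set set \<Rightarrow> 'a rel" where
  "conn S = {(x, y). \<exists>B\<in>S. x \<in> B \<and> y \<in> B}\<^sup>+"

text \<open>If \<open>M\<close> is the set of middle points of a stack, then \<open>elim M\<close> gives the blocks of the composition
  and \<open>nin M\<close> the number of loops.\<close>

definition elim :: "'a set \<Rightarrow> 'a set set \<Rightarrow> 'a set set" where
  "elim M S = (\<lambda>K. K - M) ` components S - {{}}"

definition nin :: "'a set \<Rightarrow> 'a set set \<Rightarrow> nat" where
  "nin M S = card {K \<in> components S. K \<subseteq> M}"

lemma conn_base: "B \<in> S \<Longrightarrow> x \<in> B \<Longrightarrow> y \<in> B \<Longrightarrow> (x, y) \<in> conn S"
  unfolding conn_def by auto

lemma conn_Union: "(x, y) \<in> conn S \<Longrightarrow> x \<in> \<Union>S \<and> y \<in> \<Union>S"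
  unfolding conn_def by (induction rule: trancl_induct) auto

lemma equiv_conn: "equiv (\<Union>S) (conn S)"
proof (rule equivI)
  show "conn S \<subseteq> \<Union>S \<times> \<Union>S"
    by (rule subrelI) (simp only: mem_Times_iff fst_conv snd_conv conn_Union simp_thms)
  show "refl_on (\<Union>S) (conn S)" by (rule refl_onI) (auto intro: conn_base)
  show "sym (conn S)" unfolding conn_def by (rule sym_trancl) (auto simp: sym_def)
  show "trans (conn S)" unfolding conn_def by (rule trans_trancl)
qed

lemma conn_refl: "x \<in> \<Union>S \<Longrightarrow> (x, x) \<in> conn S"
  by (auto intro: conn_base)

lemma conn_sym: "(x, y) \<in> conn S \<Longrightarrow> (y, x) \<in> conn S"
  using equiv_conn[of S] by (auto elim: equivE dest: symD)

lemma conn_trans: "(x, y) \<in> conn S \<Longrightarrow> (y, z) \<in> conn S \<Longrightarrow> (x, z) \<in> conn S"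
  using equiv_conn[of S] by (auto elim!: equivE dest: transD)

text \<open>The invariant principle: a set that absorbs every member of \<open>S\<close> it meets
  cannot be left along a path. Every proof below that two points are not connected, or are connected
  only in a certain way, chooses a suitable \<open>U\<close>.\<close>

lemma conn_closed:
  assumes "(x, y) \<in> conn S" "x \<in> U"
    and "\<And>B z w. B \<in> S \<Longrightarrow> z \<in> B \<Longrightarrow> z \<in> U \<Longrightarrow> w \<in> B \<Longrightarrow> w \<in> U"
  shows "y \<in> U"
  using assms(1,2) unfolding conn_def
  by (induction rule: trancl_induct) (use assms(3) in blast)+

lemma conn_mono: "S \<subseteq> T \<Longrightarrow> conn S \<subseteq> conn T"
  unfolding conn_def by (rule subsetI, erule trancl_mono_subset[THEN subsetD, rotated]) auto

lemma components_quotient: "components S = \<Union>S // conn S"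
  unfolding components_def conn_def ..

lemma partition_on_components: "partition_on (\<Union>S) (components S)"
  unfolding components_quotient using equiv_conn by (rule partition_on_quotient)

lemma Union_components [simp]: "\<Union>(components S) = \<Union>S"
  using partition_on_components by (metis partition_onD1)

lemma components_nonempty: "K \<in> components S \<Longrightarrow> K \<noteq> {}"
  using partition_on_components partition_onD3 by metis

lemma components_disjoint:
  "K \<in> components S \<Longrightarrow> K' \<in> components S \<Longrightarrow> x \<in> K \<Longrightarrow> x \<in> K' \<Longrightarrow> K = K'"
  by (rule partition_on_unique[OF partition_on_components])

lemma component_conn_iff: "K \<in> components S \<Longrightarrow> x \<in> K \<Longrightarrow> y \<in> K \<longleftrightarrow> (x, y) \<in> conn S"
proof -
  assume "K \<in> components S" and x: "x \<in> K"
  then have K: "K \<in> \<Union>S // conn S" by (simp add: components_quotient)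
  obtain z where z: "K = conn S `` {z}" using K by (rule quotientE)
  then have zx: "(z, x) \<in> conn S" using x by simp
  show ?thesis unfolding z
    using zx conn_trans[of z x S y] conn_trans[of x z S y] conn_sym[of z x S] by auto
qed

lemma component_ex: "x \<in> \<Union>S \<Longrightarrow> \<exists>K\<in>components S. x \<in> K"
  by (metis UnionE Union_components)

lemma component_saturated:
  "K \<in> components S \<Longrightarrow> B \<in> S \<Longrightarrow> x \<in> B \<Longrightarrow> x \<in> K \<Longrightarrow> y \<in> B \<Longrightarrow> y \<in> K"
  by (meson component_conn_iff conn_base)

lemma component_subset: "K \<in> components S \<Longrightarrow> K \<subseteq> \<Union>S"
  using Union_components[of S] Union_upper[of K "components S"] by simp

text \<open>A candidate partition is recognized from both sides: saturation says that it is coarse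
  enough, connectedness of its blocks that it is fine enough.\<close>

lemma components_eqI:
  assumes Q: "partition_on (\<Union>S) Q"
    and sat: "\<And>B K x y. B \<in> S \<Longrightarrow> K \<in> Q \<Longrightarrow> x \<in> B \<Longrightarrow> x \<in> K \<Longrightarrow> y \<in> B \<Longrightarrow> y \<in> K"
    and con: "\<And>K x y. K \<in> Q \<Longrightarrow> x \<in> K \<Longrightarrow> y \<in> K \<Longrightarrow> (x, y) \<in> conn S"
  shows "components S = Q"
proof -
  have eq: "K = K'" if "K \<in> Q" "K' \<in> components S" "x \<in> K" "x \<in> K'" for K K' x
  proof
    show "K \<subseteq> K'" using con that component_conn_iff by (metis subsetI)
    show "K' \<subseteq> K"
    proof
      fix y assume "y \<in> K'"
      then have "(x, y) \<in> conn S" using that component_conn_iff by metis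
      then show "y \<in> K" by (rule conn_closed) (use that sat in blast)+
    qed
  qed
  have U: "\<Union>Q = \<Union>S" using Q by (simp add: partition_on_def)
  have ne: "{} \<notin> Q" using Q by (simp add: partition_on_def)
  show ?thesis
  proof (intro equalityI subsetI)
    fix K assume K: "K \<in> components S"
    then obtain x where "x \<in> K" using components_nonempty by blast
    moreover from this have "x \<in> \<Union>Q" unfolding U using component_subset[OF K] by auto
    then obtain L where "L \<in> Q" "x \<in> L" by blast
    ultimately show "K \<in> Q" using eq K by metis
  next
    fix L assume L: "L \<in> Q"
    with ne have "L \<noteq> {}" by auto
    then obtain x where x: "x \<in> L" by blast
    have "x \<in> \<Union>Q" using L x by (rule UnionI)
    then have "x \<in> \<Union>S" by (simp only: U)
    from component_ex[OF this] obtain K where "K \<in> components S" "x \<in> K" by (elim bexE)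
    then show "L \<in> components S" using eq x L by metis
  qed
qed

lemma components_partition: "partition_on A P \<Longrightarrow> components P = P"
proof (rule components_eqI)
  assume P: "partition_on A P"
  then show "partition_on (\<Union>P) P" by (simp add: partition_on_def)
  show "y \<in> K" if "B \<in> P" "K \<in> P" "x \<in> B" "x \<in> K" "y \<in> B" for B K x y
    using P that by (auto simp: partition_on_def disjoint_def)
qed (rule conn_base)

lemma components_disjoint_Un:
  assumes "\<Union>S \<inter> \<Union>T = {}"
  shows "components (S \<union> T) = components S \<union> components T"
proof (rule components_eqI)
  show "partition_on (\<Union>(S \<union> T)) (components S \<union> components T)"
    using partition_on_Un[OF partition_on_components partition_on_components assms] by simp
next
  fix B K x y assume *: "B \<in> S \<union> T" "K \<in> components S \<union> components T" "x \<in> B" "x \<in> K" "y \<in> B"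
  have no: "\<not> (x \<in> \<Union>S \<and> x \<in> \<Union>T)" using assms by auto
  have "x \<in> \<Union>S \<longleftrightarrow> B \<in> S" "x \<in> \<Union>T \<longleftrightarrow> B \<in> T" using *(1,3) no by auto
  moreover have "K \<in> components S \<Longrightarrow> x \<in> \<Union>S" "K \<in> components T \<Longrightarrow> x \<in> \<Union>T"
    using component_subset[of K S] component_subset[of K T] *(4) by auto
  ultimately show "y \<in> K"
    using no *(2) component_saturated[of K S B x y] component_saturated[of K T B x y] *(3-5) by auto
next
  fix K x y assume "K \<in> components S \<union> components T" "x \<in> K" "y \<in> K"
  then show "(x, y) \<in> conn (S \<union> T)"
    using component_conn_iff[of K S x y] component_conn_iff[of K T x y]
      conn_mono[of S "S \<union> T"] conn_mono[of T "S \<union> T"] by auto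
qed

text \<open>Since \<open>B\<close> brings no new points, it can only merge components, namely those
  it meets.\<close>

lemma components_insert:
  assumes "B \<noteq> {}" "B \<subseteq> \<Union>S"
  shows "components (insert B S) =
    insert (\<Union>{K \<in> components S. K \<inter> B \<noteq> {}}) {K \<in> components S. K \<inter> B = {}}"
    (is "_ = insert ?U ?R")
proof (rule components_eqI)
  have U: "\<Union>(insert B S) = \<Union>S" using assms by auto
  have dis: "K \<in> components S \<Longrightarrow> K' \<in> components S \<Longrightarrow> K \<inter> K' \<noteq> {} \<Longrightarrow> K = K'" for K K'
    by (metis components_disjoint IntE ex_in_conv)
  have "?U \<noteq> {}"
  proof -
    obtain x where "x \<in> B" using assms by auto
    moreover have "x \<in> \<Union>S" using calculation assms(2) by (rule subsetD[rotated])
    ultimately show ?thesis using component_ex[of x S] by auto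
  qed
  then show "partition_on (\<Union>(insert B S)) (insert ?U ?R)"
    unfolding U
  proof (intro partition_onI)
    show "{} \<notin> insert ?U ?R"
      using \<open>?U \<noteq> {}\<close> components_nonempty by auto
    show "\<Union>(insert ?U ?R) = \<Union>S"
    proof -
      have "\<Union>(insert ?U ?R) = \<Union>(components S)" 
      proof -
        have "components S = {K \<in> components S. K \<inter> B \<noteq> {}} \<union> ?R" by auto
        then have "\<Union>(components S) = \<Union>({K \<in> components S. K \<inter> B \<noteq> {}} \<union> ?R)" by simp
        then show ?thesis by (simp only: Union_Un_distrib Union_insert)
      qed
      then show ?thesis by simp
    qed
    show "disjnt p q" if pq: "p \<in> insert ?U ?R" "q \<in> insert ?U ?R" "p \<noteq> q" for p q
    proof (rule ccontr)
      assume "\<not> disjnt p q"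
      then obtain x where "x \<in> p" "x \<in> q" by (auto simp: disjnt_def)
      then obtain P Q where P: "P \<in> components S" "x \<in> P" "P = p \<and> P \<inter> B = {} \<or> p = ?U \<and> P \<inter> B \<noteq> {}"
        and Q: "Q \<in> components S" "x \<in> Q" "Q = q \<and> Q \<inter> B = {} \<or> q = ?U \<and> Q \<inter> B \<noteq> {}"
        using pq(1,2) by auto
      then have "P = Q" using components_disjoint by metis
      then show False using pq(3) P(3) Q(3) by auto
    qed
  qed
  show "y \<in> K" if hyp: "C \<in> insert B S" "K \<in> insert ?U ?R" "x \<in> C" "x \<in> K" "y \<in> C" for C K x y
  proof (cases "C = B")
    case True
    then have "K = ?U" using that by blast
    moreover have "y \<in> B" "y \<in> \<Union>S" using True that assms(2) by auto
    then have "y \<in> ?U" using component_ex[of y S] by auto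
    ultimately show ?thesis by simp
  next
    case False
    then have "C \<in> S" using hyp by simp
    moreover from hyp(2,4) obtain L where "L \<in> components S" "x \<in> L" "L \<subseteq> K" by auto
    ultimately show ?thesis using hyp component_saturated[of L S C x y] by auto
  qed
  show "(x, y) \<in> conn (insert B S)" if kxy: "K \<in> insert ?U ?R" "x \<in> K" "y \<in> K" for K x y
  proof -
    have sub: "conn S \<subseteq> conn (insert B S)" by (rule conn_mono) auto
    show ?thesis
    proof (cases "K = ?U")
      case True
      have *: "\<exists>b\<in>B. (z, b) \<in> conn S" if "z \<in> ?U" for z
        using that component_conn_iff by (smt (verit) UnionE disjoint_iff mem_Collect_eq)
      obtain b c where "b \<in> B" "c \<in> B" "(x, b) \<in> conn S" "(y, c) \<in> conn S"
        using *[of x] *[of y] kxy(2,3) unfolding True by metis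
      then show ?thesis
        using sub conn_base[of B "insert B S" b c] conn_sym[of y c S] conn_trans[of x b "insert B S" c]
          conn_trans[of x c "insert B S" y] by auto
    next
      case False
      then have "K \<in> components S" using that(1) by blast
      then show ?thesis using component_conn_iff[of K S x y] that(2,3) sub by auto
    qed
  qed
qed

lemma partition_on_diff:
  assumes "partition_on A P"
  shows "partition_on (A - M) ((\<lambda>K. K - M) ` P - {{}})"
proof (rule partition_onI)
  show "\<Union>((\<lambda>K. K - M) ` P - {{}}) = A - M" using assms by (auto simp: partition_on_def)
  show "disjnt p q" if "p \<in> (\<lambda>K. K - M) ` P - {{}}" "q \<in> (\<lambda>K. K - M) ` P - {{}}" "p \<noteq> q" for p q
    using that assms by (auto simp: partition_on_def disjoint_def disjnt_def)
qed auto

lemma partition_on_elim: "partition_on (\<Union>S - M) (elim M S)"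
  unfolding elim_def using partition_on_components by (rule partition_on_diff)

lemma Union_elim [simp]: "\<Union>(elim M S) = \<Union>S - M"
  using partition_on_elim by (metis partition_onD1)

text \<open>Points may be eliminated in several stages; this is behind the associativity of the composition and
  behind all arguments that cap off one pair of points at a time.\<close>

lemma components_elim_Un:
  assumes T: "\<Union>T \<inter> M = {}"
  shows "components (elim M S \<union> T) = elim M (S \<union> T)"
proof (rule components_eqI)
  let ?R = "elim M S \<union> T"
  have "\<Union>?R = \<Union>(S \<union> T) - M" using T by auto
  then show "partition_on (\<Union>?R) (elim M (S \<union> T))" by (simp only: partition_on_elim)
next
  fix B K x y
  assume B: "B \<in> elim M S \<union> T" and K: "K \<in> elim M (S \<union> T)" and xy: "x \<in> B" "x \<in> K" "y \<in> B"
  from K obtain K' where K': "K' \<in> components (S \<union> T)" "K = K' - M" by (auto simp: elim_def)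
  have sub: "conn S \<subseteq> conn (S \<union> T)" by (rule conn_mono) auto
  from B show "y \<in> K"
  proof
    assume "B \<in> elim M S"
    then obtain C where C: "C \<in> components S" "B = C - M" by (auto simp: elim_def)
    then have "(x, y) \<in> conn S" using component_conn_iff[of C S x y] xy by simp
    then show ?thesis using sub K' C xy component_conn_iff[of K' "S \<union> T" x y] by auto
  next
    assume "B \<in> T"
    then show ?thesis using K' xy T component_saturated[of K' "S \<union> T" B x y] by auto
  qed
next
  let ?R = "elim M S \<union> T"
  fix K x y assume K: "K \<in> elim M (S \<union> T)" and xy: "x \<in> K" "y \<in> K"
  then obtain K' where K': "K' \<in> components (S \<union> T)" "K = K' - M" by (auto simp: elim_def)
  have xyc: "(x, y) \<in> conn (S \<union> T)" and xM: "x \<notin> M" and yM: "y \<notin> M"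
    using K' xy component_conn_iff[of K' "S \<union> T" x y] by auto
  have xU: "x \<in> \<Union>?R" using conn_Union[OF xyc] xM by auto
  have blk: "(z, w) \<in> conn ?R" if "C \<in> components S" "z \<in> C" "w \<in> C" "z \<notin> M" "w \<notin> M" for C z w
    by (rule conn_base[of "C - M"]) (use that in \<open>auto simp: elim_def\<close>)
  \<comment> \<open>A path from \<open>x\<close> may run through eliminated points, about which
    \<open>?R\<close> says nothing. The invariant therefore also asks, at every reached point, that
    the surviving points of its whole \<open>S\<close>-component be connected to
    \<open>x\<close>.\<close>
  let ?U = "{z. (\<forall>C\<in>components S. z \<in> C \<longrightarrow> (\<forall>w\<in>C - M. (x, w) \<in> conn ?R)) \<and>
    (z \<notin> M \<longrightarrow> (x, z) \<in> conn ?R)}"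
  have "y \<in> ?U" using xyc
  proof (rule conn_closed)
    show "x \<in> ?U" using blk xM conn_refl[OF xU] by auto
    fix B z w assume B: "B \<in> S \<union> T" and z: "z \<in> B" "z \<in> ?U" and w: "w \<in> B"
    show "w \<in> ?U"
    proof (cases "B \<in> T")
      case True
      then have "z \<notin> M" "w \<notin> M" "(z, w) \<in> conn ?R"
        using T z w by (auto intro: conn_base[of B])
      then have xw: "(x, w) \<in> conn ?R" using z(2) conn_trans[of x z ?R w] by simp
      moreover have "(x, v) \<in> conn ?R" if "C \<in> components S" "w \<in> C" "v \<in> C - M" for C v
        using conn_trans[OF xw blk[OF that(1,2)]] that \<open>w \<notin> M\<close> by auto
      ultimately show ?thesis by auto
    next
      case False
      then have BS: "B \<in> S" using B by simp
      have *: "(x, v) \<in> conn ?R" if "C \<in> components S" "w \<in> C" "v \<in> C - M" for C v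
        using component_saturated[OF that(1) BS w that(2) z(1)] z(2) that by auto
      moreover have "w \<in> \<Union>S" using BS w by auto
      then obtain C where "C \<in> components S" "w \<in> C" using component_ex[of w S] by auto
      ultimately show ?thesis by auto
    qed
  qed
  then show "(x, y) \<in> conn ?R" using yM by simp
qed

lemma elim_elim_Un:
  assumes "\<Union>T \<inter> M = {}"
  shows "elim N (elim M S \<union> T) = elim (M \<union> N) (S \<union> T)"
proof -
  have "elim N (elim M S \<union> T) = (\<lambda>K. K - N) ` elim M (S \<union> T) - {{}}"
    using components_elim_Un[OF assms] by (simp add: elim_def)
  also have "\<dots> = elim (M \<union> N) (S \<union> T)"
  proof -
    have "(\<lambda>K. K - N) ` (\<lambda>K. K - M) ` components (S \<union> T) = (\<lambda>K. K - (M \<union> N)) ` components (S \<union> T)"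
      unfolding image_image by (intro image_cong) auto
    moreover have "(\<lambda>K. K - N) ` (X - {{}}) - {{}} = (\<lambda>K. K - N) ` X - {{}}" for X :: "'a set set"
      by auto
    ultimately show ?thesis unfolding elim_def by simp
  qed
  finally show ?thesis .
qed

text \<open>A component inside \<open>M\<close> has no point through which a member of
  \<open>T\<close> could extend it, so it is decided by \<open>S\<close> alone. These are the loops
  that disappear when \<open>M\<close> is eliminated before \<open>T\<close> is attached.\<close>

lemma components_inside:
  assumes T: "\<Union>T \<inter> M = {}"
  shows "{K \<in> components (S \<union> T). K \<subseteq> M} = {K \<in> components S. K \<subseteq> M}"
proof -
  have sub: "conn S \<subseteq> conn (S \<union> T)" by (rule conn_mono) auto
  have 1: "K \<in> components S" if K: "K \<in> components (S \<union> T)" "K \<subseteq> M" for K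
  proof -
    obtain x where x: "x \<in> K" using components_nonempty K by blast
    then have "x \<in> \<Union>S" using K(2) T component_subset[OF K(1)] by blast
    then obtain C where C: "C \<in> components S" "x \<in> C" using component_ex[of x S] by auto
    have "C \<subseteq> K"
      using component_conn_iff[OF C] component_conn_iff[OF K(1) x] sub by auto
    moreover have "y \<in> C" if "y \<in> K" for y
    proof -
      have "(x, y) \<in> conn (S \<union> T)" using that component_conn_iff[OF K(1) x] by simp
      then have "y \<in> C \<inter> M"
      proof (rule conn_closed)
        show "x \<in> C \<inter> M" using C x K by auto
        fix B z w assume B: "B \<in> S \<union> T" "z \<in> B" "z \<in> C \<inter> M" "w \<in> B"
        then have "B \<in> S" using T by blast
        then have "w \<in> C" using B component_saturated[OF C(1), of B z w] by simp
        then show "w \<in> C \<inter> M" using \<open>C \<subseteq> K\<close> K by blast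
      qed
      then show ?thesis by simp
    qed
    ultimately have "C = K" by auto
    then show ?thesis using C by simp
  qed
  have 2: "K \<in> components (S \<union> T)" if K: "K \<in> components S" "K \<subseteq> M" for K
  proof -
    obtain x where x: "x \<in> K" using components_nonempty K by blast
    then have "x \<in> \<Union>(S \<union> T)" using K component_subset[OF K(1)] by auto
    then obtain C where C: "C \<in> components (S \<union> T)" "x \<in> C" using component_ex[of x "S \<union> T"] by auto
    have "K \<subseteq> C"
      using component_conn_iff[OF C] component_conn_iff[OF K(1) x] sub by auto
    moreover have "y \<in> K" if "y \<in> C" for y
    proof -
      have "(x, y) \<in> conn (S \<union> T)" using that component_conn_iff[OF C] by simp
      then show ?thesis
      proof (rule conn_closed)
        show "x \<in> K" by fact
        fix B z w assume B: "B \<in> S \<union> T" "z \<in> B" "z \<in> K" "w \<in> B"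
        then have "B \<in> S" using T K by auto
        then show "w \<in> K" using B K component_saturated by metis
      qed
    qed
    ultimately have "C = K" by auto
    then show ?thesis using C by simp
  qed
  show ?thesis using 1 2 by blast
qed

lemma finite_components: "finite (\<Union>S) \<Longrightarrow> finite (components S)"
  using partition_on_components finite_elements by metis

text \<open>A component inside \<open>M \<union> N\<close> either lies in \<open>M\<close> and is
  counted in the first stage, or keeps a point outside \<open>M\<close>; in the second case it is
  determined by what remains of it. So loop numbers add up over stages.\<close>

lemma nin_elim_Un:
  assumes T: "\<Union>T \<inter> M = {}" and fin: "finite (\<Union>(S \<union> T))"
  shows "nin N (elim M S \<union> T) + nin M S = nin (M \<union> N) (S \<union> T)"
proof -
  let ?C = "components (S \<union> T)"
  let ?X = "{K \<in> ?C. K \<subseteq> M \<union> N \<and> \<not> K \<subseteq> M}"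
  have finC: "finite ?C" by (rule finite_components) fact
  have inj: "inj_on (\<lambda>K. K - M) ?X"
  proof (rule inj_onI)
    fix K K' assume K: "K \<in> ?X" "K' \<in> ?X" "K - M = K' - M"
    then obtain x where "x \<in> K" "x \<notin> M" by blast
    then have "x \<in> K'" using K(3) by blast
    then show "K = K'" using K \<open>x \<in> K\<close> components_disjoint[of K "S \<union> T" K' x] by simp
  qed
  have "{K \<in> components (elim M S \<union> T). K \<subseteq> N} = (\<lambda>K. K - M) ` ?X"
    unfolding components_elim_Un[OF T] by (auto simp: elim_def image_iff)
  then have "nin N (elim M S \<union> T) = card ?X"
    unfolding nin_def using card_image[OF inj] by simp
  moreover have "nin M S = card {K \<in> ?C. K \<subseteq> M}"
    unfolding nin_def using components_inside[OF T] by simp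
  moreover have "{K \<in> ?C. K \<subseteq> M \<union> N} = ?X \<union> {K \<in> ?C. K \<subseteq> M}" by auto
  moreover have "card (?X \<union> {K \<in> ?C. K \<subseteq> M}) = card ?X + card {K \<in> ?C. K \<subseteq> M}"
    by (rule card_Un_disjoint) (use finC in auto)
  ultimately show ?thesis unfolding nin_def by simp
qed

lemma elim_cong: "M \<inter> \<Union>S = M' \<inter> \<Union>S \<Longrightarrow> elim M S = elim M' S"
proof -
  assume a: "M \<inter> \<Union>S = M' \<inter> \<Union>S"
  have "K - M = K - M'" if "K \<in> components S" for K
    using component_subset[OF that] a by blast
  then show ?thesis unfolding elim_def by (simp cong: image_cong)
qed

lemma nin_cong: "M \<inter> \<Union>S = M' \<inter> \<Union>S \<Longrightarrow> nin M S = nin M' S"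
proof -
  assume a: "M \<inter> \<Union>S = M' \<inter> \<Union>S"
  have "K \<subseteq> M \<longleftrightarrow> K \<subseteq> M'" if "K \<in> components S" for K
    using component_subset[OF that] a by blast
  then show ?thesis unfolding nin_def by (metis (no_types, lifting))
qed

text \<open>Identifying points along \<open>g\<close> has the same effect as joining them by the edges in \<open>F\<close>.\<close>

locale gluing =
  fixes g :: "'a \<Rightarrow> 'b" and S F :: "'a set set"
  assumes F_Union: "\<Union>F \<subseteq> \<Union>S"
    and F_fibre: "B \<in> F \<Longrightarrow> x \<in> B \<Longrightarrow> y \<in> B \<Longrightarrow> g x = g y"
    and fibre_conn: "x \<in> \<Union>S \<Longrightarrow> y \<in> \<Union>S \<Longrightarrow> g x = g y \<Longrightarrow> (x, y) \<in> conn (S \<union> F)"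
begin

lemma components_glue: "components ((`) g ` S) = (`) g ` components (S \<union> F)"
proof (rule components_eqI)
  have U: "\<Union>((`) g ` S) = g ` \<Union>S" "\<Union>(S \<union> F) = \<Union>S" using F_Union by auto
  have eq: "K = K'" if "K \<in> components (S \<union> F)" "K' \<in> components (S \<union> F)" "x \<in> K" "y \<in> K'" "g x = g y" for K K' x y
  proof -
    have "x \<in> \<Union>S" "y \<in> \<Union>S"
      using component_subset[OF that(1)] component_subset[OF that(2)] that(3,4) U(2) by auto
    then have "(x, y) \<in> conn (S \<union> F)" using fibre_conn that(5) by simp
    then have "y \<in> K" using component_conn_iff[OF that(1,3)] by simp
    then show ?thesis using components_disjoint that by metis
  qed
  show "partition_on (\<Union>((`) g ` S)) ((`) g ` components (S \<union> F))"
    unfolding U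
  proof (rule partition_onI)
    have "\<Union>((`) g ` components (S \<union> F)) = g ` \<Union>(components (S \<union> F))"
      by (simp only: image_Union)
    then show "\<Union>((`) g ` components (S \<union> F)) = g ` \<Union>S" by (simp only: U Union_components)
    show "{} \<notin> (`) g ` components (S \<union> F)"
      using components_nonempty by auto
    show "disjnt p q" if pq: "p \<in> (`) g ` components (S \<union> F)" "q \<in> (`) g ` components (S \<union> F)" "p \<noteq> q" for p q
    proof -
      obtain K K' where K: "K \<in> components (S \<union> F)" "K' \<in> components (S \<union> F)" "p = g ` K" "q = g ` K'"
        using pq(1,2) by (elim imageE)
      then show ?thesis using eq[OF K(1,2)] pq(3) unfolding disjnt_def by (metis disjoint_iff imageE)
    qed
  qed
  fix B K x y
  assume B: "B \<in> (`) g ` S" and K: "K \<in> (`) g ` components (S \<union> F)" and xy: "x \<in> B" "x \<in> K" "y \<in> B"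
  obtain B' where B': "B' \<in> S" "B = g ` B'" using B by blast
  obtain K' where K': "K' \<in> components (S \<union> F)" "K = g ` K'" using K by blast
  obtain z w v where z: "z \<in> B'" "g z = x" "w \<in> K'" "g w = x" "v \<in> B'" "g v = y"
    using xy B' K' by auto
  have "z \<in> \<Union>(S \<union> F)" using z B' by auto
  then obtain K'' where K'': "K'' \<in> components (S \<union> F)" "z \<in> K''" using component_ex by metis
  then have "z \<in> K'" using eq z K' by metis
  then have "v \<in> K'" using component_saturated[OF K'(1), of B' z v] B' z by simp
  then show "y \<in> K" using z K' by blast
next
  fix K x y assume K: "K \<in> (`) g ` components (S \<union> F)" "x \<in> K" "y \<in> K"
  obtain K' z w where z: "K' \<in> components (S \<union> F)" "z \<in> K'" "g z = x" "w \<in> K'" "g w = y" using K by auto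
  have "(z, w) \<in> conn (S \<union> F)" using z component_conn_iff by metis
  then have "w \<in> {v. (g z, g v) \<in> conn ((`) g ` S)}"
  proof (rule conn_closed)
    have "z \<in> \<Union>S" using component_subset[OF z(1)] z(2) F_Union by blast
    then have "g z \<in> \<Union>((`) g ` S)" by auto
    then show "z \<in> {v. (g z, g v) \<in> conn ((`) g ` S)}" by (simp only: mem_Collect_eq conn_refl)
    fix B u v assume B: "B \<in> S \<union> F" "u \<in> B" "u \<in> {v. (g z, g v) \<in> conn ((`) g ` S)}" "v \<in> B"
    show "v \<in> {v. (g z, g v) \<in> conn ((`) g ` S)}"
    proof (cases "B \<in> S")
      case True
      then have "(g u, g v) \<in> conn ((`) g ` S)" using B by (intro conn_base[of "g ` B"]) auto
      then show ?thesis using B(3) conn_trans[of "g z" "g u" _ "g v"] by simp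
    next
      case False
      then show ?thesis using F_fibre[of B u v] B by simp
    qed
  qed
  then show "(x, y) \<in> conn ((`) g ` S)" using z by simp
qed

text \<open>If two components had a common image point, \<open>fibre_conn\<close> would connect
  them. Hence gluing changes neither the number of components nor that of loops.\<close>

lemma glue_inj: "inj_on ((`) g) (components (S \<union> F))"
proof (rule inj_onI)
  fix K K' assume K: "K \<in> components (S \<union> F)" "K' \<in> components (S \<union> F)" "g ` K = g ` K'"
  then obtain x y where xy: "x \<in> K" "y \<in> K'" "g x = g y" using components_nonempty[OF K(1)]
    by (metis all_not_in_conv imageE imageI)
  then have "(x, y) \<in> conn (S \<union> F)"
    using fibre_conn[of x y] component_subset[OF K(1)] component_subset[OF K(2)] F_Union by blast
  then have "y \<in> K" using component_conn_iff[OF K(1) xy(1)] by simp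
  then show "K = K'" using K(1,2) xy components_disjoint by metis
qed

lemma elim_glue: "elim N ((`) g ` S) = (`) g ` elim (g -` N) (S \<union> F)"
proof -
  have "g ` K - N = g ` (K - g -` N)" for K by auto
  then have "(\<lambda>K. K - N) ` (`) g ` components (S \<union> F) = (`) g ` (\<lambda>K. K - g -` N) ` components (S \<union> F)"
    by (simp add: image_image)
  moreover have "(`) g ` X - {{}} = (`) g ` (X - {{}})" for X by auto
  ultimately show ?thesis unfolding elim_def components_glue by metis
qed

lemma nin_glue: "nin N ((`) g ` S) = nin (g -` N) (S \<union> F)"
proof -
  have "{K \<in> components ((`) g ` S). K \<subseteq> N} = (`) g ` {K \<in> components (S \<union> F). K \<subseteq> g -` N}"
    unfolding components_glue by auto
  moreover have "inj_on ((`) g) {K \<in> components (S \<union> F). K \<subseteq> g -` N}"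
    by (rule inj_on_subset[OF glue_inj]) auto
  ultimately show ?thesis unfolding nin_def by (simp add: card_image)
qed

lemma card_components_glue: "card (components ((`) g ` S)) = card (components (S \<union> F))"
  unfolding components_glue by (rule card_image[OF glue_inj])

end

text \<open>An injective map identifies nothing, so no edges are needed; the transport lemmas for
  injections are this special case.\<close>

lemma gluing_inj: "inj_on g (\<Union>S) \<Longrightarrow> gluing g S {}"
proof
  fix x y assume "inj_on g (\<Union>S)" "x \<in> \<Union>S" "y \<in> \<Union>S" "g x = g y"
  then show "(x, y) \<in> conn (S \<union> {})" by (metis conn_refl inj_onD sup_bot_right)
qed auto

lemmas components_image = gluing.components_glue[OF gluing_inj, simplified]
lemmas elim_image = gluing.elim_glue[OF gluing_inj, simplified]
lemmas nin_image = gluing.nin_glue[OF gluing_inj, simplified]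
lemmas card_components_image = gluing.card_components_glue[OF gluing_inj, simplified]

lemma elim_disjoint_Un:
  "\<Union>S \<inter> \<Union>T = {} \<Longrightarrow> elim M (S \<union> T) = elim M S \<union> elim M T"
  unfolding elim_def by (auto simp: components_disjoint_Un)

lemma nin_disjoint_Un:
  assumes "\<Union>S \<inter> \<Union>T = {}" "finite (\<Union>S)" "finite (\<Union>T)"
  shows "nin M (S \<union> T) = nin M S + nin M T"
proof -
  have "{K \<in> components (S \<union> T). K \<subseteq> M} = {K \<in> components S. K \<subseteq> M} \<union> {K \<in> components T. K \<subseteq> M}"
    using assms by (auto simp: components_disjoint_Un)
  moreover have "{K \<in> components S. K \<subseteq> M} \<inter> {K \<in> components T. K \<subseteq> M} = {}"
  proof -
    have "False" if "K \<in> components S" "K \<in> components T" for K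
      using component_subset[OF that(1)] component_subset[OF that(2)] components_nonempty[OF that(1)] assms(1)
      by auto
    then show ?thesis by auto
  qed
  ultimately show ?thesis unfolding nin_def
    using assms by (simp add: card_Un_disjoint finite_components)
qed

section \<open>The calculus of diagrams\<close>

text \<open>\<open>lev a b\<close> puts the upper points on level \<open>a\<close> and the lower points on level \<open>b\<close>, so that any number
  of diagrams can be stacked inside one type.\<close>

fun lev :: "nat \<Rightarrow> nat \<Rightarrow> point \<Rightarrow> nat \<times> nat" where
  "lev a b (Up i) = (a, i)"
| "lev a b (Low j) = (b, j)"

abbreviation lvl :: "nat \<Rightarrow> nat \<Rightarrow> diagram \<Rightarrow> (nat \<times> nat) set set" where
  "lvl a b p \<equiv> (`) (lev a b) ` blocks p"

definition layer :: "nat \<Rightarrow> (nat \<times> nat) set" where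
  "layer b = {b} \<times> UNIV"

lemma inj_lev: "a \<noteq> b \<Longrightarrow> inj (lev a b)"
proof (rule injI)
  fix x y assume "a \<noteq> b" "lev a b x = lev a b y"
  then show "x = y" by (cases x; cases y) auto
qed

lemma lev_mem:
  assumes "a \<noteq> b"
  shows "(c, i) \<in> lev a b ` B \<longleftrightarrow> c = a \<and> Up i \<in> B \<or> c = b \<and> Low i \<in> B"
proof
  assume "(c, i) \<in> lev a b ` B"
  then obtain x where "x \<in> B" "(c, i) = lev a b x" by auto
  then show "c = a \<and> Up i \<in> B \<or> c = b \<and> Low i \<in> B" by (cases x) auto
qed (metis imageI lev.simps)

lemma mem_Pair_image: "(a, i) \<in> Pair c ` X \<longleftrightarrow> a = c \<and> i \<in> X"
  by auto

lemma inj_image_inj: "inj f \<Longrightarrow> inj ((`) f)"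
  by (simp add: inj_on_def inj_image_eq_iff)

lemma lev_image_eq_iff:
  assumes "a \<noteq> b"
  shows "(`) (lev a b) ` X = (`) (lev a b) ` Y \<longleftrightarrow> X = Y"
  using inj_image_eq_iff[OF inj_image_inj[OF inj_lev[OF assms]]] .

fun stack_lev :: "nat \<Rightarrow> nat \<Rightarrow> nat \<Rightarrow> stack_point \<Rightarrow> nat \<times> nat" where
  "stack_lev a b c (Top i) = (a, i)"
| "stack_lev a b c (Mid i) = (b, i)"
| "stack_lev a b c (Bot i) = (c, i)"

lemma stack_lev_parts:
  "stack_lev a b c \<circ> upper_part = lev a b"
  "stack_lev a b c \<circ> lower_part = lev b c"
  "stack_lev a b c \<circ> outer = lev a c"
proof -
  show "stack_lev a b c \<circ> upper_part = lev a b"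
    by (rule ext, rename_tac x, case_tac x) auto
  show "stack_lev a b c \<circ> lower_part = lev b c"
    by (rule ext, rename_tac x, case_tac x) auto
  show "stack_lev a b c \<circ> outer = lev a c"
    by (rule ext, rename_tac x, case_tac x) auto
qed

lemma inj_stack_lev: "a \<noteq> b \<Longrightarrow> b \<noteq> c \<Longrightarrow> a \<noteq> c \<Longrightarrow> inj (stack_lev a b c)"
proof (rule injI)
  fix x y assume "a \<noteq> b" "b \<noteq> c" "a \<noteq> c" "stack_lev a b c x = stack_lev a b c y"
  then show "x = y" by (cases x; cases y) auto
qed

lemma outer_image_vimage: "outer ` (outer -` K) = K - range Mid"
proof (intro equalityI subsetI)
  fix z assume "z \<in> outer ` (outer -` K)"
  then obtain x where "z = outer x" "outer x \<in> K" by auto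
  then show "z \<in> K - range Mid" by (cases x) auto
next
  fix z assume z: "z \<in> K - range Mid"
  show "z \<in> outer ` (outer -` K)"
  proof (cases z)
    case (Top i)
    then show ?thesis using z by (intro image_eqI[of _ _ "Up i"]) auto
  next
    case (Bot i)
    then show ?thesis using z by (intro image_eqI[of _ _ "Low i"]) auto
  qed (use z in auto)
qed

lemma outer_compose:
  "(`) outer ` blocks (compose_diagram q p) =
    elim (range Mid) ((`) upper_part ` blocks p \<union> (`) lower_part ` blocks q)"
proof -
  let ?C = "stack_components q p"
  have "(`) outer ` ((\<lambda>K. outer -` K) ` ?C - {{}}) = (\<lambda>K. outer ` (outer -` K)) ` ?C - {{}}"
    by auto
  also have "\<dots> = (\<lambda>K. K - range Mid) ` ?C - {{}}" unfolding outer_image_vimage ..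
  finally show ?thesis
    unfolding compose_diagram_def elim_def stack_components_def diagram.sel .
qed

lemma image_image_comp: "(`) f ` (`) g ` S = (`) (f \<circ> g) ` S"
  by (auto simp: image_image image_comp)

text \<open>The three levels are arbitrary, and the composite again occupies the two outer ones.
  This lets a stack of several diagrams be evaluated inside one family of sets.\<close>

lemma
  assumes "a \<noteq> b" "b \<noteq> c" "a \<noteq> c"
  shows compose_lev: "lvl a c (compose_diagram q p) =
      elim (layer b) (lvl a b p \<union> lvl b c q)"
    and loops_lev: "loops q p = nin (layer b) (lvl a b p \<union> lvl b c q)"
proof -
  let ?e = "stack_lev a b c"
  let ?S = "(`) upper_part ` blocks p \<union> (`) lower_part ` blocks q"
  have inj: "inj_on ?e (\<Union>?S)" using inj_stack_lev[OF assms] by (rule inj_on_subset) simp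
  have S: "lvl a b p \<union> lvl b c q = (`) ?e ` ?S"
    by (simp only: image_Un image_image_comp stack_lev_parts)
  have vim: "?e -` layer b = range Mid"
  proof (intro equalityI subsetI)
    fix x assume "x \<in> ?e -` layer b"
    then show "x \<in> range Mid" using assms by (cases x) (auto simp: layer_def)
  qed (auto simp: layer_def)
  show "lvl a c (compose_diagram q p) =
      elim (layer b) (lvl a b p \<union> lvl b c q)"
    unfolding S elim_image[OF inj] vim outer_compose[symmetric]
    by (simp only: image_image_comp stack_lev_parts)
  show "loops q p = nin (layer b) (lvl a b p \<union> lvl b c q)"
    unfolding S nin_image[OF inj] vim by (simp only: loops_def nin_def stack_components_def)
qed

lemma nup_compose [simp]: "nup (compose_diagram q p) = nup p"
  and nlow_compose [simp]: "nlow (compose_diagram q p) = nlow q"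
  by (simp_all add: compose_diagram_def)

lemma Part_iff: "p \<in> Part k l \<longleftrightarrow> nup p = k \<and> nlow p = l \<and> partition_on (points k l) (blocks p)"
  unfolding Part_def by (cases p) auto

lemma Union_blocks: "p \<in> Part k l \<Longrightarrow> \<Union>(blocks p) = points k l"
  by (simp add: Part_iff partition_on_def)

lemma finite_points [simp]: "finite (points k l)"
  by (simp add: points_def)

lemma Union_lev: "p \<in> Part k l \<Longrightarrow> \<Union>(lvl a b p) = {a} \<times> {1..k} \<union> {b} \<times> {1..l}"
  by (simp only: Union_image_image Union_blocks) (auto simp: points_def image_Un image_image)

lemma partition_on_inj_imageD:
  assumes "inj f" "partition_on (f ` A) ((`) f ` P)"
  shows "partition_on A P"
proof (rule partition_onI)
  have "f ` \<Union>P = f ` A" using assms(2) by (simp add: partition_on_def Union_image_image)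
  then show "\<Union>P = A" using assms(1) by (simp add: inj_image_eq_iff)
  show "{} \<notin> P" using assms(2) by (auto simp: partition_on_def)
  show "disjnt p q" if "p \<in> P" "q \<in> P" "p \<noteq> q" for p q
  proof -
    have "f ` p \<inter> f ` q = {}"
    proof -
      have "f ` p \<noteq> f ` q" using that(3) assms(1) by (simp add: inj_image_eq_iff)
      moreover have "disjoint ((`) f ` P)" using assms(2) by (simp add: partition_on_def)
      ultimately show ?thesis using that(1,2) by (simp add: disjoint_def)
    qed
    then show ?thesis by (auto simp: disjnt_def)
  qed
qed

lemma compose_Part:
  assumes p: "p \<in> Part k l" and q: "q \<in> Part l m"
  shows "compose_diagram q p \<in> Part k m"
proof -
  let ?S = "lvl 0 1 p \<union> lvl 1 2 q"
  have U: "\<Union>?S - layer 1 = lev 0 2 ` points k m"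
    unfolding Union_Un_distrib Union_lev[OF p] Union_lev[OF q]
    by (auto simp: layer_def points_def image_Un image_image)
  have "partition_on (lev 0 2 ` points k m) (lvl 0 2 (compose_diagram q p))"
    using partition_on_elim[of ?S "layer 1"] compose_lev[of 0 1 2 q p] by (simp only: U)
  then have "partition_on (points k m) (blocks (compose_diagram q p))"
    by (rule partition_on_inj_imageD[rotated]) (simp add: inj_lev)
  then show ?thesis using p q by (simp add: Part_iff)
qed

lemma diagram_eqI:
  "nup p = nup q \<Longrightarrow> nlow p = nlow q \<Longrightarrow> blocks p = blocks q \<Longrightarrow> p = q"
  by (cases p; cases q) simp

text \<open>Both bracketings eliminate the layers 1 and 2 from the same stack of three diagrams,
  only in opposite orders. The two sums of loops count the components inside both layers
  together.\<close>

lemma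
  assumes p: "p \<in> Part k l" and q: "q \<in> Part l m" and r: "r \<in> Part m n"
  shows compose_assoc:
      "compose_diagram r (compose_diagram q p) = compose_diagram (compose_diagram r q) p"
    and loops_assoc:
      "loops q p + loops r (compose_diagram q p) = loops r q + loops (compose_diagram r q) p"
proof -
  let ?P = "lvl 0 1 p"
  let ?Q = "lvl 1 2 q"
  let ?R = "lvl 2 3 r"
  note U = Union_lev[OF p] Union_lev[OF q] Union_lev[OF r]
  have R1: "\<Union>?R \<inter> layer 1 = {}" and P2: "\<Union>?P \<inter> layer 2 = {}"
    unfolding U by (auto simp: layer_def)
  have fin: "finite (\<Union>(?P \<union> ?Q \<union> ?R))" unfolding Union_Un_distrib U by simp
  have qp: "lvl 0 2 (compose_diagram q p) = elim (layer 1) (?P \<union> ?Q)"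
    by (rule compose_lev) auto
  have rq: "lvl 1 3 (compose_diagram r q) = elim (layer 2) (?Q \<union> ?R)"
    by (rule compose_lev) auto
  have A: "?P \<union> ?Q \<union> ?R = (?Q \<union> ?R) \<union> ?P" by blast
  have B: "layer 1 \<union> layer 2 = layer 2 \<union> layer 1" by blast
  have "lvl 0 3 (compose_diagram r (compose_diagram q p))
      = elim (layer 2) (elim (layer 1) (?P \<union> ?Q) \<union> ?R)"
    using compose_lev[of 0 2 3 r "compose_diagram q p"] qp by simp
  also have "\<dots> = elim (layer 1) (elim (layer 2) (?Q \<union> ?R) \<union> ?P)"
    unfolding elim_elim_Un[OF R1] elim_elim_Un[OF P2] by (simp only: A B)
  also have "\<dots> = lvl 0 3 (compose_diagram (compose_diagram r q) p)"
    using compose_lev[of 0 1 3 "compose_diagram r q" p] rq by (simp add: Un_commute)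
  finally have "blocks (compose_diagram r (compose_diagram q p)) =
    blocks (compose_diagram (compose_diagram r q) p)"
    by (simp only: lev_image_eq_iff[of 0 3, simplified])
  then show "compose_diagram r (compose_diagram q p) = compose_diagram (compose_diagram r q) p"
    by (intro diagram_eqI) simp_all
  have 1: "loops r (compose_diagram q p) = nin (layer 2) (elim (layer 1) (?P \<union> ?Q) \<union> ?R)"
    using loops_lev[of 0 2 3 r "compose_diagram q p"] qp by simp
  have 2: "loops q p = nin (layer 1) (?P \<union> ?Q)" by (rule loops_lev) auto
  have 3: "loops (compose_diagram r q) p = nin (layer 1) (elim (layer 2) (?Q \<union> ?R) \<union> ?P)"
    using loops_lev[of 0 1 3 "compose_diagram r q" p] rq by (simp add: Un_commute)
  have 4: "loops r q = nin (layer 2) (?Q \<union> ?R)" by (rule loops_lev) auto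
  have "loops r (compose_diagram q p) + loops q p = nin (layer 1 \<union> layer 2) (?P \<union> ?Q \<union> ?R)"
    unfolding 1 2 by (rule nin_elim_Un[OF R1 fin])
  moreover have "loops (compose_diagram r q) p + loops r q = nin (layer 2 \<union> layer 1) (?Q \<union> ?R \<union> ?P)"
    unfolding 3 4 by (rule nin_elim_Un[OF P2]) (use fin in \<open>simp only: A\<close>)
  ultimately show "loops q p + loops r (compose_diagram q p) = loops r q + loops (compose_diagram r q) p"
    by (simp only: A B add.commute)
qed

text \<open>The points \<open>f i\<close> are new ends hanging on old points \<open>g i\<close>, so
  blocks grow but never merge. Stacking with an identity diagram has this shape.\<close>

lemma components_attach:
  assumes T: "partition_on A T" and g: "g ` I \<subseteq> A" and f: "f ` I \<inter> A = {}" and inj: "inj_on f I"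
  shows "components ((\<lambda>i. {f i, g i}) ` I \<union> T) = (\<lambda>B. B \<union> f ` {i \<in> I. g i \<in> B}) ` T"
proof (rule components_eqI)
  let ?S = "(\<lambda>i. {f i, g i}) ` I \<union> T" and ?X = "\<lambda>B. B \<union> f ` {i \<in> I. g i \<in> B}"
  have TA: "\<Union>T = A" and dis: "\<And>B C x. B \<in> T \<Longrightarrow> C \<in> T \<Longrightarrow> x \<in> B \<Longrightarrow> x \<in> C \<Longrightarrow> B = C"
    and ne: "{} \<notin> T"
    using T by (auto simp: partition_on_def disjoint_def)
  have sub: "B \<subseteq> A" if "B \<in> T" for B using that TA by auto
  have U: "\<Union>?S = A \<union> f ` I" using TA g by auto
  have mem: "z \<in> ?X B \<longleftrightarrow> z \<in> B \<or> (\<exists>i\<in>I. z = f i \<and> g i \<in> B)" for z B by auto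
  have fA: "f i \<notin> A" if "i \<in> I" for i using that f by auto
  show "partition_on (\<Union>?S) (?X ` T)" unfolding U
  proof (rule partition_onI)
    have "g i \<in> \<Union>T" if "i \<in> I" for i using that g TA by auto
    then show "\<Union>(?X ` T) = A \<union> f ` I" using TA by (auto 4 4)
    show "{} \<notin> ?X ` T" using ne by auto
    fix p q assume pq: "p \<in> ?X ` T" "q \<in> ?X ` T" "p \<noteq> q"
    then obtain B C where BC: "B \<in> T" "C \<in> T" "p = ?X B" "q = ?X C" by auto
    show "disjnt p q"
    proof (rule ccontr)
      assume "\<not> disjnt p q"
      then obtain z where z: "z \<in> ?X B" "z \<in> ?X C" unfolding BC disjnt_def by blast
      have "B = C"
      proof (cases "z \<in> A")
        case True
        then have "z \<in> B" "z \<in> C" using z fA unfolding mem by auto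
        then show ?thesis using dis BC by simp
      next
        case False
        then have "z \<notin> B" "z \<notin> C" using sub BC by auto
        then obtain i j where "i \<in> I" "z = f i" "g i \<in> B" "j \<in> I" "z = f j" "g j \<in> C"
          using z unfolding mem by auto
        then have "g i \<in> B" "g i \<in> C" using inj by (auto dest: inj_onD)
        then show ?thesis using dis BC by simp
      qed
      then show False using pq(3) BC by simp
    qed
  qed
  fix D K x y assume D: "D \<in> ?S" and K: "K \<in> ?X ` T" and xy: "x \<in> D" "x \<in> K" "y \<in> D"
  obtain B where B: "B \<in> T" "K = ?X B" using K by auto
  show "y \<in> K"
  proof (cases "D \<in> T")
    case True
    then have "x \<in> A" using xy(1) sub by auto
    then have "x \<in> B" using xy(2) fA unfolding B mem by auto
    then have "D = B" using dis True B xy by simp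
    then show ?thesis using B xy by simp
  next
    case False
    then obtain i where i: "i \<in> I" "D = {f i, g i}" using D by auto
    have "g i \<in> B"
    proof (cases "x = g i")
      case True
      then have "x \<in> A" using i g by auto
      then show ?thesis using xy(2) fA True unfolding B mem by auto
    next
      case False
      then have "x = f i" using xy(1) i by simp
      then have "x \<notin> B" using fA[OF i(1)] sub B by auto
      then obtain j where "j \<in> I" "f i = f j" "g j \<in> B" using xy(2) \<open>x = f i\<close> unfolding B mem by auto
      then show ?thesis using inj i by (auto dest: inj_onD)
    qed
    then show ?thesis using xy(3) i unfolding B mem by auto
  qed
next
  let ?S = "(\<lambda>i. {f i, g i}) ` I \<union> T" and ?X = "\<lambda>B. B \<union> f ` {i \<in> I. g i \<in> B}"
  fix K x y assume K: "K \<in> ?X ` T" and xy: "x \<in> K" "y \<in> K"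
  obtain B where B: "B \<in> T" "K = ?X B" using K by auto
  have *: "\<exists>b\<in>B. (z, b) \<in> conn ?S" if "z \<in> K" for z
  proof (cases "z \<in> B")
    case True
    then show ?thesis using B conn_base[of B ?S z z] by auto
  next
    case False
    then obtain i where "i \<in> I" "z = f i" "g i \<in> B"
      using \<open>z \<in> K\<close> unfolding B(2) by blast
    then show ?thesis using conn_base[of "{f i, g i}" ?S "f i" "g i"] by auto
  qed
  obtain b c where "b \<in> B" "c \<in> B" "(x, b) \<in> conn ?S" "(y, c) \<in> conn ?S" using *[OF xy(1)] *[OF xy(2)] by auto
  moreover have "(b, c) \<in> conn ?S" by (rule conn_base[of B]) (use B calculation in auto)
  ultimately show "(x, y) \<in> conn ?S" by (meson conn_sym conn_trans)
qed

section \<open>Identity diagrams\<close>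

lemma blocks_id [simp]: "blocks (id_diagram k) = (\<lambda>i. {Up i, Low i}) ` {1..k}"
  and nup_id [simp]: "nup (id_diagram k) = k"
  and nlow_id [simp]: "nlow (id_diagram k) = k"
  by (simp_all add: id_diagram_def)

lemma id_Part: "id_diagram k \<in> Part k k"
  unfolding Part_iff by (auto simp: points_def intro!: partition_onI simp: disjnt_def)

lemma lev_blocks_id: "lvl a b (id_diagram k) = (\<lambda>i. {(a, i), (b, i)}) ` {1..k}"
  by (auto simp: image_image)

fun flip :: "point \<Rightarrow> point" where
  "flip (Up i) = Low i"
| "flip (Low i) = Up i"

lemma lev_flip: "lev a b \<circ> flip = lev b a"
  by (rule ext, rename_tac z, case_tac z) auto

lemma partition_on_flip:
  assumes "partition_on (points k l) P"
  shows "partition_on (points l k) ((`) flip ` P)"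
proof -
  have "inj_on flip (points k l)"
  proof (rule inj_onI)
    fix x y assume "flip x = flip y"
    then show "x = y" by (cases x; cases y) auto
  qed
  moreover have "flip ` points k l = points l k" by (auto simp: points_def image_Un image_image)
  ultimately show ?thesis using partition_on_imageI[OF _ assms] by metis
qed

text \<open>The strands of the identity carry the upper points from level \<open>b\<close> to level
  \<open>a\<close>. What remains of a component after removing level \<open>b\<close> is a
  relabelled block, hence nonempty, so there is no loop.\<close>

lemma
  assumes P: "partition_on (points k l) P" and abc: "a \<noteq> b" "b \<noteq> c" "a \<noteq> c"
  defines "S \<equiv> (\<lambda>i. {(a, i), (b, i)}) ` {1..k} \<union> (`) (lev b c) ` P"
  shows elim_id_stack: "elim (layer b) S = (`) (lev a c) ` P"
    and nin_id_stack: "nin (layer b) S = 0"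
proof -
  let ?X = "\<lambda>B. B \<union> Pair a ` {i \<in> {1..k}. (b, i) \<in> B}"
  have sub: "B \<subseteq> points k l" "B \<noteq> {}" if "B \<in> P" for B
    using that P by (auto simp: partition_on_def)
  have "partition_on (lev b c ` points k l) ((`) (lev b c) ` P)"
    by (rule partition_on_imageI[OF inj_on_subset[OF inj_lev[OF abc(2)] subset_UNIV] P])
  then have C: "components S = ?X ` (`) (lev b c) ` P" unfolding S_def
    by (rule components_attach) (use abc in \<open>auto simp: points_def image_Un image_image inj_on_def\<close>)
  have X: "?X (lev b c ` B) - layer b = lev a c ` B" if "B \<in> P" for B
  proof -
    have "(x, i) \<in> ?X (lev b c ` B) - layer b \<longleftrightarrow> (x, i) \<in> lev a c ` B" for x i
    proof -
      have "Up i \<in> B \<Longrightarrow> i \<in> {1..k}" using sub(1)[OF that] by (auto simp: points_def)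
      then show ?thesis
        unfolding Un_iff Diff_iff mem_Pair_image mem_Collect_eq lev_mem[OF abc(2)] lev_mem[OF abc(3)] layer_def
        using abc by auto
    qed
    then show ?thesis by (simp only: set_eq_iff split_paired_All simp_thms)
  qed
  have ne: "lev a c ` B \<noteq> {}" if "B \<in> P" for B using sub(2)[OF that] by simp
  have "elim (layer b) S = (`) (lev a c) ` P - {{}}"
    unfolding elim_def C image_image by (intro arg_cong2[of _ _ _ _ "(-)"] image_cong X refl)
  then show "elim (layer b) S = (`) (lev a c) ` P" using ne by auto
  have "\<not> K \<subseteq> layer b" if K: "K \<in> components S" for K
  proof -
    obtain B where B: "B \<in> P" "K = ?X (lev b c ` B)" using K unfolding C by (elim imageE) simp
    then have "K - layer b \<noteq> {}" using X ne by simp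
    then show ?thesis by blast
  qed
  then have "{K \<in> components S. K \<subseteq> layer b} = {}" by blast
  then show "nin (layer b) S = 0" unfolding nin_def by (simp only: card.empty)
qed

lemma
  assumes p: "p \<in> Part k l"
  shows compose_id_right: "compose_diagram p (id_diagram k) = p"
    and loops_id_right: "loops p (id_diagram k) = 0"
    and compose_id_left: "compose_diagram (id_diagram l) p = p"
    and loops_id_left: "loops (id_diagram l) p = 0"
proof -
  have nl: "nup p = k" "nlow p = l" and P: "partition_on (points k l) (blocks p)"
    using p by (simp_all add: Part_iff)
  have lv: "(0::nat) \<noteq> 1" "(1::nat) \<noteq> 2" "(0::nat) \<noteq> 2" "(2::nat) \<noteq> 1" "(1::nat) \<noteq> 0" "(2::nat) \<noteq> 0" by simp_all
  note R = elim_id_stack[OF P lv(1-3)] nin_id_stack[OF P lv(1-3)]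
  have "lvl 0 2 (compose_diagram p (id_diagram k)) = lvl 0 2 p"
    unfolding compose_lev[OF lv(1-3)] lev_blocks_id R ..
  then show "compose_diagram p (id_diagram k) = p"
    unfolding lev_image_eq_iff[OF lv(3)] using nl by (intro diagram_eqI) simp_all
  show "loops p (id_diagram k) = 0" unfolding loops_lev[OF lv(1-3)] lev_blocks_id R ..
  \<comment> \<open>An identity below is reduced to an identity above by turning everything upside
    down: \<open>flip\<close> acts on the diagram and the levels are reversed.\<close>
  note L = elim_id_stack[OF partition_on_flip[OF P] lv(4-6)] nin_id_stack[OF partition_on_flip[OF P] lv(4-6)]
  have S: "lvl 0 1 p \<union> lvl 1 2 (id_diagram l) =
      (\<lambda>i. {(2, i), (1, i)}) ` {1..l} \<union> (`) (lev 1 0) ` (`) flip ` blocks p"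
    unfolding lev_blocks_id image_image_comp lev_flip by (simp add: Un_commute insert_commute)
  have "lvl 0 2 (compose_diagram (id_diagram l) p) = lvl 0 2 p"
    unfolding compose_lev[OF lv(1-3)] S L unfolding image_image_comp lev_flip ..
  then show "compose_diagram (id_diagram l) p = p"
    unfolding lev_image_eq_iff[OF lv(3)] using nl by (intro diagram_eqI) simp_all
  show "loops (id_diagram l) p = 0" unfolding loops_lev[OF lv(1-3)] S L ..
qed

section \<open>Tensor products of diagrams\<close>

lemma nup_tensor [simp]: "nup (tensor p q) = nup p + nup q"
  and nlow_tensor [simp]: "nlow (tensor p q) = nlow p + nlow q"
  and blocks_tensor: "blocks (tensor p q) = blocks p \<union> (`) (shift (nup p) (nlow p)) ` blocks q"
  by (simp_all add: tensor_def)

lemma shift_shift: "shift k l (shift k' l' x) = shift (k + k') (l + l') x"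
  by (cases x) auto

lemma shift_0 [simp]: "shift 0 0 x = x"
  by (cases x) auto

lemma inj_shift: "inj (shift k l)"
proof (rule injI)
  fix x y assume "shift k l x = shift k l y"
  then show "x = y" by (cases x; cases y) auto
qed

lemma tensor_assoc: "tensor (tensor p q) r = tensor p (tensor q r)"
  by (rule diagram_eqI)
    (simp_all add: blocks_tensor image_Un image_image shift_shift Un_assoc)

lemma tensor_unit [simp]: "tensor (id_diagram 0) p = p" "tensor p (id_diagram 0) = p"
  by (rule diagram_eqI; simp add: blocks_tensor)
    (rule diagram_eqI; simp add: blocks_tensor)

lemma atLeast1_add: "{1..k + k'} = {1..k} \<union> (+) k ` {1..k'}" for k k' :: nat
proof (intro equalityI subsetI)
  fix x assume "x \<in> {1..k + k'}"
  then show "x \<in> {1..k} \<union> (+) k ` {1..k'}"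
    by (cases "x \<le> k") (auto intro!: image_eqI[of _ _ "x - k"])
qed auto

lemma tensor_id: "tensor (id_diagram k) (id_diagram l) = id_diagram (k + l)"
proof (rule diagram_eqI)
  have "{1..k + l} = {1..k} \<union> (+) k ` {1..l}"
    by (rule atLeast1_add)
  then show "blocks (tensor (id_diagram k) (id_diagram l)) = blocks (id_diagram (k + l))"
    by (simp only: blocks_tensor blocks_id nup_id nlow_id nup_tensor nlow_tensor image_Un image_image
        image_insert image_empty shift.simps)
qed simp_all

lemma points_add: "points (k + k') (l + l') = points k l \<union> shift k l ` points k' l'"
  and points_add_disjoint: "points k l \<inter> shift k l ` points k' l' = {}"
proof -
  show "points (k + k') (l + l') = points k l \<union> shift k l ` points k' l'"
    unfolding points_def atLeast1_add image_Un image_image shift.simps by blast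
  show "points k l \<inter> shift k l ` points k' l' = {}"
    by (auto simp: points_def)
qed

lemma tensor_Part:
  assumes "p \<in> Part k l" "q \<in> Part k' l'"
  shows "tensor p q \<in> Part (k + k') (l + l')"
proof -
  have "partition_on (shift k l ` points k' l') ((`) (shift k l) ` blocks q)"
    using assms unfolding Part_iff by (simp add: partition_on_imageI inj_on_subset[OF inj_shift subset_UNIV])
  then have "partition_on (points k l \<union> shift k l ` points k' l') (blocks p \<union> (`) (shift k l) ` blocks q)"
    using assms points_add_disjoint[of k l k' l'] by (intro partition_on_Un) (auto simp: Part_iff)
  then show ?thesis using assms unfolding Part_iff points_add blocks_tensor by simp
qed

text \<open>The offset depends on the level because the levels of a stack have different widths,
  here the widths of the left factors.\<close>

definition lshift :: "(nat \<Rightarrow> nat) \<Rightarrow> nat \<times> nat \<Rightarrow> nat \<times> nat" where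
  "lshift n = (\<lambda>(a, i). (a, n a + i))"

lemma lev_shift: "n a = k \<Longrightarrow> n b = l \<Longrightarrow> lev a b \<circ> shift k l = lshift n \<circ> lev a b"
  by (rule ext, rename_tac x, case_tac x) (auto simp: lshift_def)

lemma lev_tensor:
  assumes "p \<in> Part k l" "n a = k" "n b = l"
  shows "lvl a b (tensor p p') =
    lvl a b p \<union> (`) (lshift n) ` lvl a b p'"
proof -
  have "nup p = k" "nlow p = l" using assms by (auto simp: Part_iff)
  then show ?thesis
    unfolding blocks_tensor image_Un image_image_comp by (simp add: lev_shift[where n = n, OF assms(2,3)])
qed

text \<open>Side by side, the two stacks are disjoint, and the shift maps each level to itself.
  Elimination of the middle layer and the count of loops therefore split.\<close>

lemma
  assumes p: "p \<in> Part k l" and q: "q \<in> Part l m" and p': "p' \<in> Part k' l'" and q': "q' \<in> Part l' m'"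
  shows compose_tensor: "compose_diagram (tensor q q') (tensor p p') =
      tensor (compose_diagram q p) (compose_diagram q' p')"
    and loops_tensor: "loops (tensor q q') (tensor p p') = loops q p + loops q' p'"
proof -
  define n :: "nat \<Rightarrow> nat" where "n = (\<lambda>x. if x = 0 then k else if x = 1 then l else m)"
  have n: "n 0 = k" "n 1 = l" "n 2 = m" by (simp_all add: n_def)
  let ?S = "lvl 0 1 p \<union> lvl 1 2 q"
  let ?S' = "lvl 0 1 p' \<union> lvl 1 2 q'"
  let ?D = "lvl 0 1 (tensor p p') \<union> lvl 1 2 (tensor q q')"
  have D: "?D = ?S \<union> (`) (lshift n) ` ?S'"
    unfolding lev_tensor[of p k l n 0 1, OF p n(1,2)] lev_tensor[of q l m n 1 2, OF q n(2,3)] image_Un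
    by blast
  have dis: "\<Union>?S \<inter> \<Union>((`) (lshift n) ` ?S') = {}"
    unfolding Union_image_image Union_Un_distrib Union_blocks[OF p] Union_blocks[OF q]
      Union_blocks[OF p'] Union_blocks[OF q']
    by (auto simp: points_def lshift_def image_Un image_image n_def)
  have fin: "finite (\<Union>?S)" "finite (\<Union>((`) (lshift n) ` ?S'))"
    unfolding Union_image_image Union_Un_distrib Union_blocks[OF p] Union_blocks[OF q]
      Union_blocks[OF p'] Union_blocks[OF q'] by simp_all
  have inj: "inj_on (lshift n) X" for X by (auto simp: lshift_def inj_on_def)
  have vim: "lshift n -` layer 1 = layer 1" by (auto simp: lshift_def layer_def)
  have c: "compose_diagram q p \<in> Part k m" using p q by (rule compose_Part)
  have "lvl 0 2 (compose_diagram (tensor q q') (tensor p p')) = elim (layer 1) ?D"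
    by (rule compose_lev) auto
  also have "\<dots> = elim (layer 1) ?S \<union> (`) (lshift n) ` elim (layer 1) ?S'"
    unfolding D elim_disjoint_Un[OF dis] elim_image[OF inj] vim ..
  also have "\<dots> = lvl 0 2 (tensor (compose_diagram q p) (compose_diagram q' p'))"
    unfolding lev_tensor[of _ k m n 0 2, OF c n(1,3)]
    using compose_lev[of 0 1 2 q p] compose_lev[of 0 1 2 q' p'] by simp
  finally have "blocks (compose_diagram (tensor q q') (tensor p p')) =
      blocks (tensor (compose_diagram q p) (compose_diagram q' p'))"
    by (simp only: lev_image_eq_iff[of 0 2, simplified])
  then show "compose_diagram (tensor q q') (tensor p p') =
      tensor (compose_diagram q p) (compose_diagram q' p')"
    by (intro diagram_eqI) simp_all
  have "loops (tensor q q') (tensor p p') = nin (layer 1) ?D" by (rule loops_lev) auto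
  also have "\<dots> = nin (layer 1) ?S + nin (layer 1) ?S'"
    unfolding D nin_disjoint_Un[OF dis fin] nin_image[OF inj] vim ..
  also have "\<dots> = loops q p + loops q' p'"
    using loops_lev[of 0 1 2 q p] loops_lev[of 0 1 2 q' p'] by simp
  finally show "loops (tensor q q') (tensor p p') = loops q p + loops q' p'" .
qed

section \<open>Non-crossing pairings of a linearly ordered set\<close>

text \<open>The position function is a parameter so that the condition can be moved along
  relabellings of the points.\<close>

definition ncr :: "('a \<Rightarrow> nat) \<Rightarrow> 'a set set \<Rightarrow> bool" where
  "ncr f P \<longleftrightarrow> (\<forall>B\<in>P. \<forall>B'\<in>P. \<forall>a\<in>B. \<forall>c\<in>B. \<forall>b\<in>B'. \<forall>d\<in>B'.
     f a < f b \<longrightarrow> f b < f c \<longrightarrow> f c < f d \<longrightarrow> B = B')"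

lemma ncrD:
  assumes "ncr f P" "B \<in> P" "B' \<in> P" "a \<in> B" "c \<in> B" "b \<in> B'" "d \<in> B'" "f a < f b" "f b < f c" "f c < f d"
  shows "B = B'"
  using assms(1)[unfolded ncr_def, rule_format, OF assms(2-)] .

lemma noncrossing_iff: "noncrossing p \<longleftrightarrow> ncr (pos (nup p) (nlow p)) (blocks p)"
proof
  assume nc: "noncrossing p"
  show "ncr (pos (nup p) (nlow p)) (blocks p)"
    unfolding ncr_def
  proof (intro ballI impI)
    let ?\<pi> = "pos (nup p) (nlow p)"
    fix B B' a c b d
    assume "B \<in> blocks p" "B' \<in> blocks p" "a \<in> B" "c \<in> B" "b \<in> B'" "d \<in> B'"
      and "?\<pi> a < ?\<pi> b" "?\<pi> b < ?\<pi> c" "?\<pi> c < ?\<pi> d"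
    then have "B \<noteq> B' \<Longrightarrow> \<exists>B\<in>blocks p. \<exists>B'\<in>blocks p. B \<noteq> B' \<and>
        (\<exists>a\<in>B. \<exists>c\<in>B. \<exists>b\<in>B'. \<exists>d\<in>B'. ?\<pi> a < ?\<pi> b \<and> ?\<pi> b < ?\<pi> c \<and> ?\<pi> c < ?\<pi> d)"
      by (intro bexI[of _ B] bexI[of _ B'] conjI bexI[of _ a] bexI[of _ c] bexI[of _ b] bexI[of _ d])
    then show "B = B'" using nc unfolding noncrossing_def Let_def by argo
  qed
next
  assume nc: "ncr (pos (nup p) (nlow p)) (blocks p)"
  show "noncrossing p" unfolding noncrossing_def Let_def
  proof (intro notI, elim bexE conjE)
    fix B B' a c b d
    assume *: "B \<in> blocks p" "B' \<in> blocks p" "B \<noteq> B'" "a \<in> B" "c \<in> B" "b \<in> B'" "d \<in> B'"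
      "pos (nup p) (nlow p) a < pos (nup p) (nlow p) b" "pos (nup p) (nlow p) b < pos (nup p) (nlow p) c"
      "pos (nup p) (nlow p) c < pos (nup p) (nlow p) d"
    show False using ncrD[OF nc *(1,2,4-)] *(3) by simp
  qed
qed

text \<open>A diagram is bent so that all its points lie on a line. The new point \<open>a \<in> A\<close> lies between the old
  points \<open>2 * a\<close> and \<open>2 * a + 1\<close>. Gaps in \<open>A\<close> are allowed, so capping does not renumber points.\<close>

definition old :: "nat set \<Rightarrow> nat set" where
  "old A = {z. z div 2 \<in> A}"

lemma old_iff: "z \<in> old A \<longleftrightarrow> z div 2 \<in> A"
  by (simp add: old_def)

lemma old_simps [simp]: "2 * a \<in> old A \<longleftrightarrow> a \<in> A" "Suc (2 * a) \<in> old A \<longleftrightarrow> a \<in> A"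
  by (simp_all add: old_def)

lemma old_Un: "old (A \<union> B) = old A \<union> old B" and old_Diff: "old (A - B) = old A - old B"
  by (auto simp: old_def)

lemma old_conv: "old A = (\<lambda>a. 2 * a) ` A \<union> (\<lambda>a. Suc (2 * a)) ` A"
proof (intro equalityI subsetI)
  fix z assume "z \<in> old A"
  then have "z div 2 \<in> A" by (simp add: old_iff)
  moreover have "z = 2 * (z div 2) \<or> z = Suc (2 * (z div 2))" by presburger
  ultimately show "z \<in> (\<lambda>a. 2 * a) ` A \<union> (\<lambda>a. Suc (2 * a)) ` A" by blast
qed auto

lemma finite_old [simp]: "finite A \<Longrightarrow> finite (old A)"
  by (simp add: old_conv)

lemma card_old: "finite A \<Longrightarrow> card (old A) = 2 * card A"
proof -
  assume "finite A"
  have "(\<lambda>a. 2 * a) ` A \<inter> (\<lambda>a. Suc (2 * a)) ` A = {}" by (auto, presburger)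
  then show ?thesis using \<open>finite A\<close> unfolding old_conv
    by (simp add: card_Un_disjoint card_image inj_on_def)
qed

text \<open>\<open>X\<close> is a disjoint union of pairs. This parity argument serves twice: for
  the two ends of an arc, and for the capped points in a component.\<close>

lemma even_card_saturated:
  assumes P: "partition_on Z P" and two: "\<And>B. B \<in> P \<Longrightarrow> card B = 2" and X: "X \<subseteq> Z"
    and sat: "\<And>B x y. B \<in> P \<Longrightarrow> x \<in> B \<Longrightarrow> x \<in> X \<Longrightarrow> y \<in> B \<Longrightarrow> y \<in> X"
  shows "even (card X)"
proof -
  let ?Q = "{B \<in> P. B \<subseteq> X}"
  have "partition_on X ?Q"
  proof (rule partition_onI)
    show "\<Union>?Q = X"
    proof (intro equalityI subsetI)
      fix x assume x: "x \<in> X"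
      then obtain B where "B \<in> P" "x \<in> B" using X P by (auto simp: partition_on_def)
      then show "x \<in> \<Union>?Q" using sat x by auto
    qed auto
    show "{} \<notin> ?Q" "\<And>p q. p \<in> ?Q \<Longrightarrow> q \<in> ?Q \<Longrightarrow> p \<noteq> q \<Longrightarrow> disjnt p q"
      using P by (auto simp: partition_on_def disjoint_def disjnt_def)
  qed
  then have "card X = (\<Sum>B\<in>?Q. card B)"
    by (rule product_partition) (use two in \<open>auto intro: card_ge_0_finite\<close>)
  also have "\<dots> = (\<Sum>B\<in>?Q. 2)" by (rule sum.cong) (auto simp: two)
  finally show ?thesis by simp
qed

text \<open>No block of \<open>\<pi>\<close> contains old points both between and not between \<open>u\<close> and \<open>v\<close>: the old point \<open>z\<close> is
  to the right of the new point \<open>u\<close> iff \<open>2 * u < z\<close>.\<close>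

definition sim :: "nat set set \<Rightarrow> nat \<Rightarrow> nat \<Rightarrow> bool" where
  "sim \<pi> u v \<longleftrightarrow> (\<forall>B\<in>\<pi>. \<forall>z\<in>B. \<forall>w\<in>B. ((2*u < z) \<noteq> (2*v < z)) \<longleftrightarrow> ((2*u < w) \<noteq> (2*v < w)))"

lemma sim_refl: "sim \<pi> u u"
  by (simp add: sim_def)

lemma sim_sym: "sim \<pi> u v \<Longrightarrow> sim \<pi> v u"
  unfolding sim_def by metis

lemma sim_trans: "sim \<pi> u v \<Longrightarrow> sim \<pi> v w \<Longrightarrow> sim \<pi> u w"
  unfolding sim_def by (intro ballI) (drule bspec, assumption, drule bspec, assumption,
    drule bspec, assumption, drule bspec, assumption, drule bspec, assumption, drule bspec, assumption, argo)

abbreviation half :: "nat set set \<Rightarrow> nat set set" where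
  "half \<pi> \<equiv> (`) (\<lambda>z. z div 2) ` \<pi>"

text \<open>Halving glues the old points \<open>2 * a\<close> and \<open>2 * a + 1\<close> to the
  new point \<open>a\<close>. This gluing form is stable under capping; \<open>fat_quotient\<close>
  identifies it with the order-theoretic fattening by \<open>sim\<close>.\<close>

definition fat :: "nat set set \<Rightarrow> nat set set" where
  "fat \<pi> = components (half \<pi>)"

locale nc_pairing =
  fixes A :: "nat set" and \<pi> :: "nat set set"
  assumes finA: "finite A"
    and part: "partition_on (old A) \<pi>"
    and two: "\<And>B. B \<in> \<pi> \<Longrightarrow> card B = 2"
    and nc: "ncr (\<lambda>z. z) \<pi>"
begin

lemma mate_ex:
  assumes "z \<in> old A"
  shows "\<exists>w. w \<noteq> z \<and> {z, w} \<in> \<pi>"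
proof -
  obtain B where B: "B \<in> \<pi>" "z \<in> B" using assms part by (auto simp: partition_on_def)
  then obtain x y where "B = {x, y}" "x \<noteq> y" using two[of B] by (auto simp: card_2_iff)
  then show ?thesis using B by (auto simp: insert_commute)
qed

definition mate :: "nat \<Rightarrow> nat" where
  "mate z = (SOME w. w \<noteq> z \<and> {z, w} \<in> \<pi>)"

lemma mate: "z \<in> old A \<Longrightarrow> mate z \<noteq> z" "z \<in> old A \<Longrightarrow> {z, mate z} \<in> \<pi>"
  unfolding mate_def using someI_ex[OF mate_ex] by blast+

lemma block_eq: "B \<in> \<pi> \<Longrightarrow> C \<in> \<pi> \<Longrightarrow> z \<in> B \<Longrightarrow> z \<in> C \<Longrightarrow> B = C"
  using part by (rule partition_on_unique)

lemma block_old: "B \<in> \<pi> \<Longrightarrow> z \<in> B \<Longrightarrow> z \<in> old A"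
  using part by (auto simp: partition_on_def)

lemma block_mate: "B \<in> \<pi> \<Longrightarrow> z \<in> B \<Longrightarrow> B = {z, mate z}"
  using block_eq[of B "{z, mate z}" z] mate(2)[OF block_old] by simp

lemma mate_old: "z \<in> old A \<Longrightarrow> mate z \<in> old A"
  using mate(2) block_old by blast

lemma mate_mate [simp]: "z \<in> old A \<Longrightarrow> mate (mate z) = z"
proof -
  assume z: "z \<in> old A"
  have "{z, mate z} = {mate z, mate (mate z)}"
    by (rule block_mate) (use mate z in auto)
  then show ?thesis using mate(1)[OF z] by (metis doubleton_eq_iff)
qed

lemma no_cross:
  assumes "z \<in> old A" "w \<in> old A" "z < w" "w < mate z" "mate z < mate w"
  shows False
proof -
  have "{z, mate z} = {w, mate w}"
    by (rule ncrD[OF nc, of _ _ z "mate z" w "mate w"]) (use assms mate in auto)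
  then show False using assms by (metis doubleton_eq_iff less_irrefl order.strict_trans)
qed

lemma nest:
  assumes z: "z \<in> old A" and w: "w \<in> old A" and lt: "z < w" "w < mate z"
  shows "z < mate w \<and> mate w < mate z"
proof -
  have "mate w \<noteq> z" "mate w \<noteq> mate z" using z w lt mate_mate by (metis less_irrefl)+
  moreover have "\<not> mate z < mate w" using no_cross assms by blast
  moreover have "\<not> mate w < z"
    using no_cross[of "mate w" z] z w lt mate_old mate_mate by auto
  ultimately show ?thesis by simp
qed

lemma finite_oldA [simp]: "finite (old A)"
  using finA by simp

text \<open>The points strictly under an arc are paired among themselves, so their number is even.
  If both ends had the same parity, adding one of the ends would produce a union of full couples
  \<open>{2 * a, 2 * a + 1}\<close>, and the number would be odd.\<close>

lemma parity_aux:
  assumes z: "z \<in> old A" and lt: "z < mate z"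
  shows "even z \<noteq> even (mate z)"
proof
  assume eq: "even z = even (mate z)"
  let ?I = "{w \<in> old A. z < w \<and> w < mate z}"
  have "even (card ?I)"
  proof (rule even_card_saturated[OF part two])
    fix B x y assume "B \<in> \<pi>" "x \<in> B" "x \<in> ?I" "y \<in> B"
    then have "y = x \<or> y = mate x" using block_mate by fastforce
    then show "y \<in> ?I" using nest[OF z, of x] mate_old \<open>x \<in> ?I\<close> by auto
  qed auto
  moreover have "odd (card ?I)"
  proof (cases "even z")
    case True
    let ?J = "{c \<in> A. z div 2 \<le> c \<and> c < mate z div 2}"
    have "insert z ?I = old ?J"
      using True eq z lt by (auto simp: old_iff elim!: evenE)
    then have "card (insert z ?I) = 2 * card ?J" using finA by (simp add: card_old)
    then have "Suc (card ?I) = 2 * card ?J" by simp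
    then show ?thesis by presburger
  next
    case False
    let ?J = "{c \<in> A. z div 2 < c \<and> c \<le> mate z div 2}"
    have "insert (mate z) ?I = old ?J"
      using False eq mate_old[OF z] lt by (auto simp: old_iff elim!: oddE)
    then have "card (insert (mate z) ?I) = 2 * card ?J" using finA by (simp add: card_old)
    then have "Suc (card ?I) = 2 * card ?J" by simp
    then show ?thesis by presburger
  qed
  ultimately show False by simp
qed

lemma parity: "z \<in> old A \<Longrightarrow> even (mate z) \<longleftrightarrow> odd z"
  using parity_aux[of z] parity_aux[of "mate z"] mate_old[of z] mate(1)[of z] mate_mate[of z]
  by (metis linorder_neqE_nat)

text \<open>The cyclic successor of \<open>a\<close> in its fattened block: leave \<open>a\<close> to the right and follow the arc.\<close>

definition \<sigma> :: "nat \<Rightarrow> nat" where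
  "\<sigma> a = mate (Suc (2 * a)) div 2"

lemma mate_Suc: "a \<in> A \<Longrightarrow> mate (Suc (2 * a)) = 2 * \<sigma> a"
  unfolding \<sigma>_def using parity[of "Suc (2 * a)"] by simp

lemma \<sigma>_in: "a \<in> A \<Longrightarrow> \<sigma> a \<in> A"
  using mate_old[of "Suc (2 * a)"] mate_Suc[of a] by simp

lemma mate_\<sigma>: "a \<in> A \<Longrightarrow> mate (2 * \<sigma> a) = Suc (2 * a)"
  using mate_mate[of "Suc (2 * a)"] mate_Suc[of a] by simp

lemma arc_in: "a \<in> A \<Longrightarrow> {Suc (2 * a), 2 * \<sigma> a} \<in> \<pi>"
  using mate(2)[of "Suc (2 * a)"] mate_Suc[of a] by simp

lemma arc_ex:
  assumes "B \<in> \<pi>"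
  shows "\<exists>a\<in>A. B = {Suc (2 * a), 2 * \<sigma> a}"
proof -
  obtain z where z: "z \<in> B" using two[OF assms] by fastforce
  have "\<exists>w\<in>B. odd w"
  proof (cases "odd z")
    case False
    then have "odd (mate z)" using parity block_old[OF assms z] by simp
    then show ?thesis using block_mate[OF assms z] by auto
  qed (use z in auto)
  then obtain w where w: "w \<in> B" "odd w" by auto
  then obtain a where a: "w = Suc (2 * a)" by (metis oddE Suc_eq_plus1)
  then have "a \<in> A" using block_old[OF assms w(1)] by simp
  then show ?thesis using block_mate[OF assms w(1)] a mate_Suc by auto
qed

lemma sim_iff:
  "sim \<pi> u v \<longleftrightarrow> (\<forall>z\<in>old A. (2*u < z) \<noteq> (2*v < z) \<longrightarrow> (2*u < mate z) \<noteq> (2*v < mate z))"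
  (is "_ \<longleftrightarrow> ?R")
proof
  assume s: "sim \<pi> u v"
  show ?R
  proof (intro ballI impI)
    fix z assume z: "z \<in> old A" "(2*u < z) \<noteq> (2*v < z)"
    show "(2*u < mate z) \<noteq> (2*v < mate z)"
      using s[unfolded sim_def, rule_format, OF mate(2)[OF z(1)], of z "mate z"] z(2) by auto
  qed
next
  assume R: ?R
  show "sim \<pi> u v" unfolding sim_def
  proof (intro ballI)
    fix B z w assume B: "B \<in> \<pi>" "z \<in> B" "w \<in> B"
    then have "w = z \<or> w = mate z" using block_mate[OF B(1,2)] by auto
    moreover have zo: "z \<in> old A" using block_old B by simp
    ultimately show "((2*u < z) \<noteq> (2*v < z)) \<longleftrightarrow> ((2*u < w) \<noteq> (2*v < w))"
      using R[rule_format, of z] R[rule_format, of "mate z"] mate_old[OF zo] mate_mate[OF zo] by metis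
  qed
qed

text \<open>If \<open>a < \<sigma> a\<close>, the old points between the two new points are the
  arc's ends and everything under it; otherwise they are exactly the points strictly under it. By
  \<open>nest\<close>, no pair is separated in either case.\<close>

lemma sim_\<sigma>: 
  assumes a: "a \<in> A"
  shows "sim \<pi> a (\<sigma> a)"
  unfolding sim_iff
proof (intro ballI impI)
  fix z assume z: "z \<in> old A" "(2*a < z) \<noteq> (2*\<sigma> a < z)"
  have o: "Suc (2 * a) \<in> old A" "2 * \<sigma> a \<in> old A" using a \<sigma>_in by auto
  note m = mate_Suc[OF a] mate_\<sigma>[OF a]
  show "(2*a < mate z) \<noteq> (2*\<sigma> a < mate z)"
  proof (cases "z = Suc (2 * a) \<or> z = 2 * \<sigma> a")
    case True
    then show ?thesis using z(2) m by auto
  next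
    case False
    show ?thesis
    proof (cases "a < \<sigma> a")
      case True
      then have "Suc (2 * a) < z" "z < mate (Suc (2 * a))" using z False m by auto
      then show ?thesis using nest[OF o(1) z(1)] m by auto
    next
      case 2: False
      then have "2 * \<sigma> a < z" "z < mate (2 * \<sigma> a)" using z False m by auto
      then show ?thesis using nest[OF o(2) z(1)] m by auto
    qed
  qed
qed

text \<open>The old point \<open>Suc (2 * a)\<close> lies between \<open>a\<close> and
  \<open>b\<close>, so its mate \<open>2 * \<sigma> a\<close> must lie there too.\<close>

lemma sim_less:
  assumes "a \<in> A" "sim \<pi> a b" "a < b"
  shows "a < \<sigma> a \<and> \<sigma> a \<le> b"
proof -
  have "(2*a < 2*\<sigma> a) \<noteq> (2*b < 2*\<sigma> a)"
    using assms(2)[unfolded sim_iff, rule_format, of "Suc (2 * a)"] assms mate_Suc by simp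
  then show ?thesis using assms(3) by auto
qed

lemma Union_half: "\<Union>(half \<pi>) = A"
proof -
  have "\<Union>(half \<pi>) = (\<lambda>z. z div 2) ` old A"
    using part by (simp only: Union_image_image) (simp add: partition_on_def)
  also have "\<dots> = A" by (auto simp: old_conv image_Un image_image)
  finally show ?thesis .
qed

text \<open>By \<open>sim_less\<close>, following the arc out of \<open>a\<close> never overshoots
  \<open>b\<close>, so repeated use of \<open>\<sigma>\<close> reaches \<open>b\<close>.\<close>

lemma sim_imp_conn:
  "a \<in> A \<Longrightarrow> b \<in> A \<Longrightarrow> a < b \<Longrightarrow> sim \<pi> a b \<Longrightarrow> (a, b) \<in> conn (half \<pi>)"
proof (induction "b - a" arbitrary: a rule: less_induct)
  case less
  let ?S = "half \<pi>"
  have lt: "a < \<sigma> a" "\<sigma> a \<le> b" using sim_less less.prems by auto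
  have "(\<lambda>z. z div 2) ` {Suc (2 * a), 2 * \<sigma> a} \<in> ?S" using arc_in[OF less.prems(1)] by (rule imageI)
  then have 1: "(a, \<sigma> a) \<in> conn ?S" by (rule conn_base) auto
  show ?case
  proof (cases "\<sigma> a = b")
    case False
    then have "(\<sigma> a, b) \<in> conn ?S"
      using less.hyps[of "\<sigma> a"] lt less.prems \<sigma>_in[of a] sim_trans[OF sim_sym[OF sim_\<sigma>[of a]], of b] by auto
    then show ?thesis using conn_trans[OF 1] by simp
  qed (use 1 in simp)
qed

text \<open>The bridge between the two descriptions of fattening. Only the direction from
  \<open>sim\<close> to \<open>conn\<close> uses that arcs cannot overshoot; the other follows arcs
  one by one with \<open>sim_\<sigma>\<close>.\<close>

lemma conn_iff_sim:
  assumes "a \<in> A" "b \<in> A"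
  shows "(a, b) \<in> conn (half \<pi>) \<longleftrightarrow> sim \<pi> a b"
proof
  assume "sim \<pi> a b"
  then show "(a, b) \<in> conn (half \<pi>)"
    using sim_imp_conn[of a b] sim_imp_conn[of b a] sim_sym[of \<pi> a b] assms
      conn_sym[of b a] conn_refl[of a "half \<pi>"] Union_half
    by (metis linorder_neqE_nat)
next
  assume "(a, b) \<in> conn (half \<pi>)"
  then have "b \<in> {c. sim \<pi> a c}"
  proof (rule conn_closed)
    show "a \<in> {c. sim \<pi> a c}" by (simp add: sim_refl)
    fix B z w assume B: "B \<in> half \<pi>" "z \<in> B" "z \<in> {c. sim \<pi> a c}" "w \<in> B"
    then obtain C where C: "C \<in> \<pi>" "B = (\<lambda>z. z div 2) ` C" by auto
    obtain c where c: "c \<in> A" "C = {Suc (2 * c), 2 * \<sigma> c}" using arc_ex[OF C(1)] by auto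
    then have "B = {c, \<sigma> c}" using C by auto
    then have "sim \<pi> z w" using B(2,4) sim_\<sigma>[OF c(1)] sim_sym sim_refl by auto
    then show "w \<in> {c. sim \<pi> a c}" using B(3) sim_trans[of \<pi> a z w] by simp
  qed
  then show "sim \<pi> a b" by simp
qed

lemma fat_quotient: "fat \<pi> = A // {(u, v). u \<in> A \<and> v \<in> A \<and> sim \<pi> u v}"
proof -
  let ?S = "half \<pi>"
  have "conn ?S = {(u, v). u \<in> A \<and> v \<in> A \<and> sim \<pi> u v}"
  proof (rule Set.set_eqI)
    fix x :: "nat \<times> nat"
    obtain u v where x: "x = (u, v)" by (cases x)
    have "(u, v) \<in> conn ?S \<Longrightarrow> u \<in> A \<and> v \<in> A" using conn_Union[of u v ?S] unfolding Union_half .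
    then show "x \<in> conn ?S \<longleftrightarrow> x \<in> {(u, v). u \<in> A \<and> v \<in> A \<and> sim \<pi> u v}"
      unfolding x using conn_iff_sim[of u v] by auto
  qed
  then show ?thesis unfolding fat_def components_quotient Union_half by simp
qed

lemma partition_fat: "partition_on A (fat \<pi>)"
  using partition_on_components[of "half \<pi>"] unfolding Union_half fat_def .

lemma fat_sim: "B \<in> fat \<pi> \<Longrightarrow> a \<in> B \<Longrightarrow> b \<in> B \<longleftrightarrow> b \<in> A \<and> sim \<pi> a b"
  unfolding fat_quotient
  by (auto elim!: quotientE intro: sim_sym sim_trans)

text \<open>Let \<open>z\<close> lie between \<open>a\<close> and \<open>b\<close>. Its mate lies
  between \<open>a\<close> and \<open>c\<close>; were it beyond \<open>b\<close>, it would lie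
  between \<open>b\<close> and \<open>d\<close>, and \<open>z\<close> would have to lie there as
  well. So \<open>a\<close> and \<open>b\<close> are already equivalent.\<close>

lemma ncr_fat: "ncr (\<lambda>z. z) (fat \<pi>)"
  unfolding ncr_def
proof (intro ballI impI)
  fix B B' a c b d assume B: "B \<in> fat \<pi>" "B' \<in> fat \<pi>" "a \<in> B" "c \<in> B" "b \<in> B'" "d \<in> B'"
    and lt: "a < b" "b < c" "c < d"
  have s: "sim \<pi> a c" "sim \<pi> b d" using fat_sim B by blast+
  have "sim \<pi> a b"
    unfolding sim_iff
  proof (intro ballI impI)
    fix z assume z: "z \<in> old A" "(2*a < z) \<noteq> (2*b < z)"
    have "(2*a < mate z) \<noteq> (2*c < mate z)" using s(1)[unfolded sim_iff, rule_format, of z] z lt by auto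
    moreover have "(2*b < mate z) \<noteq> (2*d < mate z) \<Longrightarrow> (2*b < z) \<noteq> (2*d < z)"
      using s(2)[unfolded sim_iff, rule_format, of "mate z"] mate_old mate_mate z by auto
    ultimately show "(2*a < mate z) \<noteq> (2*b < mate z)" using z(2) lt by auto
  qed
  moreover have "b \<in> A" using B fat_sim by blast
  ultimately have "b \<in> B" using fat_sim[OF B(1,3)] by simp
  then show "B = B'" using B partition_fat by (auto simp: partition_on_def disjoint_def)
qed

text \<open>From the last point of a block \<open>\<sigma>\<close> wraps around to the first: if
  some \<open>c\<close> preceded \<open>\<sigma> a\<close>, the old point
  \<open>2 * \<sigma> a\<close> would lie between \<open>c\<close> and \<open>\<sigma> a\<close>,
  while its mate \<open>Suc (2 * a)\<close> lies to the right of both.\<close>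

lemma \<sigma>_last:
  assumes a: "a \<in> A" and last: "\<And>c. c \<in> A \<Longrightarrow> sim \<pi> a c \<Longrightarrow> c \<le> a" and c: "c \<in> A" "sim \<pi> a c"
  shows "\<sigma> a \<le> c"
proof (rule ccontr)
  assume "\<not> \<sigma> a \<le> c"
  then have lt: "c < \<sigma> a" by simp
  have le: "\<sigma> a \<le> a" using last \<sigma>_in sim_\<sigma> a by simp
  have "sim \<pi> c (\<sigma> a)" using c sim_sym sim_trans sim_\<sigma>[OF a] by blast
  then have "(2*c < mate (2*\<sigma> a)) \<noteq> (2*\<sigma> a < mate (2*\<sigma> a))"
    using lt \<sigma>_in[OF a] unfolding sim_iff by auto
  then show False using le lt mate_\<sigma>[OF a] by simp
qed

end

text \<open>The fattening determines \<open>\<sigma>\<close>: the next point of the block, or the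
  first one if there is no next. And \<open>\<sigma>\<close> determines all arcs.\<close>

lemma fat_inj:
  assumes "nc_pairing A \<pi>" "nc_pairing A \<rho>" and eq: "fat \<pi> = fat \<rho>"
  shows "\<pi> = \<rho>"
proof -
  interpret P: nc_pairing A \<pi> by fact
  interpret R: nc_pairing A \<rho> by fact
  have sim: "sim \<pi> a b = sim \<rho> a b" if ab: "a \<in> A" "b \<in> A" for a b
  proof -
    obtain B where "B \<in> fat \<pi>" "a \<in> B" using partition_on_ex[OF P.partition_fat ab(1)] by blast
    then show ?thesis using P.fat_sim[of B a b] R.fat_sim[of B a b] ab eq by simp
  qed
  have \<sigma>: "P.\<sigma> a = R.\<sigma> a" if a: "a \<in> A" for a
  proof (cases "\<exists>c\<in>A. a < c \<and> sim \<pi> a c")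
    case True
    then obtain c where c: "c \<in> A" "a < c" "sim \<pi> a c" by auto
    have "a < P.\<sigma> a" "a < R.\<sigma> a"
      using P.sim_less[OF a c(3,2)] R.sim_less[OF a _ c(2)] sim[OF a c(1)] c(3) by auto
    then show ?thesis
      using P.sim_less[OF a _ \<open>a < R.\<sigma> a\<close>] R.sim_less[OF a _ \<open>a < P.\<sigma> a\<close>]
        sim P.\<sigma>_in R.\<sigma>_in P.sim_\<sigma> R.sim_\<sigma> a by (metis order_antisym)
  next
    case False
    then have "P.\<sigma> a \<le> R.\<sigma> a" using P.\<sigma>_last[OF a, of "R.\<sigma> a"] sim[OF a] R.sim_\<sigma>[OF a] R.\<sigma>_in[OF a]
      by (meson linorder_not_le)
    moreover have "R.\<sigma> a \<le> P.\<sigma> a" using R.\<sigma>_last[OF a, of "P.\<sigma> a"] False sim[OF a] P.sim_\<sigma>[OF a] P.\<sigma>_in[OF a]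
      by (meson linorder_not_le)
    ultimately show ?thesis by simp
  qed
  have "B \<in> \<rho>" if "B \<in> \<pi>" for B using P.arc_ex[OF that] R.arc_in \<sigma> by auto
  moreover have "B \<in> \<pi>" if "B \<in> \<rho>" for B using R.arc_ex[OF that] P.arc_in \<sigma> by auto
  ultimately show ?thesis by blast
qed

text \<open>The cyclic successor relation of the blocks, whose arcs bound the thickened blocks.\<close>

definition nxt :: "nat set set \<Rightarrow> nat \<Rightarrow> nat \<Rightarrow> bool" where
  "nxt P a b \<longleftrightarrow> (\<exists>B\<in>P. a \<in> B \<and> b \<in> B \<and>
     (a < b \<and> (\<forall>c\<in>B. c \<le> a \<or> b \<le> c) \<or> (\<forall>c\<in>B. b \<le> c \<and> c \<le> a)))"

definition thick :: "nat set set \<Rightarrow> nat set set" where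
  "thick P = {{Suc (2 * a), 2 * b} | a b. nxt P a b}"

section \<open>From a non-crossing partition back to a pairing\<close>

locale nc_partition =
  fixes A :: "nat set" and P :: "nat set set"
  assumes finA: "finite A" and part: "partition_on A P" and nc: "ncr (\<lambda>z. z) P"
begin

lemma fin_block: "B \<in> P \<Longrightarrow> finite B"
  using part by (intro finite_subset[OF _ finA]) (auto simp: partition_on_def)

lemma block_eq: "B \<in> P \<Longrightarrow> C \<in> P \<Longrightarrow> z \<in> B \<Longrightarrow> z \<in> C \<Longrightarrow> B = C"
  using part by (rule partition_on_unique)

lemma block_ex: "a \<in> A \<Longrightarrow> \<exists>B\<in>P. a \<in> B"
  using part by (auto simp: partition_on_def)

lemma block_sub: "B \<in> P \<Longrightarrow> a \<in> B \<Longrightarrow> a \<in> A"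
  using part by (auto simp: partition_on_def)

lemma nxt_ex:
  assumes "a \<in> A"
  shows "\<exists>b. nxt P a b"
proof -
  obtain B where B: "B \<in> P" "a \<in> B" using block_ex assms by auto
  have fin: "finite B" using fin_block B by simp
  show ?thesis
  proof (cases "\<exists>c\<in>B. a < c")
    case True
    let ?b = "Min {c \<in> B. a < c}"
    have "?b \<in> {c \<in> B. a < c}" by (rule Min_in) (use fin True in auto)
    moreover have "?b \<le> c" if "c \<in> B" "a < c" for c by (rule Min_le) (use fin that in auto)
    ultimately have "nxt P a ?b" unfolding nxt_def using B
      by (intro bexI[of _ B]) (auto simp: not_le[symmetric])
    then show ?thesis ..
  next
    case False
    have "Min B \<in> B" by (rule Min_in) (use fin B in auto)
    moreover have "Min B \<le> c" if "c \<in> B" for c using fin that by simp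
    ultimately have "nxt P a (Min B)" unfolding nxt_def using B False
      by (intro bexI[of _ B]) (auto simp: not_less)
    then show ?thesis ..
  qed
qed

lemma prv_ex:
  assumes "b \<in> A"
  shows "\<exists>a. nxt P a b"
proof -
  obtain B where B: "B \<in> P" "b \<in> B" using block_ex assms by auto
  have fin: "finite B" using fin_block B by simp
  show ?thesis
  proof (cases "\<exists>c\<in>B. c < b")
    case True
    let ?a = "Max {c \<in> B. c < b}"
    have "?a \<in> {c \<in> B. c < b}" by (rule Max_in) (use fin True in auto)
    moreover have "c \<le> ?a" if "c \<in> B" "c < b" for c by (rule Max_ge) (use fin that in auto)
    ultimately have "nxt P ?a b" unfolding nxt_def using B
      by (intro bexI[of _ B]) (auto simp: not_le[symmetric])
    then show ?thesis ..
  next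
    case False
    have "Max B \<in> B" by (rule Max_in) (use fin B in auto)
    moreover have "c \<le> Max B" if "c \<in> B" for c using fin that by simp
    ultimately have "nxt P (Max B) b" unfolding nxt_def using B False
      by (intro bexI[of _ B]) (auto simp: not_less)
    then show ?thesis ..
  qed
qed

lemma nxtE:
  assumes "nxt P a b"
  obtains B where "B \<in> P" "a \<in> B" "b \<in> B" "a < b" "\<And>c. c \<in> B \<Longrightarrow> c \<le> a \<or> b \<le> c"
  | B where "B \<in> P" "a \<in> B" "b \<in> B" "b \<le> a" "\<And>c. c \<in> B \<Longrightarrow> b \<le> c" "\<And>c. c \<in> B \<Longrightarrow> c \<le> a"
  using assms unfolding nxt_def by blast

lemma nxt_block: "nxt P a b \<Longrightarrow> B \<in> P \<Longrightarrow> a \<in> B \<Longrightarrow> b \<in> B"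
  unfolding nxt_def using block_eq by blast

lemma nxt_block': "nxt P a b \<Longrightarrow> B \<in> P \<Longrightarrow> b \<in> B \<Longrightarrow> a \<in> B"
  unfolding nxt_def using block_eq by blast

lemma nxt_fun:
  assumes "nxt P a b" "nxt P a b'"
  shows "b = b'"
  using assms(1)
proof (cases rule: nxtE)
  case (1 B)
  have "b' \<in> B" using nxt_block assms 1 by blast
  from assms(2) show ?thesis
  proof (cases rule: nxtE)
    case C: (1 C)
    then have "C = B" using block_eq 1 by blast
    then show ?thesis using C(5)[of b] 1(5)[of b'] \<open>b' \<in> B\<close> C 1 by auto
  next
    case C: (2 C)
    then have "C = B" using block_eq 1 by blast
    then show ?thesis using C(6)[of b] 1 by auto
  qed
next
  case (2 B)
  have "b' \<in> B" using nxt_block assms 2 by blast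
  from assms(2) show ?thesis
  proof (cases rule: nxtE)
    case C: (1 C)
    then have "C = B" using block_eq 2 by blast
    then show ?thesis using C 2(6)[of b'] by auto
  next
    case C: (2 C)
    then have "C = B" using block_eq 2 by blast
    then show ?thesis using C(5)[of b] 2(5)[of b'] 2(3) \<open>b' \<in> B\<close> by simp
  qed
qed

lemma nxt_inj:
  assumes "nxt P a b" "nxt P a' b"
  shows "a = a'"
  using assms(1)
proof (cases rule: nxtE)
  case (1 B)
  have "a' \<in> B" using nxt_block' assms 1 by blast
  from assms(2) show ?thesis
  proof (cases rule: nxtE)
    case C: (1 C)
    then have "C = B" using block_eq 1 by blast
    then show ?thesis using C(5)[of a] 1(5)[of a'] \<open>a' \<in> B\<close> C 1 by auto
  next
    case C: (2 C)
    then have "C = B" using block_eq 1 by blast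
    then show ?thesis using C(5)[of a] 1 by auto
  qed
next
  case (2 B)
  have "a' \<in> B" using nxt_block' assms 2 by blast
  from assms(2) show ?thesis
  proof (cases rule: nxtE)
    case C: (1 C)
    then have "C = B" using block_eq 2 by blast
    then show ?thesis using C 2(5)[of a'] by auto
  next
    case C: (2 C)
    then have "C = B" using block_eq 2 by blast
    then show ?thesis using C(6)[of a] 2(6)[of a'] 2(2) \<open>a' \<in> B\<close> by simp
  qed
qed

lemma nxt_in: "nxt P a b \<Longrightarrow> a \<in> A \<and> b \<in> A"
  unfolding nxt_def using block_sub by blast

lemma thickE:
  assumes "e \<in> thick P"
  obtains a b where "nxt P a b" "e = {Suc (2 * a), 2 * b}"
  using assms unfolding thick_def by blast

lemma thick_mem_eq:
  assumes "e \<in> thick P" "e' \<in> thick P" "z \<in> e" "z \<in> e'"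
  shows "e = e'"
proof -
  obtain a b where e: "nxt P a b" "e = {Suc (2 * a), 2 * b}" using thickE assms by blast
  obtain a' b' where e': "nxt P a' b'" "e' = {Suc (2 * a'), 2 * b'}" using thickE assms by blast
  have "a = a' \<or> b = b'" using assms(3,4) e(2) e'(2) by (auto, presburger+)
  then show ?thesis using e e' nxt_fun nxt_inj by blast
qed

lemma block_side:
  assumes "B \<in> P" "C \<in> P" "B \<noteq> C" "a \<in> B" "b \<in> B" "c \<in> C" "d \<in> C" "a < c" "c < b"
  shows "a < d \<and> d < b"
proof -
  have "d \<noteq> a" "d \<noteq> b" using block_eq assms by metis+
  moreover have "\<not> d < a" using ncrD[OF nc, of C B d c a b] assms by auto
  moreover have "\<not> b < d" using ncrD[OF nc, of B C a b c d] assms by auto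
  ultimately show ?thesis by simp
qed

text \<open>An arc between consecutive points spans a gap of its block, and another block that
  enters the gap stays in it. The wrap-around arc spans the whole block, hence also its other
  arcs.\<close>

lemma thick_inside:
  assumes e: "nxt P a b" and e': "nxt P c d" and ne: "a \<noteq> c"
    and z: "z \<in> {Suc (2 * c), 2 * d}" "w \<in> {Suc (2 * c), 2 * d}"
    and lt: "min (Suc (2 * a)) (2 * b) < z" "z < max (Suc (2 * a)) (2 * b)"
  shows "min (Suc (2 * a)) (2 * b) < w \<and> w < max (Suc (2 * a)) (2 * b)"
proof -
  have ne': "b \<noteq> d" using nxt_inj e e' ne by metis
  obtain C where C: "C \<in> P" "c \<in> C" "d \<in> C" using e' unfolding nxt_def by blast
  have zh: "z div 2 \<in> C" "w div 2 \<in> C" using z C by auto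
  from e show ?thesis
  proof (cases rule: nxtE)
    case (1 B)
    then have mm: "min (Suc (2 * a)) (2 * b) = Suc (2 * a)" "max (Suc (2 * a)) (2 * b) = 2 * b" by auto
    have zz: "a < z div 2" "z div 2 < b" using lt unfolding mm by auto
    then have "B \<noteq> C" using 1(5)[of "z div 2"] zh by auto
    then have "a < w div 2 \<and> w div 2 < b" using block_side[OF 1(1) C(1) _ 1(2,3) zh zz] by simp
    then show ?thesis unfolding mm by auto
  next
    case (2 B)
    have mm: "min (Suc (2 * a)) (2 * b) = 2 * b" "max (Suc (2 * a)) (2 * b) = Suc (2 * a)"
      using 2(4) by (simp_all add: min_def max_def)
    show ?thesis
    proof (cases "B = C")
      case True
      then have "b \<le> c" "c \<le> a" "b \<le> d" "d \<le> a" using 2 C by auto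
      then show ?thesis unfolding mm using z(2) ne ne' by auto
    next
      case False
      then have "z div 2 \<noteq> b" "z div 2 \<noteq> a" using zh block_eq 2 C by metis+
      then have zz: "b < z div 2" "z div 2 < a" using lt unfolding mm by auto
      then have "b < w div 2 \<and> w div 2 < a" using block_side[OF 2(1) C(1) False 2(3,2) zh zz] by simp
      then show ?thesis unfolding mm by auto
    qed
  qed
qed

lemma nc_pairing_thick: "nc_pairing A (thick P)"
proof
  show "finite A" by (rule finA)
  show "card B = 2" if Bt: "B \<in> thick P" for B
  proof -
    obtain a b where "nxt P a b" "B = {Suc (2 * a), 2 * b}" using thickE[OF Bt] .
    moreover have "Suc (2 * a) \<noteq> 2 * b" by presburger
    ultimately show ?thesis by simp
  qed
  show "partition_on (old A) (thick P)"
  proof (rule partition_onI)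
    show "\<Union>(thick P) = old A"
    proof (intro equalityI subsetI)
      fix z assume "z \<in> \<Union>(thick P)"
      then obtain a b where "nxt P a b" "z \<in> {Suc (2 * a), 2 * b}" using thickE by blast
      then show "z \<in> old A" using nxt_in by auto
    next
      fix z assume "z \<in> old A"
      then have h: "z div 2 \<in> A" by (simp add: old_iff)
      have "z = 2 * (z div 2) \<or> z = Suc (2 * (z div 2))" by presburger
      then show "z \<in> \<Union>(thick P)"
      proof
        assume z: "z = 2 * (z div 2)"
        obtain a where "nxt P a (z div 2)" using prv_ex h by blast
        then have "{Suc (2 * a), 2 * (z div 2)} \<in> thick P" unfolding thick_def by blast
        then show ?thesis using z by auto
      next
        assume z: "z = Suc (2 * (z div 2))"
        obtain b where "nxt P (z div 2) b" using nxt_ex h by blast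
        then have "{Suc (2 * (z div 2)), 2 * b} \<in> thick P" unfolding thick_def by blast
        then show ?thesis using z by (metis UnionI insertI1)
      qed
    qed
    show "{} \<notin> thick P" unfolding thick_def by auto
    show "disjnt e e'" if "e \<in> thick P" "e' \<in> thick P" "e \<noteq> e'" for e e'
      using that thick_mem_eq unfolding disjnt_def by blast
  qed
  show "ncr (\<lambda>z. z) (thick P)"
    unfolding ncr_def
  proof (intro ballI impI)
    fix e e' x y z w
    assume e: "e \<in> thick P" "e' \<in> thick P" "x \<in> e" "y \<in> e" "z \<in> e'" "w \<in> e'" and lt: "x < z" "z < y" "y < w"
    show "e = e'"
    proof (rule ccontr)
      assume ne: "e \<noteq> e'"
      obtain a b where ab: "nxt P a b" "e = {Suc (2 * a), 2 * b}" using thickE e by blast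
      obtain c d where cd: "nxt P c d" "e' = {Suc (2 * c), 2 * d}" using thickE e by blast
      have "a \<noteq> c" using ne ab cd nxt_fun by metis
      have "min (Suc (2 * a)) (2 * b) = x" "max (Suc (2 * a)) (2 * b) = y"
        using e(3,4) lt unfolding ab by auto
      then show False
        using thick_inside[OF ab(1) cd(1) \<open>a \<noteq> c\<close>, of z w] e(5,6) lt unfolding cd by simp
    qed
  qed
qed

text \<open>The inequality of \<open>u \<le> c\<close> and \<open>u < d\<close> says that the new
  point \<open>u\<close> lies under the arc with ends \<open>Suc (2 * c)\<close> and
  \<open>2 * d\<close>. So equivalent points are those lying under the same arcs.\<close>

lemma sim_thick_cover:
  "sim (thick P) u v \<longleftrightarrow> (\<forall>c d. nxt P c d \<longrightarrow> ((u \<le> c) \<noteq> (u < d)) = ((v \<le> c) \<noteq> (v < d)))"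
proof -
  have 1: "2 * u < Suc (2 * c) \<longleftrightarrow> u \<le> c" "2 * u < 2 * c \<longleftrightarrow> u < c" for u c :: nat by auto
  show ?thesis
  proof
    assume s: "sim (thick P) u v"
    show "\<forall>c d. nxt P c d \<longrightarrow> ((u \<le> c) \<noteq> (u < d)) = ((v \<le> c) \<noteq> (v < d))"
    proof (intro allI impI)
      fix c d assume "nxt P c d"
      then have "{Suc (2 * c), 2 * d} \<in> thick P" unfolding thick_def by blast
      from s[unfolded sim_def, rule_format, OF this, of "Suc (2 * c)" "2 * d"]
      show "((u \<le> c) \<noteq> (u < d)) = ((v \<le> c) \<noteq> (v < d))" by (simp add: 1) argo
    qed
  next
    assume R: "\<forall>c d. nxt P c d \<longrightarrow> ((u \<le> c) \<noteq> (u < d)) = ((v \<le> c) \<noteq> (v < d))"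
    show "sim (thick P) u v"
      unfolding sim_def
    proof (intro ballI)
      fix B z w assume B: "B \<in> thick P" "z \<in> B" "w \<in> B"
      obtain c d where cd: "nxt P c d" "B = {Suc (2 * c), 2 * d}" using thickE B by blast
      show "((2*u < z) \<noteq> (2*v < z)) \<longleftrightarrow> ((2*u < w) \<noteq> (2*v < w))"
      proof -
        have "z = Suc (2 * c) \<or> z = 2 * d" "w = Suc (2 * c) \<or> w = 2 * d" using B(2,3) unfolding cd(2) by auto
        then show ?thesis using R[rule_format, OF cd(1)] by (elim disjE; simp only: 1; argo)
      qed
    qed
  qed
qed

text \<open>An arc of another block lies over all of \<open>B\<close> or over none of it. Of the
  arcs of \<open>B\<close> itself, the inner ones cover no point of \<open>B\<close> and the
  wrap-around arc covers all of them.\<close>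

lemma sim_thick_same:
  assumes B: "B \<in> P" "u \<in> B" "v \<in> B"
  shows "sim (thick P) u v"
proof -
  have *: "((v \<le> c) \<noteq> (v < d))" if cd: "nxt P c d" "((u \<le> c) \<noteq> (u < d))" and B: "B \<in> P" "u \<in> B" "v \<in> B" for c d u v
    using cd(1)
  proof (cases rule: nxtE)
    case (1 C)
    then have lt: "c < u" "u < d" using cd(2) by auto
    then have "C \<noteq> B" using 1(5)[of u] B by auto
    then show ?thesis using block_side[OF 1(1) B(1) _ 1(2,3) B(2,3) lt] by auto
  next
    case (2 C)
    then have le: "d \<le> u" "u \<le> c" using cd(2) 2(4) by linarith+
    show ?thesis
    proof (cases "C = B")
      case True
      then show ?thesis using 2(5)[of v] 2(6)[of v] B by auto
    next
      case False
      then have "d \<noteq> u" "u \<noteq> c" using block_eq B 2 by metis+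
      then show ?thesis using block_side[OF 2(1) B(1) False 2(3,2) B(2,3)] le by auto
    qed
  qed
  show ?thesis unfolding sim_thick_cover using *[OF _ _ B] *[OF _ _ B(1,3,2)] by blast
qed

text \<open>Equivalence puts \<open>v\<close> into the span of \<open>B\<close> and \<open>u\<close>
  into the span of \<open>C\<close>. Two different non-crossing blocks cannot both reach into each
  other in this way when \<open>u < v\<close>.\<close>

lemma sim_thick_diff:
  assumes B: "B \<in> P" "C \<in> P" "u \<in> B" "v \<in> C" "u < v" "sim (thick P) u v"
  shows "B = C"
proof (rule ccontr)
  assume ne: "B \<noteq> C"
  \<comment> \<open>The wrap-around arc runs from the last to the first point, so testing it
    compares a point with the span of the block.\<close>
  have outer: "nxt P (Max D) (Min D)" if "D \<in> P" "x \<in> D" for D x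
  proof -
    have "D \<noteq> {}" "finite D" using that fin_block by auto
    then show ?thesis unfolding nxt_def using that(1) by (intro bexI[of _ D]) auto
  qed
  have "Min B \<le> u" "u \<le> Max B" using fin_block B by auto
  then have v: "Min B \<le> v" "v \<le> Max B"
    using B(6)[unfolded sim_thick_cover, rule_format, OF outer[OF B(1,3)]] by auto
  have "Min C \<le> v" "v \<le> Max C" using fin_block B by auto
  then have u: "Min C \<le> u" "u \<le> Max C"
    using B(6)[unfolded sim_thick_cover, rule_format, OF outer[OF B(2,4)]] by auto
  have mB: "Min B \<in> B" "Max B \<in> B" and mC: "Min C \<in> C"
    using fin_block B by (auto intro!: Min_in Max_in)
  have "v \<noteq> Max B" "Min C \<noteq> u" using block_eq ne B mB mC by metis+
  then have "Min C < u" "v < Max B" using u v by auto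
  \<comment> \<open>Here \<open>u\<close> lies in \<open>B\<close> strictly between the points
    \<open>Min C\<close> and \<open>v\<close> of \<open>C\<close>, which forces \<open>Max B\<close>
    below \<open>v\<close>; this is excluded by \<open>v < Max B\<close>.\<close>
  then have "Min C < Min B \<and> Max B < v \<or> False" if "Min C < Min B"
    using block_side[OF B(2,1) ne[symmetric] mC B(4) B(3) mB(2)] B(5) by auto
  moreover have "\<not> Min B \<le> Min C"
  proof
    assume "Min B \<le> Min C"
    then have "Min B < Min C" using block_eq ne B(1,2) mB mC by (metis order_le_less)
    then show False
      using block_side[OF B(1,2) ne mB(1) B(3) mC B(4)] \<open>Min C < u\<close> B(5) by auto
  qed
  ultimately show False using \<open>v < Max B\<close> by auto
qed

lemma fat_thick: "fat (thick P) = P"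
proof -
  interpret T: nc_pairing A "thick P" by (rule nc_pairing_thick)
  have "B \<in> fat (thick P)" if B: "B \<in> P" for B
  proof -
    obtain u where u: "u \<in> B" using B part by (metis partition_on_def ex_in_conv)
    then obtain K where K: "K \<in> fat (thick P)" "u \<in> K"
      using T.partition_fat block_sub[OF B] by (auto simp: partition_on_def)
    have "v \<in> K \<longleftrightarrow> v \<in> B" for v
    proof -
      have "v \<in> B" if "v \<in> A" "sim (thick P) u v"
      proof -
        obtain C where C: "C \<in> P" "v \<in> C" using block_ex \<open>v \<in> A\<close> by blast
        then have "B = C"
          using sim_thick_diff[OF B C(1) u C(2)] sim_thick_diff[OF C(1) B C(2) u] that sim_sym[of "thick P" u v]
            block_eq[OF B C(1) u] by (metis linorder_neqE_nat)
        then show ?thesis using C by simp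
      qed
      then show ?thesis using T.fat_sim[OF K] sim_thick_same[OF B u] block_sub[OF B] by auto
    qed
    then have "K = B" by blast
    then show ?thesis using K by simp
  qed
  then have sub: "P \<subseteq> fat (thick P)" by blast
  show ?thesis
  proof (rule equalityI)
    show "P \<subseteq> fat (thick P)" by (rule sub)
    show "fat (thick P) \<subseteq> P"
    proof
      fix K assume K: "K \<in> fat (thick P)"
      then have "K \<noteq> {}" using T.partition_fat by (auto simp: partition_on_def)
      then obtain u where u: "u \<in> K" by blast
      then have "u \<in> A" using T.partition_fat K by (auto simp: partition_on_def)
      then obtain B where B: "B \<in> P" "u \<in> B" using block_ex by blast
      then have "K = B" using partition_on_unique[OF T.partition_fat K _ u B(2)] sub by blast
      then show "K \<in> P" using B by simp
    qed
  qed
qed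

end

section \<open>Capping off adjacent points\<close>

lemma components_insert_inside:
  assumes "B \<noteq> {}" "B \<subseteq> K" "K \<in> components S"
  shows "components (insert B S) = components S"
proof -
  have K: "{L \<in> components S. L \<inter> B \<noteq> {}} = {K}"
  proof -
    have "L = K" if L: "L \<in> components S" "L \<inter> B \<noteq> {}" for L
    proof -
      obtain x where "x \<in> L" "x \<in> B" using L(2) by blast
      then show ?thesis using components_disjoint[OF L(1) assms(3)] assms(2) by blast
    qed
    moreover have "K \<inter> B \<noteq> {}" using assms(1,2) by blast
    ultimately show "{L \<in> components S. L \<inter> B \<noteq> {}} = {K}" using assms(3) by blast
  qed
  have "components S = {L \<in> components S. L \<inter> B \<noteq> {}} \<union> {L \<in> components S. L \<inter> B = {}}" by auto
  then have "components S = insert K {L \<in> components S. L \<inter> B = {}}" unfolding K by simp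
  moreover have "B \<subseteq> \<Union>S" using assms(2) component_subset[OF assms(3)] by simp
  then have "components (insert B S) = insert K {L \<in> components S. L \<inter> B = {}}"
    using components_insert[OF assms(1), of S] unfolding K by simp
  ultimately show ?thesis by simp
qed

lemma components_insert_two:
  assumes "components S = insert K (insert L R)" "B \<subseteq> K \<union> L" "B \<inter> K \<noteq> {}" "B \<inter> L \<noteq> {}"
    and "K \<notin> R" "L \<notin> R"
  shows "components (insert B S) = insert (K \<union> L) R"
proof -
  have KL: "K \<in> components S" "L \<in> components S" using assms(1) by auto
  have dis: "N \<inter> B = {}" if "N \<in> R" for N
  proof -
    have N: "N \<in> components S" using assms(1) that by simp
    have "N \<noteq> K" "N \<noteq> L" using that assms(5,6) by auto
    then have "N \<inter> K = {}" "N \<inter> L = {}" using components_disjoint[OF N KL(1)] components_disjoint[OF N KL(2)] by blast+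
    then show ?thesis using assms(2) by blast
  qed
  have "{N \<in> components S. N \<inter> B \<noteq> {}} = {K, L}" unfolding assms(1) using dis assms(3,4) by blast
  moreover have "{N \<in> components S. N \<inter> B = {}} = R" unfolding assms(1) using dis assms(3,4) by blast
  moreover have "B \<noteq> {}" using assms(3) by blast
  moreover have "B \<subseteq> \<Union>S" using assms(2) component_subset[OF KL(1)] component_subset[OF KL(2)] by blast
  ultimately show ?thesis using components_insert[of B S] by simp
qed

text \<open>If \<open>z\<close> and \<open>w\<close> are paired with each other, the cap closes a
  loop and leaves no block behind. Otherwise their partners become a new pair, and all other blocks
  survive.\<close>

lemma cap_blocks:
  assumes P: "partition_on Z \<pi>" and two: "\<And>B. B \<in> \<pi> \<Longrightarrow> card B = 2"
    and zw: "z \<in> Z" "w \<in> Z" "z \<noteq> w" and B: "B \<in> elim {z, w} (insert {z, w} \<pi>)"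
  shows "B \<in> \<pi> \<and> z \<notin> B \<and> w \<notin> B \<or>
    (\<exists>z' w'. {z, z'} \<in> \<pi> \<and> {w, w'} \<in> \<pi> \<and> B = {z', w'} \<and> z' \<noteq> z \<and> z' \<noteq> w \<and> w' \<noteq> z \<and> w' \<noteq> w \<and> z' \<noteq> w')"
proof -
  have U: "\<Union>\<pi> = Z" using P by (simp add: partition_on_def)
  obtain Bz Bw where Bz: "Bz \<in> \<pi>" "z \<in> Bz" and Bw: "Bw \<in> \<pi>" "w \<in> Bw"
    using partition_on_ex[OF P] zw by blast
  have "{K \<in> \<pi>. K \<inter> {z, w} \<noteq> {}} = {Bz, Bw}"
    using Bz Bw partition_on_unique[OF P] by blast
  then have c: "components (insert {z, w} \<pi>) = insert (Bz \<union> Bw) {K \<in> \<pi>. K \<inter> {z, w} = {}}"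
    using components_insert[of "{z, w}" \<pi>] zw U unfolding components_partition[OF P] by simp
  obtain K where K: "K \<in> components (insert {z, w} \<pi>)" "B = K - {z, w}" "B \<noteq> {}"
    using B unfolding elim_def by auto
  show ?thesis
  proof (cases "K = Bz \<union> Bw")
    case True
    obtain z' where z': "Bz = {z, z'}" "z' \<noteq> z" using two[OF Bz(1)] Bz(2) by (metis card_2_iff doubleton_eq_iff insertE singletonD)
    obtain w' where w': "Bw = {w, w'}" "w' \<noteq> w" using two[OF Bw(1)] Bw(2) by (metis card_2_iff doubleton_eq_iff insertE singletonD)
    have ne: "z' \<noteq> w"
    proof
      assume "z' = w"
      then have "Bz = Bw" using partition_on_unique[OF P Bz(1) Bw(1), of w] z' Bw by simp
      then show False using True K(2,3) z' w' \<open>z' = w\<close> by auto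
    qed
    have "Bz \<noteq> Bw" using ne z' Bw(2) zw(3) by auto
    then have "z' \<noteq> w'" "w' \<noteq> z"
      using partition_on_unique[OF P Bz(1) Bw(1), of z'] partition_on_unique[OF P Bz(1) Bw(1), of z] z' w' by auto
    then have "{z, z'} \<in> \<pi> \<and> {w, w'} \<in> \<pi> \<and> B = {z', w'} \<and> z' \<noteq> z \<and> z' \<noteq> w \<and> w' \<noteq> z \<and> w' \<noteq> w \<and> z' \<noteq> w'"
      using Bz(1) Bw(1) z' w' ne True K(2) by auto
    then show ?thesis by blast
  next
    case False
    then have "K \<in> \<pi>" "K \<inter> {z, w} = {}" using K(1) unfolding c by auto
    moreover then have "B = K" using K(2) by blast
    ultimately show ?thesis by blast
  qed
qed

text \<open>No point lies between \<open>z\<close> and \<open>w\<close>, so every other point has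
  both on the same side. A crossing with the new pair would thus already be a crossing with one of
  the two pairs it came from.\<close>

lemma cap_nc_pairing:
  fixes z w :: nat
  assumes P: "partition_on Z \<pi>" and two: "\<And>B. B \<in> \<pi> \<Longrightarrow> card B = 2" and nc: "ncr (\<lambda>z. z) \<pi>"
    and zw: "z \<in> Z" "w \<in> Z" "z < w" and adj: "\<And>v. v \<in> Z \<Longrightarrow> \<not> (z < v \<and> v < w)"
  defines "\<rho> \<equiv> elim {z, w} (insert {z, w} \<pi>)"
  shows "partition_on (Z - {z, w}) \<rho>" and "\<And>B. B \<in> \<rho> \<Longrightarrow> card B = 2" and "ncr (\<lambda>z. z) \<rho>"
proof -
  have "\<Union>(insert {z, w} \<pi>) = Z" using P zw by (auto simp: partition_on_def)
  then show part: "partition_on (Z - {z, w}) \<rho>" unfolding \<rho>_def using partition_on_elim[of "insert {z, w} \<pi>" "{z, w}"] by simp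
  have bl: "B \<in> \<pi> \<and> z \<notin> B \<and> w \<notin> B \<or>
    (\<exists>z' w'. {z, z'} \<in> \<pi> \<and> {w, w'} \<in> \<pi> \<and> B = {z', w'} \<and> z' \<noteq> z \<and> z' \<noteq> w \<and> w' \<noteq> z \<and> w' \<noteq> w \<and> z' \<noteq> w')"
    if "B \<in> \<rho>" for B
    using cap_blocks[OF P two zw(1,2)] zw(3) that unfolding \<rho>_def by simp
  show "card B = 2" if "B \<in> \<rho>" for B using bl[OF that] two by auto
  have side: "v < z \<longleftrightarrow> v < w" "z < v \<longleftrightarrow> w < v" if "v \<in> Z - {z, w}" for v
    using adj[of v] that zw(3) by auto
  have mem: "v \<in> Z - {z, w}" if "B \<in> \<rho>" "v \<in> B" for B v
    using part that by (auto simp: partition_on_def)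
  have cap: "\<exists>e\<in>{z, w}. {v, e} \<in> \<pi>" if "{z, z'} \<in> \<pi>" "{w, w'} \<in> \<pi>" "v \<in> {z', w'}" for v z' w'
    using that by (auto simp: insert_commute)
  show "ncr (\<lambda>z. z) \<rho>"
    unfolding ncr_def
  proof (intro ballI impI, rule ccontr)
    fix B C a c b d
    assume B: "B \<in> \<rho>" "C \<in> \<rho>" "a \<in> B" "c \<in> B" "b \<in> C" "d \<in> C" and lt: "a < b" "b < c" "c < d" and ne: "B \<noteq> C"
    have m: "a \<in> Z - {z, w}" "b \<in> Z - {z, w}" "c \<in> Z - {z, w}" "d \<in> Z - {z, w}" using mem B by blast+
    have ef: "v < g \<longleftrightarrow> v < z" "g < v \<longleftrightarrow> z < v" if "v \<in> Z - {z, w}" "g \<in> {z, w}" for v g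
      using side[OF that(1)] that(2) by auto
    have ne_z: "v < z \<or> z < v" if "v \<in> Z - {z, w}" for v using that by auto
    have nocross: False if "{p, q} \<in> \<pi>" "{r, t} \<in> \<pi>" "p < r" "r < q" "q < t" for p q r t
    proof -
      have "{p, q} = {r, t}" by (rule ncrD[OF nc that(1,2), of p q r t]) (use that in auto)
      then show False using that(3-) by (auto simp: doubleton_eq_iff)
    qed
    have Beq: "B = {a, c}" if "card B = 2" using that B(3,4) lt by (auto simp: card_2_iff)
    have Ceq: "C = {b, d}" if "card C = 2" using that B(5,6) lt by (auto simp: card_2_iff)
    from bl[OF B(1)] show False
    proof
      assume B1: "B \<in> \<pi> \<and> z \<notin> B \<and> w \<notin> B"
      then have ac: "{a, c} \<in> \<pi>" using Beq two by auto
      from bl[OF B(2)] show False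
      proof
        assume C1: "C \<in> \<pi> \<and> z \<notin> C \<and> w \<notin> C"
        then have "{b, d} \<in> \<pi>" using Ceq two by auto
        then show False using nocross[OF ac] lt by blast
      next
        assume "\<exists>z' w'. {z, z'} \<in> \<pi> \<and> {w, w'} \<in> \<pi> \<and> C = {z', w'} \<and> z' \<noteq> z \<and> z' \<noteq> w \<and> w' \<noteq> z \<and> w' \<noteq> w \<and> z' \<noteq> w'"
        then obtain e f where e: "e \<in> {z, w}" "{b, e} \<in> \<pi>" and f: "f \<in> {z, w}" "{d, f} \<in> \<pi>"
          using cap B(5,6) by metis
        have fd: "{f, d} \<in> \<pi>" "{e, b} \<in> \<pi>" using e f by (simp_all add: insert_commute)
        \<comment> \<open>The arc from \<open>a\<close> to \<open>c\<close> separates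
          \<open>b\<close> from \<open>d\<close>, and the capped points lie together on one side of
          it. If they are outside the arc, the old arc of \<open>b\<close> crosses it; if inside,
          that of \<open>d\<close>.\<close>
        consider "z < a" | "a < z" "z < c" | "c < z" using ne_z[OF m(1)] ne_z[OF m(3)] by blast
        then consider "e < a" "f < a" | "a < e" "e < c" "a < f" "f < c" | "c < e" "c < f"
          by cases (simp_all add: ef[OF m(1) e(1)] ef[OF m(3) e(1)] ef[OF m(1) f(1)] ef[OF m(3) f(1)])
        then show False
        proof cases
          case 1 then show False using nocross[OF fd(2) ac] lt by blast
        next
          case 2 then show False using nocross[OF ac fd(1)] lt by blast
        next
          case 3 then show False using nocross[OF ac e(2)] lt by blast
        qed
      qed
    next
      assume "\<exists>z' w'. {z, z'} \<in> \<pi> \<and> {w, w'} \<in> \<pi> \<and> B = {z', w'} \<and> z' \<noteq> z \<and> z' \<noteq> w \<and> w' \<noteq> z \<and> w' \<noteq> w \<and> z' \<noteq> w'"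
      then obtain z' w' where zw': "{z, z'} \<in> \<pi>" "{w, w'} \<in> \<pi>" "B = {z', w'}" by blast
      then obtain e f where e: "e \<in> {z, w}" "{a, e} \<in> \<pi>" and f: "f \<in> {z, w}" "{c, f} \<in> \<pi>"
        using cap B(3,4) by metis
      have fd: "{f, c} \<in> \<pi>" "{e, a} \<in> \<pi>" using e f by (simp_all add: insert_commute)
      from bl[OF B(2)] show False
      proof
        assume C1: "C \<in> \<pi> \<and> z \<notin> C \<and> w \<notin> C"
        then have bd: "{b, d} \<in> \<pi>" using Ceq two by auto
        consider "z < b" | "b < z" "z < d" | "d < z" using ne_z[OF m(2)] ne_z[OF m(4)] by blast
        then consider "e < b" "f < b" | "b < e" "e < d" "b < f" "f < d" | "d < e" "d < f"
          by cases (simp_all add: ef[OF m(2) e(1)] ef[OF m(4) e(1)] ef[OF m(2) f(1)] ef[OF m(4) f(1)])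
        then show False
        proof cases
          case 1 then show False using nocross[OF fd(1) bd] lt by blast
        next
          case 2 then show False using nocross[OF e(2) bd] lt by blast
        next
          case 3 then show False using nocross[OF bd f(2)] lt by blast
        qed
      next
        assume "\<exists>z' w'. {z, z'} \<in> \<pi> \<and> {w, w'} \<in> \<pi> \<and> C = {z', w'} \<and> z' \<noteq> z \<and> z' \<noteq> w \<and> w' \<noteq> z \<and> w' \<noteq> w \<and> z' \<noteq> w'"
        \<comment> \<open>One cap creates at most one new pair, so \<open>B\<close> and
          \<open>C\<close> coincide.\<close>
        then obtain z'' w'' where "{z, z''} \<in> \<pi>" "{w, w''} \<in> \<pi>" "C = {z'', w''}" by blast
        moreover then have "{z, z''} = {z, z'}" "{w, w''} = {w, w'}"
          using partition_on_unique[OF P] zw' by blast+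
        ultimately show False using ne zw' by (metis doubleton_eq_iff)
      qed
    qed
  qed
qed

text \<open>Joining the adjacent new points \<open>x\<close> and \<open>y\<close> amounts to two caps on the old points. Each component of
  the pairing together with the pairs \<open>{2 * a, 2 * a + 1}\<close>, \<open>a \<noteq> x, y\<close>, contains an even number of the four
  capped points. If \<open>x\<close> and \<open>y\<close> lie in the same fattened block, then the inner cap closes a loop,
  because the only two old points between \<open>x\<close> and \<open>y\<close> are paired with each other.\<close>

lemma (in nc_pairing) cap_step:
  assumes xy: "x \<in> A" "y \<in> A" "x < y" and adj: "\<And>c. c \<in> A \<Longrightarrow> \<not> (x < c \<and> c < y)"
  defines "E \<equiv> {{Suc (2 * x), 2 * y}, {2 * x, Suc (2 * y)}}"
  defines "\<rho> \<equiv> elim (old {x, y}) (\<pi> \<union> E)"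
  shows "nc_pairing (A - {x, y}) \<rho>"
    and "fat \<rho> = elim {x, y} (fat \<pi> \<union> {{x, y}})"
    and "nin (old {x, y}) (\<pi> \<union> E) + card (fat \<pi>)
      = 1 + card (fat \<rho>) + 2 * nin {x, y} (fat \<pi> \<union> {{x, y}})"
proof -
  let ?e = "{Suc (2 * x), 2 * y}" and ?f = "{2 * x, Suc (2 * y)}"
  let ?M = "old {x, y}" and ?A' = "A - {x, y}"
  have M: "?M = {2 * x, Suc (2 * x), 2 * y, Suc (2 * y)}" by (auto simp: old_conv)
  let ?\<rho>1 = "elim ?e (insert ?e \<pi>)"
  have adj1: "\<not> (Suc (2 * x) < v \<and> v < 2 * y)" if "v \<in> old A" for v
    using adj[of "v div 2"] that by (auto simp: old_iff)
  have o1: "Suc (2 * x) \<in> old A" "2 * y \<in> old A" "Suc (2 * x) < 2 * y" using xy by auto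
  note c1 = cap_nc_pairing[OF part two nc o1 adj1]
  let ?Z1 = "old A - ?e"
  have parity_ne: "2 * a \<noteq> Suc (2 * b)" "Suc (2 * b) \<noteq> 2 * a" for a b :: nat by presburger+
  have o2: "2 * x \<in> ?Z1" "Suc (2 * y) \<in> ?Z1" "2 * x < Suc (2 * y)"
    using xy by (simp_all add: parity_ne)
  \<comment> \<open>Once the inner cap has consumed its ends, nothing is left between the ends of
    the outer one.\<close>
  have adj2: "\<not> (2 * x < v \<and> v < Suc (2 * y))" if "v \<in> ?Z1" for v
  proof
    assume "2 * x < v \<and> v < Suc (2 * y)"
    then have "Suc (2 * x) < v \<and> v < 2 * y" using that by auto
    then show False using adj1 that by blast
  qed
  note c2 = cap_nc_pairing[OF c1 o2 adj2]
  have \<rho>2: "elim ?f (insert ?f ?\<rho>1) = \<rho>"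
  proof -
    have "\<Union>{?f} \<inter> ?e = {}" using xy by (simp add: parity_ne)
    from elim_elim_Un[OF this, of ?f "insert ?e \<pi>"]
    have "elim ?f (?\<rho>1 \<union> {?f}) = elim (?e \<union> ?f) (insert ?e \<pi> \<union> {?f})" .
    moreover have "?e \<union> ?f = ?M" "insert ?e \<pi> \<union> {?f} = \<pi> \<union> E" unfolding M E_def by auto
    ultimately show ?thesis unfolding \<rho>_def by simp
  qed
  have Z2: "?Z1 - ?f = old ?A'" unfolding old_Diff M by auto
  show nc\<rho>: "nc_pairing ?A' \<rho>"
    using c2 finA unfolding \<rho>2 Z2 by unfold_locales auto

  \<comment> \<open>All couples except those at \<open>x\<close> and \<open>y\<close> are glued, so
    that the thickened blocks stay cut open at these two points. All counts below are made relative
    to the components of \<open>?S\<close>.\<close>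
  let ?T = "(\<lambda>a. {2 * a, Suc (2 * a)}) ` ?A'"
  let ?S = "\<pi> \<union> ?T"
  let ?h = "\<lambda>z::nat. z div 2"
  have U\<pi>: "\<Union>\<pi> = old A" using part by (simp add: partition_on_def)
  have UT: "\<Union>?T = old ?A'" by (auto simp: old_conv)
  have TM: "\<Union>?T \<inter> ?M = {}" unfolding UT by (auto simp: old_iff)
  have MA: "?M \<subseteq> old A" using xy by (auto simp: old_iff)
  have ME: "M0 \<subseteq> \<Union>?S" if "M0 \<subseteq> ?M" for M0 using that MA U\<pi> by auto
  have US: "\<Union>?S = old A" unfolding Union_Un_distrib U\<pi> UT by (auto simp: old_Diff)
  have partT: "partition_on (old ?A') ?T"
  proof (rule partition_onI)
    show "disjnt p q" if pq: "p \<in> ?T" "q \<in> ?T" "p \<noteq> q" for p q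
    proof -
      obtain a b where "p = {2 * a, Suc (2 * a)}" "q = {2 * b, Suc (2 * b)}" using pq(1,2) by auto
      moreover have "a \<noteq> b" using calculation pq(3) by auto
      ultimately show ?thesis by (simp add: disjnt_def parity_ne)
    qed
  qed (use UT in auto)
  have even: "even (card (K \<inter> ?M))" if K: "K \<in> components ?S" for K
  proof -
    have Ko: "K \<subseteq> old A" using component_subset[OF K] US by simp
    have fin: "finite K" using Ko finite_subset by fastforce
    have "even (card K)"
    proof (rule even_card_saturated[OF part two Ko])
      fix B u v assume "B \<in> \<pi>" "u \<in> B" "u \<in> K" "v \<in> B"
      then show "v \<in> K" using component_saturated[OF K, of B u v] by simp
    qed
    moreover have "even (card (K \<inter> old ?A'))"
    proof (rule even_card_saturated[OF partT])
      show "card B = 2" if "B \<in> ?T" for B using that by auto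
      show "v \<in> K \<inter> old ?A'" if "B \<in> ?T" "u \<in> B" "u \<in> K \<inter> old ?A'" "v \<in> B" for B u v
        using that component_saturated[OF K, of B u v] UT by auto
    qed auto
    moreover have "K = (K \<inter> ?M) \<union> (K \<inter> old ?A')" "(K \<inter> ?M) \<inter> (K \<inter> old ?A') = {}"
      using Ko by (auto simp: old_iff)
    then have "card K = card (K \<inter> ?M) + card (K \<inter> old ?A')"
      using fin by (metis card_Un_disjoint finite_Int)
    ultimately show ?thesis by simp
  qed
  have con_sim: "sim \<pi> (u div 2) (v div 2)" if "K \<in> components ?S" "u \<in> K" "v \<in> K" for K u v
  proof -
    have "(u, v) \<in> conn ?S" using component_conn_iff[OF that(1,2)] that(3) by simp
    then have "v \<in> {v. sim \<pi> (u div 2) (v div 2)}"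
    proof (rule conn_closed)
      show "u \<in> {v. sim \<pi> (u div 2) (v div 2)}" by (simp add: sim_refl)
      fix B z w assume B: "B \<in> ?S" "z \<in> B" "z \<in> {v. sim \<pi> (u div 2) (v div 2)}" "w \<in> B"
      have "sim \<pi> (z div 2) (w div 2)"
      proof (cases "B \<in> \<pi>")
        case True
        then obtain a where "a \<in> A" "B = {Suc (2 * a), 2 * \<sigma> a}" using arc_ex by blast
        then have "z div 2 \<in> {a, \<sigma> a}" "w div 2 \<in> {a, \<sigma> a}" "sim \<pi> a (\<sigma> a)"
          using B(2,4) sim_\<sigma>[of a] by auto
        then show ?thesis using sim_sym[of \<pi> a "\<sigma> a"] by (auto simp: sim_refl)
      next
        case False
        then have "z div 2 = w div 2" using B by auto
        then show ?thesis by (simp add: sim_refl)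
      qed
      then show "w \<in> {v. sim \<pi> (u div 2) (v div 2)}"
        using B(3) sim_trans[of \<pi> "u div 2" "z div 2" "w div 2"] by simp
    qed
    then show ?thesis by simp
  qed
  have xyU: "2 * x \<in> \<Union>?S" "2 * y \<in> \<Union>?S" unfolding US using xy by simp_all
  obtain X where X: "X \<in> components ?S" "2 * x \<in> X" using component_ex[OF xyU(1)] by (elim bexE)
  obtain Y where Y: "Y \<in> components ?S" "2 * y \<in> Y" using component_ex[OF xyU(2)] by (elim bexE)
  define R where "R = {K \<in> components ?S. K \<inter> ?M = {}}"
  have finC: "finite (components ?S)" by (rule finite_components) (simp only: US finite_oldA)
  have finR: "finite R" unfolding R_def using finC by simp
  have RM: "K - ?M = K" "\<not> K \<subseteq> ?M" "K \<noteq> {}" if "K \<in> R" for K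
    using that components_nonempty unfolding R_def by blast+
  have memM: "v \<in> {2 * x, Suc (2 * x), 2 * y, Suc (2 * y)}" if "v \<in> ?M" for v using that M by simp
  \<comment> \<open>The first alternative occurs when \<open>x\<close> and \<open>y\<close> belong
    to different fattened blocks. The second occurs when they belong to the same one: then
    \<open>\<sigma> x = y\<close>, so the ends of the inner cap form an isolated pair.\<close>
  have key: "X \<noteq> Y \<and> (Suc (2 * x) \<in> X \<and> Suc (2 * y) \<in> Y \<or> Y = ?e \<and> Suc (2 * y) \<in> X)"
  proof (cases "sim \<pi> x y")
    case True
    then have "x < \<sigma> x" "\<sigma> x \<le> y" using sim_less xy by auto
    then have "\<sigma> x = y" using adj[of "\<sigma> x"] \<sigma>_in xy by auto
    then have e\<pi>: "?e \<in> \<pi>" using arc_in[OF xy(1)] by simp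
    have eT: "?e \<inter> \<Union>?T = {}" unfolding UT by (auto simp: old_iff)
    have sat: "v \<in> ?e" if "B \<in> ?S" "u \<in> B" "u \<in> ?e" "v \<in> B" for B u v
    proof (cases "B \<in> \<pi>")
      case True
      then have "B = ?e" using block_eq[OF True e\<pi> that(2,3)] by simp
      then show ?thesis using that by simp
    next
      case False
      then show ?thesis using that eT by blast
    qed
    have Ye: "Y = ?e"
    proof
      show "Y \<subseteq> ?e"
      proof
        fix v assume "v \<in> Y"
        then have "(2 * y, v) \<in> conn ?S" using component_conn_iff[OF Y] by simp
        then show "v \<in> ?e" by (rule conn_closed) (simp, rule sat)
      qed
      show "?e \<subseteq> Y" using component_saturated[OF Y(1), of ?e "2 * y"] Y(2) e\<pi> by auto
    qed
    then have ne: "X \<noteq> Y" using X(2) xy by (auto simp: parity_ne)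
    have "Suc (2 * y) \<in> X"
    proof (rule ccontr)
      assume n: "Suc (2 * y) \<notin> X"
      have "X \<inter> Y = {}" using components_disjoint[OF X(1) Y(1)] ne by blast
      then have "X \<inter> ?M = {2 * x}" using n X(2) Ye unfolding M by auto
      then show False using even[OF X(1)] by simp
    qed
    then show ?thesis using ne Ye by simp
  next
    case False
    have XM: "2 * y \<notin> X" "Suc (2 * y) \<notin> X" using con_sim[OF X(1,2)] False by fastforce+
    have YM: "2 * x \<notin> Y" "Suc (2 * x) \<notin> Y"
      using con_sim[OF Y(1,2)] False sim_sym[of \<pi> y x] by fastforce+
    have "Suc (2 * x) \<in> X"
    proof (rule ccontr)
      assume n: "Suc (2 * x) \<notin> X"
      then have "X \<inter> ?M = {2 * x}" using X(2) XM unfolding M by auto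
      then show False using even[OF X(1)] by simp
    qed
    moreover have "Suc (2 * y) \<in> Y"
    proof (rule ccontr)
      assume n: "Suc (2 * y) \<notin> Y"
      then have "Y \<inter> ?M = {2 * y}" using Y(2) YM unfolding M by auto
      then show False using even[OF Y(1)] by simp
    qed
    ultimately show ?thesis using XM Y(2) by auto
  qed
  have MXY: "?M \<subseteq> X \<union> Y" using key X(2) Y(2) unfolding M by auto
  have CS: "components ?S = insert X (insert Y R)"
  proof (intro equalityI subsetI)
    fix K assume K: "K \<in> components ?S"
    show "K \<in> insert X (insert Y R)"
    proof (cases "K \<inter> ?M = {}")
      case False
      then obtain v where "v \<in> K" "v \<in> X \<or> v \<in> Y" using MXY by blast
      then show ?thesis using components_disjoint[OF K X(1)] components_disjoint[OF K Y(1)] by auto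
    qed (use K in \<open>simp add: R_def\<close>)
  qed (use X Y in \<open>auto simp: R_def\<close>)
  have XR: "X \<notin> R" using X(2) unfolding R_def M by auto
  have YR: "Y \<notin> R" using Y(2) unfolding R_def M by auto
  have neXY: "X \<noteq> Y" using key by simp
  define U where "U = X \<union> Y"
  \<comment> \<open>\<open>e\<close> counts a loop of the fattened blocks: it is 1 when nothing
    outside the four capped points hangs on the joined component.\<close>
  define e :: nat where "e = (if U \<subseteq> ?M then 1 else 0)"
  have UR: "U \<notin> R" using X(2) unfolding U_def R_def M by auto
  have Une: "U \<noteq> {}" using X(2) unfolding U_def by auto
  have UmR: "U - ?M \<notin> R"
  proof
    assume a: "U - ?M \<in> R"
    then have K: "U - ?M \<in> components ?S" unfolding R_def by simp
    obtain v where v: "v \<in> U - ?M" using RM(3)[OF a] by blast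
    then have "v \<in> X \<or> v \<in> Y" unfolding U_def by simp
    then have "U - ?M = X \<or> U - ?M = Y"
      using components_disjoint[OF K X(1) v] components_disjoint[OF K Y(1) v] by blast
    then show False using XR YR a by auto
  qed
  \<comment> \<open>Joining the new points \<open>x\<close> and \<open>y\<close> means inserting all
    four old points as a single block. It is compared below with the two separate caps
    \<open>E\<close>.\<close>
  have MU: "components (insert ?M ?S) = insert U R"
    unfolding U_def
  proof (rule components_insert_two[OF CS MXY _ _ XR YR])
    show "?M \<inter> X \<noteq> {}" "?M \<inter> Y \<noteq> {}" using X(2) Y(2) unfolding M by auto
  qed
  have elimM: "elim ?M (insert ?M ?S) = R \<union> (if U \<subseteq> ?M then {} else {U - ?M})"
  proof -
    have "(\<lambda>K. K - ?M) ` R = R" using RM(1) by (simp cong: image_cong)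
    then show ?thesis unfolding elim_def MU using RM(3) by auto
  qed
  have ninM: "nin ?M (insert ?M ?S) = e"
  proof -
    have "{K \<in> insert U R. K \<subseteq> ?M} = (if U \<subseteq> ?M then {U} else {})" using RM(2) by auto
    then show ?thesis unfolding nin_def MU e_def by simp
  qed
  have cardel: "card (elim ?M (insert ?M ?S)) + e = card R + 1"
    unfolding elimM e_def using finR UmR by simp
  let ?F = "(\<lambda>a. {2 * a, Suc (2 * a)}) ` A"
  have SF: "\<pi> \<union> ?F = insert {2 * x, Suc (2 * x)} (insert {2 * y, Suc (2 * y)} ?S)"
    using xy by blast
  have SE: "?S \<union> E = insert ?f (insert ?e ?S)" unfolding E_def by blast
  \<comment> \<open>In the first case the caps merge \<open>X\<close> and \<open>Y\<close> just as
    \<open>?M\<close> does, and there are \<open>2 + card R\<close> fattened blocks. In the second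
    the inner cap closes the extra loop \<open>Y\<close>, but there is one fattened block less. Both
    changes cancel in the sum.\<close>
  have main: "elim ?M (?S \<union> E) = elim ?M (insert ?M ?S) \<and>
      nin ?M (?S \<union> E) + card (components (\<pi> \<union> ?F)) = 2 + card R + e"
    using key
  proof (elim conjE disjE)
    assume a: "Suc (2 * x) \<in> X" "Suc (2 * y) \<in> Y"
    have "components (insert ?e ?S) = insert U R" unfolding U_def
      by (rule components_insert_two[OF CS _ _ _ XR YR]) (use a X Y in auto)
    then have "components (?S \<union> E) = insert U R"
      unfolding SE using components_insert_inside[of ?f U "insert ?e ?S"] a X(2) Y(2) by (auto simp: U_def)
    moreover have "components (insert {2 * y, Suc (2 * y)} ?S) = components ?S"
      by (rule components_insert_inside[OF _ _ Y(1)]) (use a Y in auto)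
    then have "components (\<pi> \<union> ?F) = components ?S"
      unfolding SF using components_insert_inside[of "{2 * x, Suc (2 * x)}" X "insert {2 * y, Suc (2 * y)} ?S"] a X by auto
    moreover have "card (components ?S) = 2 + card R" unfolding CS using XR YR neXY finR by simp
    ultimately show ?thesis using ninM unfolding elim_def nin_def MU by simp
  next
    assume a: "Y = ?e" "Suc (2 * y) \<in> X"
    have "components (insert ?e ?S) = components ?S"
      by (rule components_insert_inside[OF _ _ Y(1)]) (use a in auto)
    then have cE: "components (?S \<union> E) = insert X (insert Y R)"
      unfolding SE using components_insert_inside[of ?f X "insert ?e ?S"] a X CS by auto
    have YM: "Y \<subseteq> ?M" unfolding a M by auto
    then have XU: "X - ?M = U - ?M" "X \<subseteq> ?M \<longleftrightarrow> U \<subseteq> ?M" unfolding U_def by auto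
    have "elim ?M (?S \<union> E) = elim ?M (insert ?M ?S)"
      unfolding elim_def cE MU using XU YM by auto
    moreover have "{K \<in> insert X (insert Y R). K \<subseteq> ?M} = (if U \<subseteq> ?M then {X, Y} else {Y})"
      using RM(2) XU YM by auto
    then have "nin ?M (?S \<union> E) = 1 + e"
      unfolding nin_def cE e_def using neXY by simp
    moreover have "components (insert {2 * y, Suc (2 * y)} ?S) = insert U R" unfolding U_def
      by (rule components_insert_two[OF CS _ _ _ XR YR]) (use a X Y in auto)
    then have "components (\<pi> \<union> ?F) = insert U R"
      unfolding SF using components_insert_inside[of "{2 * x, Suc (2 * x)}" U "insert {2 * y, Suc (2 * y)} ?S"] a X(2)
      by (auto simp: U_def)
    then have "card (components (\<pi> \<union> ?F)) = 1 + card R" using UR finR by simp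
    ultimately show ?thesis by simp
  qed

  \<comment> \<open>Halving is a gluing whenever each couple either lies in one member of the family
    or is supplied as an edge. It is applied to the pairing before capping, to the joined family and
    to the pairing after capping.\<close>
  have gl: "gluing ?h P (\<Union>a\<in>B. {{2 * a, Suc (2 * a)}})" if UP: "\<Union>P = old A'" and BA: "B \<subseteq> A'"
    and ex: "\<And>a. a \<in> A' - B \<Longrightarrow> \<exists>N\<in>P. 2 * a \<in> N \<and> Suc (2 * a) \<in> N" for P A' B
  proof
    let ?F = "\<Union>a\<in>B. {{2 * a, Suc (2 * a)}}"
    show "\<Union>?F \<subseteq> \<Union>P" unfolding UP using BA by auto
    show "?h u = ?h v" if "N \<in> ?F" "u \<in> N" "v \<in> N" for N u v using that by auto
    fix u v assume uv: "u \<in> \<Union>P" "v \<in> \<Union>P" "?h u = ?h v"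
    then have "u div 2 \<in> A'" unfolding UP by (simp add: old_iff)
    then obtain N where "N \<in> P \<union> ?F" "2 * (u div 2) \<in> N" "Suc (2 * (u div 2)) \<in> N"
      using ex[of "u div 2"] by blast
    moreover have "u = 2 * (u div 2) \<or> u = Suc (2 * (u div 2))" "v = 2 * (u div 2) \<or> v = Suc (2 * (u div 2))"
      using uv(3) by presburger+
    ultimately have "u \<in> N" "v \<in> N" by metis+
    then show "(u, v) \<in> conn (P \<union> ?F)" using \<open>N \<in> P \<union> ?F\<close> by (rule_tac conn_base)
  qed
  have g1: "gluing ?h \<pi> ?F" using gl[of \<pi> A A] U\<pi> by (simp add: UNION_singleton_eq_range)
  have g2: "gluing ?h (insert ?M \<pi>) ?T"
  proof -
    have UM: "\<Union>(insert ?M \<pi>) = old A" using U\<pi> MA by auto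
    have "\<exists>N\<in>insert ?M \<pi>. 2 * a \<in> N \<and> Suc (2 * a) \<in> N" if "a \<in> A - ?A'" for a
      by (rule bexI[of _ ?M]) (use that in auto)
    then show ?thesis using gl[OF UM, of ?A'] by (simp add: UNION_singleton_eq_range)
  qed
  have U\<rho>: "\<Union>\<rho> = old ?A'" using nc\<rho> unfolding nc_pairing_def by (simp add: partition_on_def)
  have g3: "gluing ?h \<rho> ?T" using gl[of \<rho> ?A' ?A'] U\<rho> by (simp add: UNION_singleton_eq_range)
  have hM: "?h ` ?M = {x, y}" unfolding M by auto
  have vM: "?h -` {x, y} = ?M" by (auto simp: old_def)
  \<comment> \<open>Taking components is eliminating nothing. Hence \<open>fat\<close> is itself an
    elimination and can be merged with the one caused by the cap.\<close>
  have el0: "elim {} P = components P" for P :: "nat set set"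
    unfolding elim_def using components_nonempty by auto
  have fat1: "elim {x, y} (fat \<pi> \<union> {{x, y}}) = elim {x, y} ((`) ?h ` insert ?M \<pi>)"
    using elim_elim_Un[of "{{x, y}}" "{}" "{x, y}" "(`) ?h ` \<pi>"] unfolding el0 fat_def
    by (simp add: hM)
  have fin: "finite (\<Union>((`) ?h ` \<pi> \<union> {{x, y}}))" using Union_half finA by simp
  have nin0: "nin {} P = 0" for P :: "nat set set"
  proof -
    have "{K \<in> components P. K \<subseteq> {}} = {}" using components_nonempty by auto
    then show ?thesis unfolding nin_def by simp
  qed
  have nin1: "nin {x, y} (fat \<pi> \<union> {{x, y}}) = nin {x, y} ((`) ?h ` insert ?M \<pi>)"
    using nin_elim_Un[of "{{x, y}}" "{}" "(`) ?h ` \<pi>" "{x, y}", OF _ fin] unfolding el0 fat_def nin0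
    by (simp add: hM)
  have fat2: "elim {x, y} (fat \<pi> \<union> {{x, y}}) = (`) ?h ` elim ?M (insert ?M ?S)"
    unfolding fat1 gluing.elim_glue[OF g2] vM by simp
  have nin2: "nin {x, y} (fat \<pi> \<union> {{x, y}}) = e"
    unfolding nin1 gluing.nin_glue[OF g2] vM using ninM by simp
  have SEeq: "(\<pi> \<union> E) \<union> ?T = ?S \<union> E" by blast
  have comp\<rho>: "components (\<rho> \<union> ?T) = elim ?M (insert ?M ?S)"
    unfolding \<rho>_def components_elim_Un[OF TM] SEeq using main by simp
  show "fat \<rho> = elim {x, y} (fat \<pi> \<union> {{x, y}})"
    unfolding fat2 using gluing.components_glue[OF g3] unfolding comp\<rho> fat_def .
  have "card (fat \<rho>) = card (elim ?M (insert ?M ?S))"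
    using gluing.card_components_glue[OF g3] unfolding comp\<rho> fat_def .
  moreover have "card (fat \<pi>) = card (components (\<pi> \<union> ?F))"
    using gluing.card_components_glue[OF g1] unfolding fat_def .
  moreover have "nin ?M (\<pi> \<union> E) = nin ?M (?S \<union> E)"
    unfolding nin_def components_inside[OF TM, of "\<pi> \<union> E", symmetric] SEeq ..
  ultimately show "nin ?M (\<pi> \<union> E) + card (fat \<pi>) = 1 + card (fat \<rho>) + 2 * nin {x, y} (fat \<pi> \<union> {{x, y}})"
    using main cardel nin2 by simp
qed

section \<open>Nested families of caps\<close>

definition midset :: "nat \<Rightarrow> nat \<Rightarrow> nat set" where
  "midset c n = (\<lambda>i. c - i) ` {..<n} \<union> (\<lambda>i. Suc (c + i)) ` {..<n}"

text \<open>Arcs nested around the gap after position \<open>c\<close>, numbered from the innermost;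
  for \<open>n \<le> c\<close> their ends are exactly the positions in
  \<open>midset c n\<close>.\<close>

definition caps :: "nat \<Rightarrow> nat \<Rightarrow> nat set set" where
  "caps c n = (\<lambda>i. {c - i, Suc (c + i)}) ` {..<n}"

text \<open>Each cap doubled to the two strings along its sides, the inner one first, in the shape
  of \<open>E\<close> in \<open>cap_step\<close>.\<close>

definition old_caps :: "nat \<Rightarrow> nat \<Rightarrow> nat set set" where
  "old_caps c n = (\<Union>i<n. {{Suc (2 * (c - i)), 2 * Suc (c + i)}, {2 * (c - i), Suc (2 * Suc (c + i))}})"

lemma midset_Suc: "midset c (Suc n) = midset c n \<union> {c - n, Suc (c + n)}"
  by (auto simp: midset_def lessThan_Suc)

lemma caps_Suc: "caps c (Suc n) = caps c n \<union> {{c - n, Suc (c + n)}}"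
  by (auto simp: caps_def lessThan_Suc)

lemma old_caps_Suc: "old_caps c (Suc n) = old_caps c n \<union>
    {{Suc (2 * (c - n)), 2 * Suc (c + n)}, {2 * (c - n), Suc (2 * Suc (c + n))}}"
  by (auto simp: old_caps_def lessThan_Suc)

lemma midset_conv: "n \<le> c \<Longrightarrow> midset c n = {c + 1 - n..c + n}"
proof (induction n)
  case 0
  then show ?case by (simp add: midset_def)
next
  case (Suc n)
  then have IH: "midset c n = {c + 1 - n..c + n}" by simp
  obtain d where c: "c = Suc n + d" using Suc.prems le_Suc_ex by blast
  show ?case unfolding midset_Suc IH by (auto simp: c)
qed

text \<open>After \<open>n\<close> inner caps the points \<open>c - n\<close> and
  \<open>c + n + 1\<close> are adjacent among those that remain, so \<open>cap_step\<close> applies.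
  The loops of successive steps add up by \<open>nin_elim_Un\<close>, and each cap contributes one
  to the constant.\<close>

lemma cap_all:
  assumes "nc_pairing A \<pi>" "n \<le> c" "midset c n \<subseteq> A"
  defines "\<rho> \<equiv> elim (old (midset c n)) (\<pi> \<union> old_caps c n)"
  shows "nc_pairing (A - midset c n) \<rho> \<and> fat \<rho> = elim (midset c n) (fat \<pi> \<union> caps c n) \<and>
    nin (old (midset c n)) (\<pi> \<union> old_caps c n) + card (fat \<pi>)
      = n + card (fat \<rho>) + 2 * nin (midset c n) (fat \<pi> \<union> caps c n)"
  using assms(2,3) unfolding \<rho>_def
proof (induction n)
  case 0
  interpret nc_pairing A \<pi> by fact
  have m: "midset c 0 = {}" "caps c 0 = {}" "old_caps c 0 = {}" "old {} = {}"
    by (simp_all add: midset_def caps_def old_caps_def old_def)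
  have el0: "elim {} P = P" "nin {} P = 0" if "partition_on X P" for X and P :: "nat set set"
    using that components_partition[OF that] unfolding elim_def nin_def by (auto simp: partition_on_def)
  show ?case unfolding m using el0[OF part] el0[OF partition_fat] assms(1) by simp
next
  case (Suc n)
  let ?x = "c - n" and ?y = "Suc (c + n)"
  let ?A = "A - midset c n" and ?\<rho> = "elim (old (midset c n)) (\<pi> \<union> old_caps c n)"
  have sub: "midset c n \<subseteq> A" "?x \<in> A" "?y \<in> A" "n \<le> c" using Suc.prems unfolding midset_Suc by auto
  note IH = Suc.IH[OF sub(4,1)]
  interpret P: nc_pairing A \<pi> by fact
  interpret R: nc_pairing ?A ?\<rho> using IH by blast
  have nm: "?x \<notin> midset c n" "?y \<notin> midset c n" using Suc.prems(1) unfolding midset_conv[OF sub(4)] by auto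
  have xy: "?x \<in> ?A" "?y \<in> ?A" "?x < ?y" using sub nm by auto
  have adj: "\<not> (?x < v \<and> v < ?y)" if "v \<in> ?A" for v
    using that Suc.prems(1) unfolding midset_conv[OF sub(4)] by auto
  note st = R.cap_step[OF xy adj]
  let ?E = "{{Suc (2 * ?x), 2 * ?y}, {2 * ?x, Suc (2 * ?y)}}"
  have disE: "\<Union>?E \<inter> old (midset c n) = {}" using nm by (auto simp: old_iff)
  have disF: "\<Union>{{?x, ?y}} \<inter> midset c n = {}" using nm by auto
  have oldM: "old (midset c n) \<union> old {?x, ?y} = old (midset c (Suc n))" unfolding midset_Suc old_Un ..
  have capsE: "(\<pi> \<union> old_caps c n) \<union> ?E = \<pi> \<union> old_caps c (Suc n)" unfolding old_caps_Suc by (simp only: Un_assoc)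
  have capsF: "(fat \<pi> \<union> caps c n) \<union> {{?x, ?y}} = fat \<pi> \<union> caps c (Suc n)" unfolding caps_Suc by (simp only: Un_assoc)
  have el1: "elim (old {?x, ?y}) (?\<rho> \<union> ?E) = elim (old (midset c (Suc n))) (\<pi> \<union> old_caps c (Suc n))"
    unfolding elim_elim_Un[OF disE] oldM capsE ..
  have el2: "elim {?x, ?y} (fat ?\<rho> \<union> {{?x, ?y}}) = elim (midset c (Suc n)) (fat \<pi> \<union> caps c (Suc n))"
    using IH elim_elim_Un[OF disF, of "{?x, ?y}" "fat \<pi> \<union> caps c n"] unfolding capsF midset_Suc[symmetric] by simp
  have U: "\<Union>\<pi> = old A" "\<Union>(fat \<pi>) = A" using P.part P.partition_fat by (simp_all add: partition_on_def)
  have oc: "\<Union>(old_caps c (Suc n)) \<subseteq> old (midset c (Suc n))"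
    unfolding old_caps_def midset_def by (auto simp: old_iff)
  have cc: "\<Union>(caps c (Suc n)) \<subseteq> midset c (Suc n)"
    unfolding caps_def midset_def by auto
  have oA: "old (midset c (Suc n)) \<subseteq> old A" using Suc.prems(2) by (auto simp: old_iff)
  have fin1: "finite (\<Union>((\<pi> \<union> old_caps c n) \<union> ?E))" unfolding capsE Union_Un_distrib U
    using P.finA oc oA by (intro finite_subset[OF _ P.finite_oldA]) auto
  have fin2: "finite (\<Union>((fat \<pi> \<union> caps c n) \<union> {{?x, ?y}}))" unfolding capsF Union_Un_distrib U
    using P.finA cc Suc.prems(2) by (intro finite_subset[OF _ P.finA]) auto
  have n1: "nin (old {?x, ?y}) (?\<rho> \<union> ?E) + nin (old (midset c n)) (\<pi> \<union> old_caps c n)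
      = nin (old (midset c (Suc n))) (\<pi> \<union> old_caps c (Suc n))"
    using nin_elim_Un[OF disE fin1, of "old {?x, ?y}"] unfolding oldM capsE .
  have n2: "nin {?x, ?y} (fat ?\<rho> \<union> {{?x, ?y}}) + nin (midset c n) (fat \<pi> \<union> caps c n)
      = nin (midset c (Suc n)) (fat \<pi> \<union> caps c (Suc n))"
    using IH nin_elim_Un[OF disF fin2, of "{?x, ?y}"] unfolding capsF midset_Suc[symmetric] by simp
  have A: "?A - {?x, ?y} = A - midset c (Suc n)" unfolding midset_Suc by blast
  have arith: "a2 + f0 = Suc n + f2 + 2 * b2"
    if "a1 + f1 = 1 + f2 + 2 * b1" "a0 + f0 = n + f1 + 2 * b0" "a1 + a0 = a2" "b1 + b0 = b2"
    for a0 a1 a2 b0 b1 b2 f0 f1 f2 n :: nat using that by simp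
  note st' = st[unfolded el1 el2 A]
  show ?case
    using st'(1,2) arith[OF st'(3) conjunct2[OF conjunct2[OF IH]] n1 n2] by blast
qed

section \<open>Fattening of diagrams\<close>

lemma ncr_image: "ncr f P \<Longrightarrow> ncr (\<lambda>z. z) ((`) f ` P)"
  unfolding ncr_def[of "\<lambda>z. z"]
proof (intro ballI impI)
  fix B C a c b d assume nc: "ncr f P" and B: "B \<in> (`) f ` P" "C \<in> (`) f ` P"
    and m: "a \<in> B" "c \<in> B" "b \<in> C" "d \<in> C" and lt: "a < b" "b < c" "c < d"
  obtain B' C' where B': "B' \<in> P" "B = f ` B'" "C' \<in> P" "C = f ` C'" using B by auto
  obtain a' c' b' d' where "a' \<in> B'" "c' \<in> B'" "b' \<in> C'" "d' \<in> C'" "a = f a'" "c = f c'" "b = f b'" "d = f d'"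
    using m B' by auto
  then show "B = C" using ncrD[OF nc B'(1,3)] lt B' by blast
qed

lemma image_image_eqD:
  assumes "inj_on f X" "\<Union>S \<subseteq> X" "\<Union>T \<subseteq> X" "(`) f ` S = (`) f ` T"
  shows "S = T"
proof -
  have sub: "S \<subseteq> T" if "\<Union>S \<subseteq> X" "\<Union>T \<subseteq> X" "(`) f ` S = (`) f ` T" for S T
  proof
    fix B assume B: "B \<in> S"
    then have "f ` B \<in> (`) f ` T" using that(3) by blast
    then obtain C where C: "C \<in> T" "f ` B = f ` C" by blast
    have "B \<subseteq> X" "C \<subseteq> X" using B C that by auto
    then have "B = C" using C(2) inj_on_image_eq_iff[OF assms(1)] by metis
    then show "B \<in> T" using C by simp
  qed
  show ?thesis using sub[OF assms(2,3,4)] sub[OF assms(3,2) assms(4)[symmetric]] by (rule subset_antisym)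
qed

lemma ncr_imageD:
  assumes "inj_on f (\<Union>P)" "ncr (\<lambda>z. z) ((`) f ` P)"
  shows "ncr f P"
  unfolding ncr_def
proof (intro ballI impI)
  fix B C a c b d assume B: "B \<in> P" "C \<in> P" "a \<in> B" "c \<in> B" "b \<in> C" "d \<in> C" and lt: "f a < f b" "f b < f c" "f c < f d"
  have "f ` B = f ` C"
    by (rule ncrD[OF assms(2), of _ _ "f a" "f c" "f b" "f d"]) (use B lt in auto)
  moreover have "B \<subseteq> \<Union>P" "C \<subseteq> \<Union>P" using B by auto
  ultimately show "B = C" using inj_on_image_eq_iff[OF assms(1)] by metis
qed

lemma ncr_mono:
  assumes "ncr f P" "\<And>x y. x \<in> \<Union>P \<Longrightarrow> y \<in> \<Union>P \<Longrightarrow> g x < g y \<Longrightarrow> f x < f y"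
  shows "ncr g P"
  unfolding ncr_def
proof (intro ballI impI)
  fix B C a c b d assume B: "B \<in> P" "C \<in> P" "a \<in> B" "c \<in> B" "b \<in> C" "d \<in> C" and lt: "g a < g b" "g b < g c" "g c < g d"
  then have "a \<in> \<Union>P" "b \<in> \<Union>P" "c \<in> \<Union>P" "d \<in> \<Union>P" by auto
  then show "B = C" using ncrD[OF assms(1) B] assms(2) lt by blast
qed

section \<open>Non-crossing diagrams bent to a line\<close>

lemma NC_iff: "p \<in> NC k l \<longleftrightarrow> p \<in> Part k l \<and> ncr (pos k l) (blocks p)"
  unfolding NC_def noncrossing_iff by (auto simp: Part_iff)

lemma NC2_iff: "p \<in> NC2 k l \<longleftrightarrow> p \<in> Part k l \<and> ncr (pos k l) (blocks p) \<and> (\<forall>B\<in>blocks p. card B = 2)"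
  unfolding NC2_def by (auto simp: NC_iff)

lemma NC2_NC: "p \<in> NC2 k l \<Longrightarrow> p \<in> NC k l" and NC_Part: "p \<in> NC k l \<Longrightarrow> p \<in> Part k l"
  and NC2_Part: "p \<in> NC2 k l \<Longrightarrow> p \<in> Part k l"
  by (auto simp: NC2_iff NC_iff)

lemma points_mem [simp]:
  "Up i \<in> points k l \<longleftrightarrow> 1 \<le> i \<and> i \<le> k" "Low j \<in> points k l \<longleftrightarrow> 1 \<le> j \<and> j \<le> l"
  by (auto simp: points_def)

lemma pos_less: "x \<in> points k l \<Longrightarrow> 1 \<le> pos k l x \<and> pos k l x \<le> k + l"
  by (auto simp: points_def)

lemma inj_pos: "inj_on (pos k l) (points k l)"
proof (rule inj_onI)
  fix x y assume "x \<in> points k l" "y \<in> points k l" "pos k l x = pos k l y"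
  then show "x = y" by (cases x; cases y) (auto simp: points_def)
qed

lemma pos_image: "pos k l ` points k l = {1..k + l}"
proof (intro equalityI subsetI)
  fix a assume a: "a \<in> {1..k + l}"
  show "a \<in> pos k l ` points k l"
  proof (cases "a \<le> k")
    case True
    then show ?thesis using a by (intro image_eqI[of _ _ "Up a"]) (auto simp: points_def)
  next
    case False
    then show ?thesis using a by (intro image_eqI[of _ _ "Low (k + l + 1 - a)"]) auto
  qed
qed (use pos_less in auto)

text \<open>The offset of one gives the upper points \<open>2 * i - 1\<close> and
  \<open>2 * i\<close> the positions \<open>2 * i\<close> and \<open>2 * i + 1\<close>, whose common
  half is the position of the new point \<open>i\<close>.\<close>

definition opos :: "nat \<Rightarrow> nat \<Rightarrow> point \<Rightarrow> nat" where
  "opos k l z = Suc (pos (2 * k) (2 * l) z)"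

text \<open>The new point next to an old point; fattening turns out to glue each pair of old points to the
  new point between them.\<close>

fun hpt :: "point \<Rightarrow> point" where
  "hpt (Up i) = Up (Suc i div 2)"
| "hpt (Low j) = Low (Suc j div 2)"

lemma opos_div: "z \<in> points (2 * k) (2 * l) \<Longrightarrow> opos k l z div 2 = pos k l (hpt z)"
proof (cases z)
  case (Low j)
  assume "z \<in> points (2 * k) (2 * l)"
  then have j: "1 \<le> j" "j \<le> 2 * l" using Low by (auto simp: points_def)
  have "(2 * k + (2 * l + 1 - j) + 1) div 2 = k + (l + 1 - Suc j div 2)"
    using j by linarith
  then show ?thesis using Low by (simp add: opos_def)
qed (simp add: opos_def)

lemma hpt_points: "hpt ` points (2 * k) (2 * l) = points k l"
proof (intro equalityI subsetI)
  fix z assume "z \<in> points k l"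
  then show "z \<in> hpt ` points (2 * k) (2 * l)"
  proof (cases z)
    case (Up i)
    then show ?thesis using \<open>z \<in> points k l\<close> by (intro image_eqI[of _ _ "Up (2 * i)"]) (auto simp: points_def)
  next
    case (Low i)
    then show ?thesis using \<open>z \<in> points k l\<close> by (intro image_eqI[of _ _ "Low (2 * i)"]) (auto simp: points_def)
  qed
next
  fix z assume "z \<in> hpt ` points (2 * k) (2 * l)"
  then obtain x where x: "z = hpt x" "x \<in> points (2 * k) (2 * l)" by (elim imageE)
  then show "z \<in> points k l" by (cases x) auto
qed

lemma inj_opos: "inj_on (opos k l) (points (2 * k) (2 * l))"
  using inj_pos[of "2 * k" "2 * l"] by (auto simp: opos_def inj_on_def)

lemma opos_image: "opos k l ` points (2 * k) (2 * l) = old {1..k + l}"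
proof -
  have "opos k l ` points (2 * k) (2 * l) = Suc ` {1..2 * k + 2 * l}"
    unfolding opos_def pos_image[symmetric] image_image ..
  also have "\<dots> = old {1..k + l}"
  proof (rule Set.set_eqI)
    fix z
    have "z \<in> Suc ` {1..2 * k + 2 * l} \<longleftrightarrow> 2 \<le> z \<and> z \<le> 2 * k + 2 * l + 1"
      by (cases z) auto
    also have "\<dots> \<longleftrightarrow> 1 \<le> z div 2 \<and> z div 2 \<le> k + l" by linarith
    finally show "z \<in> Suc ` {1..2 * k + 2 * l} \<longleftrightarrow> z \<in> old {1..k + l}" by (simp add: old_iff)
  qed
  finally show ?thesis .
qed

text \<open>The translation by \<open>c\<close> makes room for placing two diagrams next to each other on a line.\<close>

definition line :: "nat \<Rightarrow> nat \<Rightarrow> nat \<Rightarrow> diagram \<Rightarrow> nat set set" where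
  "line c k l p = (`) (\<lambda>z. c + pos k l z) ` blocks p"

definition oline :: "nat \<Rightarrow> nat \<Rightarrow> nat \<Rightarrow> diagram \<Rightarrow> nat set set" where
  "oline c k l p = (`) (\<lambda>z. 2 * c + opos k l z) ` blocks p"

lemma nc_pairing_oline:
  assumes p: "p \<in> NC2 (2 * k) (2 * l)"
  shows "nc_pairing {c + 1..c + k + l} (oline c k l p)"
proof
  let ?f = "\<lambda>z. 2 * c + opos k l z" and ?X = "points (2 * k) (2 * l)"
  have inj: "inj_on ?f ?X" using inj_opos[of k l] by (simp add: inj_on_def)
  have P: "partition_on ?X (blocks p)" using p by (simp add: NC2_iff Part_iff)
  have "?f ` ?X = (+) (2 * c) ` old {1..k + l}"
    unfolding opos_image[symmetric] image_image ..
  also have "\<dots> = old {c + 1..c + k + l}"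
  proof (rule Set.set_eqI)
    fix z
    have "z \<in> (+) (2 * c) ` old {1..k + l} \<longleftrightarrow> 2 * c \<le> z \<and> z - 2 * c \<in> old {1..k + l}"
      by (auto intro!: image_eqI[of _ _ "z - 2 * c"])
    also have "\<dots> \<longleftrightarrow> c + 1 \<le> z div 2 \<and> z div 2 \<le> c + k + l"
      unfolding old_iff atLeastAtMost_iff by linarith
    finally show "z \<in> (+) (2 * c) ` old {1..k + l} \<longleftrightarrow> z \<in> old {c + 1..c + k + l}" by (simp add: old_iff)
  qed
  finally show "partition_on (old {c + 1..c + k + l}) (oline c k l p)"
    using partition_on_imageI[OF inj P] unfolding oline_def by simp
  show "card B = 2" if B: "B \<in> oline c k l p" for B
  proof -
    obtain C where C: "C \<in> blocks p" "B = ?f ` C" using B unfolding oline_def by auto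
    then have "C \<subseteq> ?X" using P by (auto simp: partition_on_def)
    then have "card B = card C" unfolding C(2) by (intro card_image inj_on_subset[OF inj])
    then show ?thesis using p C by (simp add: NC2_iff)
  qed
  have "ncr ?f (blocks p)"
  proof (rule ncr_mono)
    show "ncr (pos (2 * k) (2 * l)) (blocks p)" using p by (simp add: NC2_iff)
  qed (simp add: opos_def)
  then show "ncr (\<lambda>z. z) (oline c k l p)" unfolding oline_def by (rule ncr_image)
qed simp

lemma half_oline:
  assumes "p \<in> Part (2 * k) (2 * l)"
  shows "half (oline c k l p) = (`) (\<lambda>z. c + pos k l z) ` (`) hpt ` blocks p"
proof -
  have "(\<lambda>z. z div 2) ` (\<lambda>z. 2 * c + opos k l z) ` B = (\<lambda>z. c + pos k l z) ` hpt ` B" if "B \<in> blocks p" for B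
  proof -
    have "B \<subseteq> points (2 * k) (2 * l)" using that Union_blocks[OF assms] by auto
    then show ?thesis unfolding image_image by (intro image_cong refl) (auto simp: opos_div[symmetric])
  qed
  then show ?thesis unfolding oline_def image_image[of "(`) _"] by (rule image_cong[OF refl])
qed

lemma Union_hpt_blocks: "p \<in> Part (2 * k) (2 * l) \<Longrightarrow> \<Union>((`) hpt ` blocks p) = points k l"
  by (simp only: Union_image_image Union_blocks hpt_points)

lemma conn_image:
  assumes inj: "inj_on f (\<Union>S)" and uv: "u \<in> \<Union>S" "v \<in> \<Union>S"
  shows "(f u, f v) \<in> conn ((`) f ` S) \<longleftrightarrow> (u, v) \<in> conn S"
proof -
  obtain K where K: "K \<in> components S" "u \<in> K" using component_ex[OF uv(1)] by auto
  then have "f ` K \<in> components ((`) f ` S)" "f u \<in> f ` K" unfolding components_image[OF inj] by auto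
  then have "(f u, f v) \<in> conn ((`) f ` S) \<longleftrightarrow> f v \<in> f ` K" using component_conn_iff by metis
  also have "\<dots> \<longleftrightarrow> v \<in> K" using inj_on_image_mem_iff[OF inj uv(2) component_subset[OF K(1)]] .
  also have "\<dots> \<longleftrightarrow> (u, v) \<in> conn S" using component_conn_iff[OF K] .
  finally show ?thesis .
qed

lemma new_pos_eq: "u \<in> points k l \<Longrightarrow> new_pos k l u + 1 = 4 * pos k l u"
  by (cases u) (auto simp: points_def old_pos_def)

text \<open>Old and new points sit at \<open>2 * opos - 2\<close> and \<open>4 * pos - 1\<close>.
  Passing from these to \<open>opos\<close> and \<open>2 * pos\<close> keeps strict comparisons of a
  new with an old point, and an old point lies between two new ones iff these two comparisons
  differ.\<close>

lemma lies_between_iff: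
  assumes "u \<in> points k l" "v \<in> points k l"
  shows "lies_between k l u v z \<longleftrightarrow> (2 * pos k l u < opos k l z) \<noteq> (2 * pos k l v < opos k l z)"
proof -
  have "new_pos k l u + 1 = 4 * pos k l u" "new_pos k l v + 1 = 4 * pos k l v" using new_pos_eq assms by auto
  moreover have "old_pos k l z + 2 = 2 * opos k l z" by (simp add: old_pos_def opos_def)
  ultimately show ?thesis unfolding lies_between_def by (auto simp: min_def max_def)
qed

text \<open>On the line, \<open>conn_iff_sim\<close> turns the order-theoretic equivalence into
  connectivity after gluing. Since \<open>pos\<close> is injective this can be pulled back, and the
  result no longer mentions positions.\<close>

lemma
  assumes p: "p \<in> NC2 (2 * k) (2 * l)"
  shows blocks_fatten: "blocks (fatten p) = components ((`) hpt ` blocks p)"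
    and nup_fatten: "nup (fatten p) = k" and nlow_fatten: "nlow (fatten p) = l"
proof -
  let ?S = "(`) hpt ` blocks p" and ?\<pi> = "oline 0 k l p"
  interpret nc_pairing "{1..k + l}" ?\<pi> using nc_pairing_oline[OF p, of 0] by simp
  have pp: "p \<in> Part (2 * k) (2 * l)" and kl: "nup p = 2 * k" "nlow p = 2 * l"
    using p by (auto simp: NC2_iff Part_iff)
  have U: "\<Union>?S = points k l" using Union_hpt_blocks[OF pp] .
  have h: "half ?\<pi> = (`) (pos k l) ` ?S" using half_oline[OF pp, of 0] by simp
  have inj: "inj_on (pos k l) (\<Union>?S)" unfolding U by (rule inj_pos)
  have con: "(u, v) \<in> conn ?S \<longleftrightarrow> sim ?\<pi> (pos k l u) (pos k l v)" if "u \<in> points k l" "v \<in> points k l" for u v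
    using conn_iff_sim[of "pos k l u" "pos k l v"] conn_image[OF inj, of u v] that pos_less unfolding U h by simp
  have sim: "sim ?\<pi> (pos k l u) (pos k l v) \<longleftrightarrow>
      \<not> (\<exists>B\<in>blocks p. (\<exists>z\<in>B. lies_between k l u v z) \<and> (\<exists>z\<in>B. \<not> lies_between k l u v z))"
    if uv: "u \<in> points k l" "v \<in> points k l" for u v
  proof -
    have "sim ?\<pi> (pos k l u) (pos k l v) \<longleftrightarrow> (\<forall>B\<in>blocks p. \<forall>z\<in>B. \<forall>w\<in>B. lies_between k l u v z \<longleftrightarrow> lies_between k l u v w)"
      unfolding sim_def oline_def lies_between_iff[OF uv] by simp
    also have "\<dots> \<longleftrightarrow> \<not> (\<exists>B\<in>blocks p. (\<exists>z\<in>B. lies_between k l u v z) \<and> (\<exists>z\<in>B. \<not> lies_between k l u v z))"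
      by blast
    finally show ?thesis .
  qed
  have R: "{(u, v). u \<in> points k l \<and> v \<in> points k l \<and>
       \<not> (\<exists>B\<in>blocks p. (\<exists>z\<in>B. lies_between k l u v z) \<and> (\<exists>z\<in>B. \<not> lies_between k l u v z))} = conn ?S" (is "?R = _")
  proof (rule Set.set_eqI)
    fix x :: "point \<times> point"
    obtain u v where x: "x = (u, v)" by (cases x)
    have "(u, v) \<in> conn ?S \<Longrightarrow> u \<in> points k l \<and> v \<in> points k l" using conn_Union[of u v ?S] unfolding U .
    then show "x \<in> ?R \<longleftrightarrow> x \<in> conn ?S" unfolding x using con[of u v] sim[of u v] by auto
  qed
  have f: "fatten p = Diagram k l (points k l // conn ?S)"
    unfolding fatten_def Let_def R[symmetric] kl by simp
  show "blocks (fatten p) = components ?S" unfolding f components_quotient U by simp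
  show "nup (fatten p) = k" "nlow (fatten p) = l" unfolding f by simp_all
qed

lemma fat_oline:
  assumes p: "p \<in> NC2 (2 * k) (2 * l)"
  shows "fat (oline c k l p) = line c k l (fatten p)"
proof -
  have inj: "inj_on (\<lambda>z. c + pos k l z) (\<Union>((`) hpt ` blocks p))"
    unfolding Union_hpt_blocks[OF NC2_Part[OF p]] using inj_pos[of k l] by (simp add: inj_on_def)
  show ?thesis
    unfolding fat_def half_oline[OF NC2_Part[OF p]] components_image[OF inj] line_def blocks_fatten[OF p] ..
qed

lemma fatten_NC:
  assumes p: "p \<in> NC2 (2 * k) (2 * l)"
  shows "fatten p \<in> NC k l"
proof -
  interpret nc_pairing "{1..k + l}" "oline 0 k l p" using nc_pairing_oline[OF p, of 0] by simp
  have part': "partition_on (points k l) (blocks (fatten p))"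
    unfolding blocks_fatten[OF p] Union_hpt_blocks[OF NC2_Part[OF p], symmetric]
    by (rule partition_on_components)
  have "ncr (pos k l) (blocks (fatten p))"
  proof (rule ncr_imageD)
    show "inj_on (pos k l) (\<Union>(blocks (fatten p)))" using part' inj_pos by (simp add: partition_on_def)
    show "ncr (\<lambda>z. z) ((`) (pos k l) ` blocks (fatten p))"
      using ncr_fat unfolding fat_oline[OF p] line_def by simp
  qed
  then show ?thesis using part' by (simp add: NC_iff Part_iff nup_fatten[OF p] nlow_fatten[OF p])
qed

lemma fatten_inj: "inj_on fatten (NC2 (2 * k) (2 * l))"
proof (rule inj_onI)
  fix p q assume p: "p \<in> NC2 (2 * k) (2 * l)" and q: "q \<in> NC2 (2 * k) (2 * l)" and eq: "fatten p = fatten q"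
  have "oline 0 k l p = oline 0 k l q"
    using fat_inj[OF nc_pairing_oline[OF p] nc_pairing_oline[OF q], of 0] unfolding fat_oline[OF p] fat_oline[OF q] eq by simp
  then have "(`) (opos k l) ` blocks p = (`) (opos k l) ` blocks q" unfolding oline_def by simp
  then have "blocks p = blocks q"
    by (rule image_image_eqD[OF inj_opos, rotated 2])
      (simp_all add: Union_blocks[OF NC2_Part[OF p]] Union_blocks[OF NC2_Part[OF q]])
  moreover have "nup p = nup q" "nlow p = nlow q" using p q by (auto simp: NC2_iff Part_iff)
  ultimately show "p = q" by (intro diagram_eqI)
qed

lemma fatten_surj:
  assumes r: "r \<in> NC k l"
  shows "\<exists>p\<in>NC2 (2 * k) (2 * l). fatten p = r"
proof -
  let ?P = "(`) (pos k l) ` blocks r"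
  have rp: "partition_on (points k l) (blocks r)" and rn: "nup r = k" "nlow r = l"
    using r by (auto simp: NC_iff Part_iff)
  interpret P: nc_partition "{1..k + l}" ?P
  proof
    show "partition_on {1..k + l} ?P"
      using partition_on_imageI[OF inj_pos rp] unfolding pos_image .
    show "ncr (\<lambda>z. z) ?P" using r by (intro ncr_image) (simp add: NC_iff)
  qed simp
  let ?\<pi> = "thick ?P" and ?X = "points (2 * k) (2 * l)"
  interpret T: nc_pairing "{1..k + l}" ?\<pi> by (rule P.nc_pairing_thick)
  \<comment> \<open>\<open>g\<close> bends the line back: it turns the positions of the thickened
    partition into points of a diagram.\<close>
  define g where "g = inv_into ?X (opos k l)"
  have g: "opos k l (g z) = z" "g z \<in> ?X" if "z \<in> old {1..k + l}" for z
    using that unfolding g_def opos_image[symmetric] by (auto intro: f_inv_into_f inv_into_into)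
  have gi: "g ` old {1..k + l} = ?X"
    unfolding g_def opos_image[symmetric] by (rule inv_into_image_cancel[OF inj_opos]) simp
  have ginj: "inj_on g (old {1..k + l})" using g(1) by (metis inj_onI)
  define p where "p = Diagram (2 * k) (2 * l) ((`) g ` ?\<pi>)"
  have pp: "partition_on ?X (blocks p)"
    using partition_on_imageI[OF ginj T.part] unfolding gi p_def by simp
  have sub: "B \<subseteq> old {1..k + l}" if "B \<in> ?\<pi>" for B using that T.part by (auto simp: partition_on_def)
  have "(\<lambda>B. opos k l ` g ` B) ` ?\<pi> = ?\<pi>"
  proof -
    have "opos k l ` g ` B = B" if "B \<in> ?\<pi>" for B
      unfolding image_image using sub[OF that] g(1) by force
    then show ?thesis by simp
  qed
  then have ol: "oline 0 k l p = ?\<pi>" unfolding oline_def p_def by (simp add: image_image)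
  have p: "p \<in> NC2 (2 * k) (2 * l)"
    unfolding NC2_iff
  proof (intro conjI ballI)
    show "p \<in> Part (2 * k) (2 * l)" using pp by (simp add: Part_iff p_def)
    have "ncr (opos k l) (blocks p)"
    proof (rule ncr_imageD)
      show "inj_on (opos k l) (\<Union>(blocks p))" using pp inj_opos by (simp add: partition_on_def)
      show "ncr (\<lambda>z. z) ((`) (opos k l) ` blocks p)" using ol T.nc unfolding oline_def by simp
    qed
    then show "ncr (pos (2 * k) (2 * l)) (blocks p)" by (rule ncr_mono) (simp add: opos_def)
    fix B assume "B \<in> blocks p"
    then obtain C where C: "C \<in> ?\<pi>" "B = g ` C" by (auto simp: p_def)
    have "card B = card C" unfolding C(2) by (intro card_image inj_on_subset[OF ginj] sub C(1))
    then show "card B = 2" using T.two C by simp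
  qed
  have "(`) (pos k l) ` blocks (fatten p) = (`) (pos k l) ` blocks r"
    using fat_oline[OF p, of 0] P.fat_thick unfolding ol line_def by simp
  then have "blocks (fatten p) = blocks r"
    by (rule image_image_eqD[OF inj_pos, rotated 2])
      (use fatten_NC[OF p] r in \<open>simp_all add: Union_blocks[OF NC_Part]\<close>)
  then have "fatten p = r" by (intro diagram_eqI) (simp_all add: nup_fatten[OF p] nlow_fatten[OF p] rn)
  then show ?thesis using p by blast
qed

lemma fatten_bij: "bij_betw fatten (NC2 (2 * k) (2 * l)) (NC k l)"
  unfolding bij_betw_def
proof
  show "fatten ` NC2 (2 * k) (2 * l) = NC k l" using fatten_NC fatten_surj by blast
qed (rule fatten_inj)

subsection \<open>Identities and tensor products\<close>

lemma id_NC2: "id_diagram k \<in> NC2 k k"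
  unfolding NC2_iff
proof (intro conjI ballI)
  show "ncr (pos k k) (blocks (id_diagram k))"
    unfolding ncr_def blocks_id by auto
qed (auto simp: id_Part)

lemma shift_points: "z \<in> points k' l' \<Longrightarrow> pos (k + k') (l + l') (shift k l z) = k + pos k' l' z"
  by (cases z) (auto simp: points_def)

lemma unshift_points:
  "z \<in> points k l \<Longrightarrow> pos (k + k') (l + l') z = (if pos k l z \<le> k then pos k l z else pos k l z + k' + l')"
  by (cases z) (auto simp: points_def)

text \<open>In the order of the product, the points of \<open>q\<close> form an interval placed
  between the upper and the lower points of \<open>p\<close>. So no block of one factor can cross a
  block of the other.\<close>

lemma ncr_tensor:
  assumes p: "p \<in> Part k l" "ncr (pos k l) (blocks p)" and q: "q \<in> Part k' l'" "ncr (pos k' l') (blocks q)"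
  shows "ncr (pos (k + k') (l + l')) (blocks (tensor p q))"
proof -
  let ?f = "pos (k + k') (l + l')"
  have kl: "nup p = k" "nlow p = l" using p by (auto simp: Part_iff)
  have p': "ncr ?f (blocks p)"
  proof (rule ncr_mono[OF p(2)])
    fix x y assume "x \<in> \<Union>(blocks p)" "y \<in> \<Union>(blocks p)" "?f x < ?f y"
    then show "pos k l x < pos k l y" unfolding Union_blocks[OF p(1)]
      by (auto simp: unshift_points split: if_splits)
  qed
  have q': "ncr ?f ((`) (shift k l) ` blocks q)"
    unfolding ncr_def
  proof (intro ballI impI)
    fix B C a c b d assume B: "B \<in> (`) (shift k l) ` blocks q" "C \<in> (`) (shift k l) ` blocks q"
      "a \<in> B" "c \<in> B" "b \<in> C" "d \<in> C" and lt: "?f a < ?f b" "?f b < ?f c" "?f c < ?f d"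
    obtain B' C' where B': "B' \<in> blocks q" "B = shift k l ` B'" "C' \<in> blocks q" "C = shift k l ` C'" using B by auto
    obtain a' c' b' d' where m: "a' \<in> B'" "c' \<in> B'" "b' \<in> C'" "d' \<in> C'"
      "a = shift k l a'" "c = shift k l c'" "b = shift k l b'" "d = shift k l d'"
      using B B' by auto
    have pt: "x \<in> points k' l'" if "x \<in> B' \<or> x \<in> C'" for x using that B' Union_blocks[OF q(1)] by blast
    have "pos k' l' a' < pos k' l' b'" "pos k' l' b' < pos k' l' c'" "pos k' l' c' < pos k' l' d'"
      using lt m pt by (simp_all add: shift_points)
    then show "B = C" using ncrD[OF q(2) B'(1,3) m(1-4)] B' by simp
  qed
  have in1: "?f x \<le> k \<or> k + k' + l' < ?f x" if "B \<in> blocks p" "x \<in> B" for B x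
  proof -
    have "x \<in> points k l" using that Union_blocks[OF p(1)] by blast
    then show ?thesis by (auto simp: unshift_points)
  qed
  have in2: "k < ?f x \<and> ?f x \<le> k + k' + l'" if Bx: "B \<in> (`) (shift k l) ` blocks q" "x \<in> B" for B x
  proof -
    obtain C where C: "C \<in> blocks q" "B = shift k l ` C" using Bx(1) by (elim imageE)
    then obtain y where y: "y \<in> C" "x = shift k l y" using Bx(2) by auto
    then have "y \<in> points k' l'" using C Union_blocks[OF q(1)] by auto
    then show ?thesis using pos_less[of y k' l'] by (simp add: y(2) shift_points)
  qed
  show ?thesis
    unfolding blocks_tensor kl
  proof (subst ncr_def, intro ballI impI)
    fix B C a c b d assume B: "B \<in> blocks p \<union> (`) (shift k l) ` blocks q" "C \<in> blocks p \<union> (`) (shift k l) ` blocks q"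
      and m: "a \<in> B" "c \<in> B" "b \<in> C" "d \<in> C" and lt: "?f a < ?f b" "?f b < ?f c" "?f c < ?f d"
    from B show "B = C"
    proof (elim UnE)
      assume "B \<in> blocks p" "C \<in> blocks p"
      then show ?thesis using ncrD[OF p' _ _ m lt] by simp
    next
      assume "B \<in> (`) (shift k l) ` blocks q" "C \<in> (`) (shift k l) ` blocks q"
      then show ?thesis using ncrD[OF q' _ _ m lt] by simp
    next
      assume a: "B \<in> blocks p" "C \<in> (`) (shift k l) ` blocks q"
      then show ?thesis using in1[OF a(1) m(2)] in2[OF a(2) m(3)] in2[OF a(2) m(4)] lt by linarith
    next
      assume a: "B \<in> (`) (shift k l) ` blocks q" "C \<in> blocks p"
      then show ?thesis using in1[OF a(2) m(3)] in2[OF a(1) m(1)] in2[OF a(1) m(2)] lt by linarith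
    qed
  qed
qed

lemma tensor_NC: "p \<in> NC k l \<Longrightarrow> q \<in> NC k' l' \<Longrightarrow> tensor p q \<in> NC (k + k') (l + l')"
  unfolding NC_iff using ncr_tensor tensor_Part by blast

lemma tensor_NC2:
  assumes "p \<in> NC2 k l" "q \<in> NC2 k' l'"
  shows "tensor p q \<in> NC2 (k + k') (l + l')"
  unfolding NC2_iff
proof (intro conjI ballI)
  show "tensor p q \<in> Part (k + k') (l + l')" using assms by (simp add: NC2_iff tensor_Part)
  show "ncr (pos (k + k') (l + l')) (blocks (tensor p q))" using assms ncr_tensor unfolding NC2_iff by blast
  fix B assume "B \<in> blocks (tensor p q)"
  then show "card B = 2" unfolding blocks_tensor
    using assms card_image[OF inj_on_subset[OF inj_shift subset_UNIV]] by (auto simp: NC2_iff)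
qed

lemma fatten_id: "fatten (id_diagram (2 * k)) = id_diagram k"
proof (rule diagram_eqI)
  note p = id_NC2[of "2 * k"]
  show "nup (fatten (id_diagram (2 * k))) = nup (id_diagram k)" "nlow (fatten (id_diagram (2 * k))) = nlow (id_diagram k)"
    by (simp_all add: nup_fatten[OF p] nlow_fatten[OF p])
  have "(\<lambda>i. Suc i div 2) ` {1..2 * k} = {1..k}"
  proof (intro equalityI subsetI)
    fix a assume "a \<in> {1..k}"
    then show "a \<in> (\<lambda>i. Suc i div 2) ` {1..2 * k}" by (intro image_eqI[of _ _ "2 * a"]) auto
  qed auto
  moreover have "(`) hpt ` blocks (id_diagram (2 * k)) = (\<lambda>a. {Up a, Low a}) ` (\<lambda>i. Suc i div 2) ` {1..2 * k}"
    by (simp add: image_image)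
  ultimately have "(`) hpt ` blocks (id_diagram (2 * k)) = blocks (id_diagram k)" by simp
  then show "blocks (fatten (id_diagram (2 * k))) = blocks (id_diagram k)"
    unfolding blocks_fatten[OF p] using id_Part[of k] components_partition[of "points k k" "blocks (id_diagram k)"]
    by (simp only: Part_iff)
qed

lemma hpt_shift: "hpt \<circ> shift (2 * k) (2 * l) = shift k l \<circ> hpt"
  by (rule ext, rename_tac z, case_tac z) auto

lemma fatten_tensor:
  assumes p: "p \<in> NC2 (2 * k) (2 * l)" and q: "q \<in> NC2 (2 * k') (2 * l')"
  shows "fatten (tensor p q) = tensor (fatten p) (fatten q)"
proof (rule diagram_eqI)
  have pq: "tensor p q \<in> NC2 (2 * (k + k')) (2 * (l + l'))"
    using tensor_NC2[OF p q] by (simp add: algebra_simps)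
  show "nup (fatten (tensor p q)) = nup (tensor (fatten p) (fatten q))"
    "nlow (fatten (tensor p q)) = nlow (tensor (fatten p) (fatten q))"
    by (simp_all add: nup_fatten[OF p] nlow_fatten[OF p] nup_fatten[OF q] nlow_fatten[OF q]
        nup_fatten[OF pq] nlow_fatten[OF pq])
  have kl: "nup p = 2 * k" "nlow p = 2 * l" using p by (auto simp: NC2_iff Part_iff)
  let ?P = "(`) hpt ` blocks p" and ?Q = "(`) hpt ` blocks q"
  note U = Union_hpt_blocks[OF NC2_Part[OF p]] Union_hpt_blocks[OF NC2_Part[OF q]]
  have "(`) hpt ` blocks (tensor p q) = ?P \<union> (`) (shift k l) ` ?Q"
    unfolding blocks_tensor kl image_Un image_image_comp hpt_shift ..
  moreover have "\<Union>?P \<inter> \<Union>((`) (shift k l) ` ?Q) = {}"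
    unfolding Union_image_image[of "shift k l"] U by (rule points_add_disjoint)
  moreover have "components ((`) (shift k l) ` ?Q) = (`) (shift k l) ` components ?Q"
    by (rule components_image) (rule inj_on_subset[OF inj_shift subset_UNIV])
  ultimately show "blocks (fatten (tensor p q)) = blocks (tensor (fatten p) (fatten q))"
    by (simp add: blocks_fatten[OF pq] blocks_fatten[OF p] blocks_fatten[OF q] components_disjoint_Un
        blocks_tensor nup_fatten[OF p] nlow_fatten[OF p])
qed

lemma card_blocks_tensor:
  assumes "p \<in> Part k l" "q \<in> Part k' l'"
  shows "card (blocks (tensor p q)) = card (blocks p) + card (blocks q)"
proof -
  have kl: "nup p = k" "nlow p = l" using assms by (auto simp: Part_iff)
  have fin: "finite (blocks p)" "finite (blocks q)"
    using assms finite_elements[OF finite_points] unfolding Part_iff by blast+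
  have "blocks p \<inter> (`) (shift k l) ` blocks q = {}"
  proof (rule ccontr)
    assume "blocks p \<inter> (`) (shift k l) ` blocks q \<noteq> {}"
    then obtain B where B: "shift k l ` B \<in> blocks p" "B \<in> blocks q" by blast
    have "B \<noteq> {}" using B assms(2) by (auto simp: Part_iff partition_on_def)
    then obtain z where z: "z \<in> B" by blast
    have "z \<in> points k' l'" using B z Union_blocks[OF assms(2)] by blast
    moreover have "shift k l z \<in> points k l" using B z Union_blocks[OF assms(1)] by blast
    ultimately show False using points_add_disjoint[of k l k' l'] by blast
  qed
  moreover have "card ((`) (shift k l) ` blocks q) = card (blocks q)"
    by (intro card_image inj_on_subset[OF inj_image_inj[OF inj_shift]]) simp
  ultimately show ?thesis unfolding blocks_tensor kl using fin by (simp add: card_Un_disjoint)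
qed

subsection \<open>Composition\<close>

text \<open>A stack is cut open along its left side: from left to right the line shows the upper and the
  lower points of \<open>p\<close>, then the upper and the lower points of \<open>q\<close>, each in the order used by \<open>pos\<close>.
  The two copies of the middle points are then nested around the position \<open>k + l\<close>, and composing
  means capping them off from the inside to the outside. \<open>strip\<close> glues the copies together again.\<close>

definition strip :: "nat \<Rightarrow> nat \<Rightarrow> nat \<Rightarrow> nat \<Rightarrow> stack_point" where
  "strip k l m a = (if a \<le> k then Top a else if a \<le> k + l then Mid (k + l + 1 - a)
    else if a \<le> k + 2 * l then Mid (a - (k + l)) else Bot (k + 2 * l + m + 1 - a))"

lemma strip_upper: "z \<in> points k l \<Longrightarrow> strip k l m (pos k l z) = upper_part z"
  by (cases z) (auto simp: strip_def)

lemma strip_lower: "z \<in> points l m \<Longrightarrow> strip k l m (k + l + pos l m z) = lower_part z"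
  by (cases z) (auto simp: strip_def)

lemma Union_line: "p \<in> Part k l \<Longrightarrow> \<Union>(line c k l p) = {c + 1..c + k + l}"
proof -
  assume p: "p \<in> Part k l"
  have "\<Union>(line c k l p) = (+) c ` pos k l ` points k l"
    unfolding line_def Union_image_image Union_blocks[OF p] image_image ..
  also have "\<dots> = {c + 1..c + k + l}" unfolding pos_image by (simp add: add.assoc)
  finally show ?thesis .
qed

lemma image_strip_line:
  assumes p: "p \<in> Part k l" and q: "q \<in> Part l m"
  shows "(`) (strip k l m) ` (line 0 k l p \<union> line (k + l) l m q) =
    (`) upper_part ` blocks p \<union> (`) lower_part ` blocks q"
proof -
  have "strip k l m ` (\<lambda>z. 0 + pos k l z) ` B = upper_part ` B" if "B \<in> blocks p" for B
  proof -
    have "B \<subseteq> points k l" using that Union_blocks[OF p] by auto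
    then show ?thesis unfolding image_image by (intro image_cong refl) (auto simp: strip_upper)
  qed
  then have 1: "(`) (strip k l m) ` line 0 k l p = (`) upper_part ` blocks p"
    unfolding line_def image_image[of "(`) _"] by (rule image_cong[OF refl])
  have "strip k l m ` (\<lambda>z. k + l + pos l m z) ` B = lower_part ` B" if "B \<in> blocks q" for B
  proof -
    have "B \<subseteq> points l m" using that Union_blocks[OF q] by auto
    then show ?thesis unfolding image_image by (intro image_cong refl) (auto simp: strip_lower)
  qed
  then have "(`) (strip k l m) ` line (k + l) l m q = (`) lower_part ` blocks q"
    unfolding line_def image_image[of "(`) _"] by (rule image_cong[OF refl])
  then show ?thesis unfolding image_Un 1 by simp
qed

text \<open>Positions with the same image are the two copies of one middle point, placed
  symmetrically about the gap after \<open>k + l\<close>; these are precisely the ends of the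
  caps.\<close>

lemma strip_eqD:
  assumes "strip k l m a = strip k l m b" "a \<in> {1..k + 2 * l + m}" "b \<in> {1..k + 2 * l + m}" "a < b"
  shows "k < a \<and> a \<le> k + l \<and> a + b = 2 * (k + l) + 1"
  using assms unfolding strip_def by (auto split: if_splits)

lemma caps_mem: "l \<le> c \<Longrightarrow> c < a + l \<Longrightarrow> a \<le> c \<Longrightarrow> a + b = 2 * c + 1 \<Longrightarrow> {a, b} \<in> caps c l"
  unfolding caps_def by (intro image_eqI[of _ _ "c - a"]) auto

lemma capsE:
  assumes "B \<in> caps c l"
  obtains i where "i < l" "B = {c - i, Suc (c + i)}"
  using assms unfolding caps_def by blast

lemma gluing_strip:
  assumes p: "p \<in> Part k l" and q: "q \<in> Part l m"
  shows "gluing (strip k l m) (line 0 k l p \<union> line (k + l) l m q) (caps (k + l) l)"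
proof
  let ?S = "line 0 k l p \<union> line (k + l) l m q"
  have U: "\<Union>?S = {1..k + 2 * l + m}"
    unfolding Union_Un_distrib Union_line[OF p] Union_line[OF q] by auto
  have sub: "B \<subseteq> {1..k + 2 * l + m}" if "B \<in> caps (k + l) l" for B
    using that by (elim capsE) auto
  then show "\<Union>(caps (k + l) l) \<subseteq> \<Union>?S" unfolding U by blast
  have st: "strip k l m (k + l - i) = strip k l m (Suc (k + l + i))" if "i < l" for i
    using that by (auto simp: strip_def)
  show "strip k l m x = strip k l m y" if "B \<in> caps (k + l) l" "x \<in> B" "y \<in> B" for B x y
    using that(2,3) st capsE[OF that(1)] by (metis insertE singletonD)
  fix x y assume xy: "x \<in> \<Union>?S" "y \<in> \<Union>?S" "strip k l m x = strip k l m y"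
  have *: "(a, b) \<in> conn (?S \<union> caps (k + l) l)"
    if "a \<in> \<Union>?S" "b \<in> \<Union>?S" "strip k l m a = strip k l m b" "a < b" for a b
  proof -
    have "k < a \<and> a \<le> k + l \<and> a + b = 2 * (k + l) + 1" using strip_eqD that unfolding U by blast
    then have "{a, b} \<in> caps (k + l) l" by (intro caps_mem) auto
    then show ?thesis by (intro conn_base[of "{a, b}"]) auto
  qed
  consider "x = y" | "x < y" | "y < x" by linarith
  then show "(x, y) \<in> conn (?S \<union> caps (k + l) l)"
  proof cases
    case 1
    have "x \<in> \<Union>(?S \<union> caps (k + l) l)" using xy(1) by (simp only: Union_Un_distrib Un_iff) simp
    then show ?thesis unfolding 1[symmetric] by (rule conn_refl)
  next
    case 2 then show ?thesis using *[OF xy(1,2,3)] by simp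
  next
    case 3 then show ?thesis using *[OF xy(2,1) xy(3)[symmetric]] conn_sym by fast
  qed
qed

lemma
  assumes p: "p \<in> Part k l" and q: "q \<in> Part l m"
  defines "S \<equiv> line 0 k l p \<union> line (k + l) l m q \<union> caps (k + l) l"
  shows outer_compose_line: "(`) outer ` blocks (compose_diagram q p) = (`) (strip k l m) ` elim (midset (k + l) l) S"
    and loops_line: "loops q p = nin (midset (k + l) l) S"
proof -
  let ?S = "line 0 k l p \<union> line (k + l) l m q"
  interpret gluing "strip k l m" ?S "caps (k + l) l" by (rule gluing_strip[OF p q])
  have U: "\<Union>S = {1..k + 2 * l + m}"
    using F_Union unfolding S_def Union_Un_distrib Union_line[OF p] Union_line[OF q] by auto
  have M: "strip k l m -` range Mid \<inter> \<Union>S = midset (k + l) l \<inter> \<Union>S"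
    unfolding midset_conv[of l "k + l", simplified] U by (auto simp: strip_def split: if_splits)
  show "(`) outer ` blocks (compose_diagram q p) = (`) (strip k l m) ` elim (midset (k + l) l) S"
    unfolding outer_compose image_strip_line[OF p q, symmetric] elim_glue
    unfolding S_def[symmetric] elim_cong[OF M] ..
  show "loops q p = nin (midset (k + l) l) S"
    unfolding loops_def stack_components_def image_strip_line[OF p q, symmetric] nin_def[symmetric] nin_glue
    unfolding S_def[symmetric] nin_cong[OF M] ..
qed

text \<open>The position of an outer point of a stack with \<open>l\<close> middle points.\<close>

definition epos :: "nat \<Rightarrow> nat \<Rightarrow> nat \<Rightarrow> point \<Rightarrow> nat" where
  "epos k l m z = (case z of Up i \<Rightarrow> i | Low j \<Rightarrow> pos k m z + 2 * l)"

lemma strip_epos: "z \<in> points k m \<Longrightarrow> strip k l m (epos k l m z) = outer z"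
  by (cases z) (auto simp: strip_def epos_def)

lemma epos_less_iff: "x \<in> points k m \<Longrightarrow> y \<in> points k m \<Longrightarrow> epos k l m x < epos k l m y \<longleftrightarrow> pos k m x < pos k m y"
  by (cases x; cases y) (auto simp: epos_def)

lemma inj_epos: "inj_on (epos k l m) (points k m)"
proof (rule inj_onI)
  fix x y assume xy: "x \<in> points k m" "y \<in> points k m" "epos k l m x = epos k l m y"
  then have "pos k m x = pos k m y" using epos_less_iff[OF xy(1,2)] epos_less_iff[OF xy(2,1)] by (metis less_irrefl linorder_neqE_nat)
  then show "x = y" using inj_pos xy by (metis inj_onD)
qed

lemma epos_image: "epos k l m ` points k m = {1..k} \<union> {k + 2 * l + 1..k + 2 * l + m}"
proof (intro equalityI subsetI)
  fix a assume a: "a \<in> {1..k} \<union> {k + 2 * l + 1..k + 2 * l + m}"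
  show "a \<in> epos k l m ` points k m"
  proof (cases "a \<le> k")
    case True
    then show ?thesis using a by (intro image_eqI[of _ _ "Up a"]) (auto simp: epos_def)
  next
    case False
    then show ?thesis using a by (intro image_eqI[of _ _ "Low (k + 2 * l + m + 1 - a)"]) (auto simp: epos_def)
  qed
next
  fix a assume "a \<in> epos k l m ` points k m"
  then obtain z where "a = epos k l m z" "z \<in> points k m" by (elim imageE)
  then show "a \<in> {1..k} \<union> {k + 2 * l + 1..k + 2 * l + m}" by (cases z) (auto simp: epos_def)
qed

text \<open>Both families have the same image under \<open>strip\<close>, which is injective on the
  outer positions. Valid for arbitrary partitions, this is applied to the strings as well as to
  their fattenings.\<close>

lemma blocks_compose_epos:
  assumes p: "p \<in> Part k l" and q: "q \<in> Part l m"
  shows "(`) (epos k l m) ` blocks (compose_diagram q p) =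
    elim (midset (k + l) l) (line 0 k l p \<union> line (k + l) l m q \<union> caps (k + l) l)"
    (is "_ = elim ?M ?S")
proof (rule image_image_eqD)
  let ?X = "{1..k} \<union> {k + 2 * l + 1..k + 2 * l + m}"
  have c: "\<Union>(blocks (compose_diagram q p)) = points k m"
    using Union_blocks[OF compose_Part[OF p q]] .
  show "inj_on (strip k l m) ?X"
  proof (rule inj_onI, rule ccontr)
    fix a b assume ab: "a \<in> ?X" "b \<in> ?X" "strip k l m a = strip k l m b" "a \<noteq> b"
    then have "a \<in> {1..k + 2 * l + m}" "b \<in> {1..k + 2 * l + m}" by auto
    then show False using strip_eqD[of k l m a b] strip_eqD[of k l m b a] ab by (auto simp: neq_iff)
  qed
  show "\<Union>((`) (epos k l m) ` blocks (compose_diagram q p)) \<subseteq> ?X"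
    unfolding Union_image_image c epos_image ..
  have "\<Union>?S \<subseteq> {1..k + 2 * l + m}"
    using gluing.F_Union[OF gluing_strip[OF p q]] unfolding Union_Un_distrib Union_line[OF p] Union_line[OF q] by auto
  then show "\<Union>(elim ?M ?S) \<subseteq> ?X" unfolding Union_elim midset_conv[of l "k + l", simplified] by auto
  have "strip k l m ` epos k l m ` B = outer ` B" if "B \<in> blocks (compose_diagram q p)" for B
  proof -
    have "B \<subseteq> points k m" using that c by auto
    then show ?thesis unfolding image_image by (intro image_cong refl) (auto simp: strip_epos)
  qed
  then have "(`) (strip k l m) ` (`) (epos k l m) ` blocks (compose_diagram q p) = (`) outer ` blocks (compose_diagram q p)"
    unfolding image_image[of "(`) _"] by (rule image_cong[OF refl])
  then show "(`) (strip k l m) ` (`) (epos k l m) ` blocks (compose_diagram q p) = (`) (strip k l m) ` elim ?M ?S"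
    unfolding outer_compose_line[OF p q] .
qed

lemma old_midset: "n \<le> c \<Longrightarrow> old (midset c n) = Suc ` midset (2 * c) (2 * n)"
proof (rule Set.set_eqI)
  fix z assume "n \<le> c"
  then have "z \<in> old (midset c n) \<longleftrightarrow> c + 1 - n \<le> z div 2 \<and> z div 2 \<le> c + n"
    by (simp add: old_iff midset_conv)
  also have "\<dots> \<longleftrightarrow> 1 \<le> z \<and> 2 * c + 1 - 2 * n \<le> z - 1 \<and> z - 1 \<le> 2 * c + 2 * n" using \<open>n \<le> c\<close> by linarith
  also have "\<dots> \<longleftrightarrow> z \<in> Suc ` midset (2 * c) (2 * n)"
    using \<open>n \<le> c\<close> by (cases z) (auto simp: midset_conv)
  finally show "z \<in> old (midset c n) \<longleftrightarrow> z \<in> Suc ` midset (2 * c) (2 * n)" .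
qed

text \<open>Up to the offset of one, doubling \<open>n\<close> nested caps gives
  \<open>2 * n\<close> nested caps: the strings with even number are the inner sides and those with
  odd number the outer sides. So capping the fattened blocks and composing the strings use the same
  data.\<close>

lemma old_caps_conv: "n \<le> c \<Longrightarrow> old_caps c n = (`) Suc ` caps (2 * c) (2 * n)"
proof (intro equalityI subsetI)
  assume nc: "n \<le> c"
  fix B assume "B \<in> old_caps c n"
  then obtain i where i: "i < n" "B = {Suc (2 * (c - i)), 2 * Suc (c + i)} \<or> B = {2 * (c - i), Suc (2 * Suc (c + i))}"
    unfolding old_caps_def by blast
  from i(2) show "B \<in> (`) Suc ` caps (2 * c) (2 * n)"
  proof
    assume B: "B = {Suc (2 * (c - i)), 2 * Suc (c + i)}"
    show ?thesis unfolding caps_def image_image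
      by (rule image_eqI[of _ _ "2 * i"]) (use i nc B in \<open>auto simp: diff_mult_distrib2\<close>)
  next
    assume B: "B = {2 * (c - i), Suc (2 * Suc (c + i))}"
    have "2 * (c - i) = Suc (2 * c - Suc (2 * i))" using i(1) nc by linarith
    then show ?thesis unfolding caps_def image_image
      by (intro image_eqI[of _ _ "Suc (2 * i)"]) (use i(1) nc B in auto)
  qed
next
  assume nc: "n \<le> c"
  fix B assume "B \<in> (`) Suc ` caps (2 * c) (2 * n)"
  then obtain j where j: "j < 2 * n" "B = {Suc (2 * c - j), Suc (Suc (2 * c + j))}"
    unfolding caps_def by auto
  show "B \<in> old_caps c n"
  proof (cases "even j")
    case True
    then obtain i where i: "j = 2 * i" by (rule evenE)
    then have "B = {Suc (2 * (c - i)), 2 * Suc (c + i)}" using j by (auto simp: diff_mult_distrib2)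
    then show ?thesis unfolding old_caps_def using i j(1) by auto
  next
    case False
    then obtain i where i: "j = 2 * i + 1" by (rule oddE)
    have "Suc (2 * c - j) = 2 * (c - i)" using i j(1) nc by linarith
    then have "B = {2 * (c - i), Suc (2 * Suc (c + i))}" using j i by auto
    then show ?thesis unfolding old_caps_def using i j(1) by auto
  qed
qed

lemma oline_conv: "oline c k l p = (`) Suc ` line (2 * c) (2 * k) (2 * l) p"
  unfolding oline_def line_def opos_def image_image_comp comp_def by simp

lemma nc_pairing_Un:
  assumes "nc_pairing A \<pi>" "nc_pairing B \<rho>" and lt: "\<And>a b. a \<in> A \<Longrightarrow> b \<in> B \<Longrightarrow> a < b"
  shows "nc_pairing (A \<union> B) (\<pi> \<union> \<rho>)"
proof -
  interpret P: nc_pairing A \<pi> by fact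
  interpret R: nc_pairing B \<rho> by fact
  have lto: "x < y" if "x \<in> old A" "y \<in> old B" for x y
    using lt[of "x div 2" "y div 2"] that by (auto simp: old_iff)
  show ?thesis
  proof
    show "finite (A \<union> B)" using P.finA R.finA by simp
    have "old A \<inter> old B = {}" using lto by (meson disjoint_iff less_irrefl)
    then show "partition_on (old (A \<union> B)) (\<pi> \<union> \<rho>)"
      unfolding old_Un using partition_on_Un P.part R.part by blast
    show "card C = 2" if "C \<in> \<pi> \<union> \<rho>" for C using that P.two R.two by blast
    show "ncr (\<lambda>z. z) (\<pi> \<union> \<rho>)"
      unfolding ncr_def
    proof (intro ballI impI)
      fix C D a c b d
      assume C: "C \<in> \<pi> \<union> \<rho>" "D \<in> \<pi> \<union> \<rho>" and m: "a \<in> C" "c \<in> C" "b \<in> D" "d \<in> D" and l: "a < b" "b < c" "c < d"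
      from C show "C = D"
      proof (elim UnE)
        assume "C \<in> \<pi>" "D \<in> \<pi>"
        then show ?thesis using ncrD[OF P.nc _ _ m l] by simp
      next
        assume "C \<in> \<rho>" "D \<in> \<rho>"
        then show ?thesis using ncrD[OF R.nc _ _ m l] by simp
      next
        assume "C \<in> \<pi>" "D \<in> \<rho>"
        then have "c < b" using lto P.block_old R.block_old m by blast
        then show ?thesis using l by simp
      next
        assume "C \<in> \<rho>" "D \<in> \<pi>"
        then have "b < a" using lto P.block_old R.block_old m by blast
        then show ?thesis using l by simp
      qed
    qed
  qed
qed

lemma epos_hpt:
  assumes "z \<in> points (2 * k) (2 * m)"
  shows "Suc (epos (2 * k) (2 * l) (2 * m) z) div 2 = epos k l m (hpt z)"
proof (cases z)
  case (Low j)
  then have "1 \<le> j" "j \<le> 2 * m" using assms by auto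
  then have "Suc (2 * k + (2 * m + 1 - j) + 2 * (2 * l)) div 2 = k + (m + 1 - Suc j div 2) + 2 * l"
    by linarith
  then show ?thesis by (simp add: Low epos_def)
qed (simp add: epos_def)

lemma card_blocks_line: "p \<in> Part k l \<Longrightarrow> card (line c k l p) = card (blocks p)"
proof -
  assume p: "p \<in> Part k l"
  have "inj_on (\<lambda>z. c + pos k l z) (\<Union>(blocks p))"
    unfolding Union_blocks[OF p] using inj_pos[of k l] by (simp add: inj_on_def)
  then show ?thesis unfolding line_def by (intro card_image inj_on_image)
qed

lemma euler_arith:
  fixes L F l R K L' P Q R' K' :: nat
  assumes "L + F = l + R + 2 * K" "L = L'" "K = K'" "F = P + Q" "R = R'"
  shows "L' + P + Q = l + R' + 2 * K'"
  using assms by simp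

text \<open>All three claims are read off from \<open>cap_all\<close> applied to the two lines
  placed side by side, with one cap for each of the \<open>l\<close> middle points of the fattened
  stack. The capped line is compared with the composite through an order-preserving relabelling of
  the outer points.\<close>

lemma
  assumes p: "p \<in> NC2 (2 * k) (2 * l)" and q: "q \<in> NC2 (2 * l) (2 * m)"
  shows compose_NC2: "compose_diagram q p \<in> NC2 (2 * k) (2 * m)"
    and fatten_compose: "fatten (compose_diagram q p) = compose_diagram (fatten q) (fatten p)"
    and euler_compose: "loops q p + card (blocks (fatten p)) + card (blocks (fatten q)) =
      l + card (blocks (fatten (compose_diagram q p))) + 2 * loops (fatten q) (fatten p)"
proof -
  note pP = NC2_Part[OF p] and qP = NC2_Part[OF q]
  have fp: "fatten p \<in> Part k l" and fq: "fatten q \<in> Part l m"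
    using fatten_NC[OF p] fatten_NC[OF q] NC_Part by blast+
  let ?c = "k + l" and ?A = "{1..k + 2 * l + m}" and ?M = "midset (k + l) l"
  let ?\<pi> = "oline 0 k l p \<union> oline ?c l m q"
  let ?\<rho> = "elim (old ?M) (?\<pi> \<union> old_caps ?c l)"
  have A: "{1..k + l} \<union> {k + l + 1..k + l + l + m} = ?A" by auto
  have nc\<pi>: "nc_pairing ?A ?\<pi>"
  proof -
    have "nc_pairing ({1..k + l} \<union> {k + l + 1..k + l + l + m}) ?\<pi>"
      using nc_pairing_Un[OF nc_pairing_oline[OF p, of 0] nc_pairing_oline[OF q, of ?c]] by simp
    then show ?thesis by (simp only: A)
  qed
  have MA: "?M \<subseteq> ?A" unfolding midset_conv[of l ?c, simplified] by auto
  have lc: "l \<le> ?c" by simp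
  note main = cap_all[OF nc\<pi> lc MA]
  have U1: "\<Union>(oline 0 k l p) = old {1..k + l}"
    and U2: "\<Union>(oline ?c l m q) = old {?c + 1..?c + l + m}"
    using nc_pairing.part[OF nc_pairing_oline[OF p, of 0]] nc_pairing.part[OF nc_pairing_oline[OF q, of ?c]]
    by (simp_all add: partition_on_def)
  have fat\<pi>: "fat ?\<pi> = line 0 k l (fatten p) \<union> line ?c l m (fatten q)"
  proof -
    have "\<Union>(half (oline 0 k l p)) \<inter> \<Union>(half (oline ?c l m q)) = {}"
      unfolding Union_image_image U1 U2 by (auto simp: old_iff)
    then have "fat ?\<pi> = fat (oline 0 k l p) \<union> fat (oline ?c l m q)"
      unfolding fat_def image_Un by (rule components_disjoint_Un)
    then show ?thesis unfolding fat_oline[OF p] fat_oline[OF q] .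
  qed
  have caps: "?\<pi> \<union> old_caps ?c l =
      (`) Suc ` (line 0 (2 * k) (2 * l) p \<union> line (2 * k + 2 * l) (2 * l) (2 * m) q \<union> caps (2 * k + 2 * l) (2 * l))"
    (is "_ = (`) Suc ` ?S")
    using old_caps_conv[of l ?c] by (simp add: oline_conv image_Un distrib_left)
  have oM: "old ?M = Suc ` midset (2 * k + 2 * l) (2 * l)"
    using old_midset[of l ?c] by (simp add: distrib_left)
  have injS: "inj_on Suc X" for X by simp
  have SM: "Suc -` old ?M = midset (2 * k + 2 * l) (2 * l)" unfolding oM by (simp add: inj_vimage_image_eq)
  let ?d = "compose_diagram q p"
  have dP: "?d \<in> Part (2 * k) (2 * m)" using compose_Part[OF pP qP] .
  have \<rho>: "?\<rho> = (`) Suc ` (`) (epos (2 * k) (2 * l) (2 * m)) ` blocks ?d"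
    unfolding caps elim_image[OF injS] SM blocks_compose_epos[OF pP qP] ..
  \<comment> \<open>The relabelling \<open>?e\<close> leaves the gap of the eliminated middle points
    in place. It has the same order as \<open>pos\<close>, so being non-crossing passes to the
    composite.\<close>
  have \<rho>': "?\<rho> = (`) (\<lambda>z. Suc (epos (2 * k) (2 * l) (2 * m) z)) ` blocks ?d" (is "_ = (`) ?e ` _")
    unfolding \<rho> image_image_comp comp_def ..
  have inje: "inj_on ?e (points (2 * k) (2 * m))" using inj_epos[of "2 * k" "2 * l" "2 * m"] by (simp add: inj_on_def)
  interpret R: nc_pairing "?A - ?M" ?\<rho> using main by blast
  show d: "?d \<in> NC2 (2 * k) (2 * m)"
    unfolding NC2_iff
  proof (intro conjI ballI)
    have "ncr ?e (blocks ?d)"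
      by (rule ncr_imageD) (use inje R.nc in \<open>simp_all only: Union_blocks[OF dP] \<rho>'\<close>)
    then show "ncr (pos (2 * k) (2 * m)) (blocks ?d)"
      by (rule ncr_mono) (simp add: Union_blocks[OF dP] epos_less_iff)
    fix B assume B: "B \<in> blocks ?d"
    then have "B \<subseteq> points (2 * k) (2 * m)" using Union_blocks[OF dP] by blast
    then have "card (?e ` B) = card B" by (intro card_image inj_on_subset[OF inje])
    moreover have "card (?e ` B) = 2" by (rule R.two) (use B \<rho>' in blast)
    ultimately show "card B = 2" by simp
  qed (rule dP)
  have fat\<rho>: "fat ?\<rho> = (`) (epos k l m) ` blocks (fatten ?d)"
  proof -
    have "(\<lambda>z. z div 2) ` ?e ` B = epos k l m ` hpt ` B" if "B \<in> blocks ?d" for B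
    proof -
      have "B \<subseteq> points (2 * k) (2 * m)" using that Union_blocks[OF dP] by blast
      then show ?thesis unfolding image_image by (intro image_cong refl) (auto simp: epos_hpt)
    qed
    then have "half ?\<rho> = (`) (epos k l m) ` (`) hpt ` blocks ?d"
      unfolding \<rho>' image_image[of "(`) _"] by (rule image_cong[OF refl])
    moreover have "inj_on (epos k l m) (\<Union>((`) hpt ` blocks ?d))"
      unfolding Union_hpt_blocks[OF dP] by (rule inj_epos)
    ultimately show ?thesis unfolding fat_def blocks_fatten[OF d] by (simp add: components_image)
  qed
  have fat\<rho>': "fat ?\<rho> = (`) (epos k l m) ` blocks (compose_diagram (fatten q) (fatten p))"
    unfolding blocks_compose_epos[OF fp fq] using main unfolding fat\<pi> by blast
  have fd: "fatten ?d \<in> Part k m" using fatten_NC[OF d] NC_Part by blast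
  have "blocks (fatten ?d) = blocks (compose_diagram (fatten q) (fatten p))"
    by (rule image_image_eqD[OF inj_epos[of k l m]])
      (use fat\<rho> fat\<rho>' in \<open>simp_all add: Union_blocks[OF fd] Union_blocks[OF compose_Part[OF fp fq]]\<close>)
  then show "fatten ?d = compose_diagram (fatten q) (fatten p)"
    by (intro diagram_eqI) (simp_all add: nup_fatten[OF d] nlow_fatten[OF d] nup_fatten[OF p] nlow_fatten[OF q])
  have "nin (old ?M) (?\<pi> \<union> old_caps ?c l) = loops q p"
    unfolding caps nin_image[OF injS] SM loops_line[OF pP qP] ..
  moreover have "nin ?M (fat ?\<pi> \<union> caps ?c l) = loops (fatten q) (fatten p)"
    unfolding fat\<pi> loops_line[OF fp fq] ..
  moreover have "card (fat ?\<pi>) = card (blocks (fatten p)) + card (blocks (fatten q))"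
  proof -
    have "line 0 k l (fatten p) \<inter> line ?c l m (fatten q) = {}"
    proof (rule ccontr)
      assume "line 0 k l (fatten p) \<inter> line ?c l m (fatten q) \<noteq> {}"
      then obtain B where B: "B \<in> line 0 k l (fatten p)" "B \<in> line ?c l m (fatten q)" by blast
      have "B \<noteq> {}" using B(1) fp by (auto simp: line_def Part_iff partition_on_def)
      then obtain b where "b \<in> B" by blast
      then have "b \<in> {0 + 1..0 + k + l}" "b \<in> {?c + 1..?c + l + m}"
        using B Union_line[OF fp, of 0] Union_line[OF fq, of ?c] by blast+
      then show False by simp
    qed
    moreover have "finite (line 0 k l (fatten p))" "finite (line ?c l m (fatten q))"
      using fp fq finite_elements[OF finite_points] unfolding line_def Part_iff by blast+
    ultimately show ?thesis unfolding fat\<pi>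
      by (simp add: card_Un_disjoint card_blocks_line[OF fp] card_blocks_line[OF fq])
  qed
  moreover have "card (fat ?\<rho>) = card (blocks (fatten ?d))"
    unfolding fat\<rho> by (intro card_image inj_on_image) (simp add: Union_blocks[OF fd] inj_epos)
  ultimately show "loops q p + card (blocks (fatten p)) + card (blocks (fatten q)) =
      l + card (blocks (fatten ?d)) + 2 * loops (fatten q) (fatten p)"
    using euler_arith[OF conjunct2[OF conjunct2[OF main]]] by blast
qed

text \<open>Every non-crossing partition is a fattening, so closure under composition is inherited
  from the pairings.\<close>

lemma compose_NC:
  assumes "r \<in> NC k l" "r' \<in> NC l m"
  shows "compose_diagram r' r \<in> NC k m"
proof -
  obtain p q where "p \<in> NC2 (2 * k) (2 * l)" "fatten p = r" "q \<in> NC2 (2 * l) (2 * m)" "fatten q = r'"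
    using fatten_surj assms by metis
  then show ?thesis using compose_NC2 fatten_compose fatten_NC by metis
qed

subsection \<open>Traces and the coefficients\<close>

abbreviation id_blocks :: "nat \<Rightarrow> point set set" where
  "id_blocks k \<equiv> (\<lambda>i. {Up i, Low i}) ` {1..k}"

lemma caps_square: "caps k k = (`) (pos k k) ` id_blocks k"
proof -
  have "(`) (pos k k) ` id_blocks k = (\<lambda>i. {i, k + (k + 1 - i)}) ` {1..k}"
    by (simp add: image_image)
  also have "\<dots> = caps k k"
  proof (intro equalityI subsetI)
    fix B assume "B \<in> (\<lambda>i. {i, k + (k + 1 - i)}) ` {1..k}"
    then obtain i where "i \<in> {1..k}" "B = {i, k + (k + 1 - i)}" by (elim imageE)
    then show "B \<in> caps k k" by (auto intro!: caps_mem)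
  next
    fix B assume "B \<in> caps k k"
    then obtain i where "i < k" "B = {k - i, Suc (k + i)}" by (rule capsE)
    then show "B \<in> (\<lambda>i. {i, k + (k + 1 - i)}) ` {1..k}" by (intro image_eqI[of _ _ "k - i"]) auto
  qed
  finally show ?thesis ..
qed

text \<open>Closing a diagram is capping its whole line. No points and hence no fattened blocks
  remain, and every component counts as a loop.\<close>

lemma euler_trace:
  assumes p: "p \<in> NC2 (2 * k) (2 * k)"
  shows "card (components (blocks p \<union> id_blocks (2 * k))) + card (blocks (fatten p)) =
    k + 2 * card (components (blocks (fatten p) \<union> id_blocks k))"
proof -
  let ?A = "{1..2 * k}" and ?M = "midset k k" and ?\<pi> = "oline 0 k k p"
  have M: "?M = ?A" by (simp add: midset_conv mult_2)
  have nc\<pi>: "nc_pairing ?A ?\<pi>" using nc_pairing_oline[OF p, of 0] by (simp add: mult_2)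
  let ?\<rho> = "elim (old ?M) (?\<pi> \<union> old_caps k k)"
  have main: "nc_pairing (?A - ?M) ?\<rho> \<and> fat ?\<rho> = elim ?M (fat ?\<pi> \<union> caps k k) \<and>
      nin (old ?M) (?\<pi> \<union> old_caps k k) + card (fat ?\<pi>) = k + card (fat ?\<rho>) + 2 * nin ?M (fat ?\<pi> \<union> caps k k)"
    by (rule cap_all[OF nc\<pi>]) (simp_all add: M)
  interpret R: nc_pairing "{}" ?\<rho> using main unfolding M by simp
  have f0: "fat ?\<rho> = {}" using R.partition_fat by (simp add: partition_on_empty)
  have ninc: "nin X S = card (components S)" if "\<Union>S \<subseteq> X" for X and S :: "nat set set"
  proof -
    have "{K \<in> components S. K \<subseteq> X} = components S" using component_subset that by fast
    then show ?thesis unfolding nin_def by simp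
  qed
  note pP = NC2_Part[OF p]
  have fp: "fatten p \<in> Part k k" using fatten_NC[OF p] NC_Part by blast
  have id: "\<Union>(id_blocks k) = points k k" for k by (auto simp: points_def)
  have comp: "card (components (line 0 k k r \<union> caps k k)) = card (components (blocks r \<union> id_blocks k))"
    and sub: "\<Union>(line 0 k k r \<union> caps k k) = {1..2 * k}"
    if r: "r \<in> Part k k" for k r
  proof -
    have eq: "line 0 k k r \<union> caps k k = (`) (pos k k) ` (blocks r \<union> id_blocks k)"
      unfolding line_def caps_square image_Un by simp
    have U: "\<Union>(blocks r \<union> id_blocks k) = points k k"
      unfolding Union_Un_distrib id Union_blocks[OF r] by simp
    show "card (components (line 0 k k r \<union> caps k k)) = card (components (blocks r \<union> id_blocks k))"
      unfolding eq by (rule card_components_image) (simp only: U inj_pos)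
    show "\<Union>(line 0 k k r \<union> caps k k) = {1..2 * k}"
      unfolding eq Union_image_image U pos_image by (simp add: mult_2)
  qed
  have "?\<pi> \<union> old_caps k k = (`) Suc ` (line 0 (2 * k) (2 * k) p \<union> caps (2 * k) (2 * k))"
    by (simp add: oline_conv old_caps_conv image_Un)
  moreover have "\<Union>((`) Suc ` (line 0 (2 * k) (2 * k) p \<union> caps (2 * k) (2 * k))) \<subseteq> old ?M"
    unfolding Union_image_image sub[OF pP] M by (auto simp: old_iff)
  ultimately have "nin (old ?M) (?\<pi> \<union> old_caps k k) = card (components (blocks p \<union> id_blocks (2 * k)))"
    by (simp add: ninc card_components_image comp[OF pP])
  moreover have "nin ?M (fat ?\<pi> \<union> caps k k) = card (components (blocks (fatten p) \<union> id_blocks k))"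
    unfolding fat_oline[OF p] by (subst ninc) (simp_all only: sub[OF fp] comp[OF fp] M order_refl)
  moreover have "card (fat ?\<pi>) = card (blocks (fatten p))" unfolding fat_oline[OF p] card_blocks_line[OF fp] ..
  ultimately show ?thesis using main f0 by simp
qed

section \<open>The coefficients: completing diagrams to square shape\<close>

lemma pair_upper_NC2: "pair_upper \<in> NC2 2 0"
proof -
  have "points 2 0 = {Up 1, Up 2}"
  proof (rule Set.set_eqI)
    fix z show "z \<in> points 2 0 \<longleftrightarrow> z \<in> {Up 1, Up 2}" by (cases z) auto
  qed
  then show ?thesis
    unfolding NC2_iff Part_iff by (simp add: pair_upper_def partition_on_space ncr_def)
qed

lemma pair_lower_NC2: "pair_lower \<in> NC2 0 2"
proof -
  have "points 0 2 = {Low 1, Low 2}"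
  proof (rule Set.set_eqI)
    fix z show "z \<in> points 0 2 \<longleftrightarrow> z \<in> {Low 1, Low 2}" by (cases z) auto
  qed
  then show ?thesis
    unfolding NC2_iff Part_iff by (simp add: pair_lower_def partition_on_space ncr_def)
qed

lemma card_fatten_pair:
  "card (blocks (fatten pair_upper)) = 1" "card (blocks (fatten pair_lower)) = 1"
proof -
  have 1: "components {B} = {B}" if "B \<noteq> {}" for B :: "point set"
    using that by (intro components_partition[of B] partition_on_space)
  show "card (blocks (fatten pair_upper)) = 1"
    using blocks_fatten[of pair_upper 1 0] pair_upper_NC2 by (simp add: pair_upper_def 1)
  show "card (blocks (fatten pair_lower)) = 1"
    using blocks_fatten[of pair_lower 0 1] pair_lower_NC2 by (simp add: pair_lower_def 1)
qed

lemma tensor_power_pair: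
  assumes "p = pair_upper \<and> a = 1 \<and> b = 0 \<or> p = pair_lower \<and> a = 0 \<and> b = 1"
  shows "tensor_power p n \<in> NC2 (2 * (a * n)) (2 * (b * n)) \<and> card (blocks (fatten (tensor_power p n))) = n"
proof (induction n)
  case 0
  then show ?case using id_NC2[of 0] fatten_id[of 0] by simp
next
  case (Suc n)
  have p: "p \<in> NC2 (2 * a) (2 * b)" "card (blocks (fatten p)) = 1"
    using assms pair_upper_NC2 pair_lower_NC2 card_fatten_pair by auto
  have t: "tensor_power p n \<in> NC2 (2 * (a * n)) (2 * (b * n))" using Suc by blast
  have "tensor_power p (Suc n) \<in> NC2 (2 * (a * Suc n)) (2 * (b * Suc n))"
    using tensor_NC2[OF t p(1)] by (simp add: algebra_simps)
  moreover have "card (blocks (fatten (tensor_power p (Suc n)))) = Suc n"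
    using card_blocks_tensor[OF NC_Part[OF fatten_NC[OF t]] NC_Part[OF fatten_NC[OF p(1)]]] p(2) Suc
    by (simp add: fatten_tensor[OF t p(1)])
  ultimately show ?case by blast
qed

text \<open>Each added pair fattens to one block, so squaring adds the difference of
  \<open>k\<close> and \<open>l\<close> to the number of blocks.\<close>

lemma square_props:
  assumes p: "p \<in> NC2 (2 * k) (2 * l)"
  shows "square p \<in> NC2 (2 * max k l) (2 * max k l)"
    and "card (blocks (fatten (square p))) + min k l = card (blocks (fatten p)) + max k l"
proof -
  have kl: "nup p = 2 * k" "nlow p = 2 * l" using p by (auto simp: NC2_iff Part_iff)
  have "square p \<in> NC2 (2 * max k l) (2 * max k l) \<and>
    card (blocks (fatten (square p))) + min k l = card (blocks (fatten p)) + max k l"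
  proof (cases "k \<le> l")
    case True
    have t: "tensor_power pair_upper (l - k) \<in> NC2 (2 * (l - k)) (2 * 0)"
      "card (blocks (fatten (tensor_power pair_upper (l - k)))) = l - k"
      using tensor_power_pair[of pair_upper 1 0 "l - k"] by auto
    have s: "square p = tensor p (tensor_power pair_upper (l - k))" using True by (simp add: square_def kl)
    have "2 * k + 2 * (l - k) = 2 * l" "2 * l + 2 * 0 = 2 * l" using True by simp_all
    then have "square p \<in> NC2 (2 * l) (2 * l)" unfolding s
      using tensor_NC2[OF p t(1)] by (simp only:)
    moreover have "card (blocks (fatten (square p))) = card (blocks (fatten p)) + (l - k)"
      unfolding s fatten_tensor[OF p t(1)]
      using card_blocks_tensor[OF NC_Part[OF fatten_NC[OF p]] NC_Part[OF fatten_NC[OF t(1)]]] t(2) by simp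
    ultimately show ?thesis using True by simp
  next
    case False
    have t: "tensor_power pair_lower (k - l) \<in> NC2 (2 * 0) (2 * (k - l))"
      "card (blocks (fatten (tensor_power pair_lower (k - l)))) = k - l"
      using tensor_power_pair[of pair_lower 0 1 "k - l"] by auto
    have s: "square p = tensor p (tensor_power pair_lower (k - l))" using False by (simp add: square_def kl)
    have "2 * l + 2 * (k - l) = 2 * k" "2 * k + 2 * 0 = 2 * k" using False by simp_all
    then have "square p \<in> NC2 (2 * k) (2 * k)" unfolding s
      using tensor_NC2[OF p t(1)] by (simp only:)
    moreover have "card (blocks (fatten (square p))) = card (blocks (fatten p)) + (k - l)"
      unfolding s fatten_tensor[OF p t(1)]
      using card_blocks_tensor[OF NC_Part[OF fatten_NC[OF p]] NC_Part[OF fatten_NC[OF t(1)]]] t(2) by simp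
    ultimately show ?thesis using False by simp
  qed
  then show "square p \<in> NC2 (2 * max k l) (2 * max k l)"
    and "card (blocks (fatten (square p))) + min k l = card (blocks (fatten p)) + max k l" by auto
qed

text \<open>Thus \<open>a(p) = s\<^sup>-\<^sup>2\<^sup>\<chi>\<close>, where \<open>\<chi>\<close> is the Euler characteristic of the thickened blocks when each
  of the \<open>k + l\<close> boundary intervals counts one half, so that \<open>\<chi>\<close> is additive under gluing.\<close>

lemma coeff_a_eq:
  fixes s t :: complex
  assumes t: "t \<noteq> 0" "s\<^sup>2 = t" and p: "p \<in> NC2 (2 * k) (2 * l)"
  shows "coeff_a t s p * s ^ (2 * card (blocks (fatten p))) = s ^ (k + l)"
proof -
  have s: "s \<noteq> 0" using t by auto
  have kl: "nup p = 2 * k" "nlow p = 2 * l" using p by (auto simp: NC2_iff Part_iff)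
  let ?n = "max k l" and ?q = "square p"
  note q = square_props[OF p]
  have qn: "nup ?q = 2 * ?n" "nup (fatten ?q) = ?n"
    using q(1) nup_fatten[OF q(1)] by (auto simp: NC2_iff Part_iff)
  define L where "L = card (components (blocks ?q \<union> id_blocks (2 * ?n)))"
  define K where "K = card (components (blocks (fatten ?q) \<union> id_blocks ?n))"
  define b where "b = card (blocks (fatten p))"
  define d where "d = nat \<bar>int k - int l\<bar>"
  have eq: "L + card (blocks (fatten ?q)) = ?n + 2 * K"
    unfolding L_def K_def by (rule euler_trace[OF q(1)])
  have tr: "tr t ?q = s ^ (2 * L)" "tr (t\<^sup>2) (fatten ?q) = s ^ (4 * K)"
    unfolding tr_def qn L_def[symmetric] K_def[symmetric] t(2)[symmetric] by (simp_all add: power_mult[symmetric])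
  \<comment> \<open>The number of blocks of the square diagram is eliminated from the two counts;
    then \<open>2 * min k l + d = k + l\<close>.\<close>
  have "d + 2 * L + 2 * b = k + l + 4 * K"
    using eq q(2) unfolding b_def[symmetric] d_def by (auto simp: max_def min_def split: if_splits)
  then have "s ^ d * s ^ (2 * L) * s ^ (2 * b) = s ^ (k + l) * s ^ (4 * K)"
    unfolding power_add[symmetric] by simp
  moreover have "coeff_a t s p = s ^ d * (s ^ (2 * L) / s ^ (4 * K))"
    unfolding coeff_a_def Let_def tr kl d_def by simp
  ultimately have "coeff_a t s p * s ^ (2 * b) = s ^ (k + l) * s ^ (4 * K) / s ^ (4 * K)" by simp
  then show ?thesis unfolding b_def[symmetric] using s by simp
qed

lemma
  fixes s t :: complex
  assumes t: "t \<noteq> 0" "s\<^sup>2 = t" and p: "p \<in> NC2 (2 * k) (2 * l)"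
  shows coeff_a_nonzero: "coeff_a t s p \<noteq> 0"
    and coeff_a_tensor: "q \<in> NC2 (2 * k') (2 * l') \<Longrightarrow> coeff_a t s (tensor p q) = coeff_a t s p * coeff_a t s q"
    and coeff_a_compose: "q \<in> NC2 (2 * l) (2 * m) \<Longrightarrow>
      coeff_a t s (compose_diagram q p) * t ^ loops q p =
      coeff_a t s q * coeff_a t s p * (t\<^sup>2) ^ loops (fatten q) (fatten p)"
proof -
  have s: "s \<noteq> 0" using t by auto
  note cp = coeff_a_eq[OF t p]
  show "coeff_a t s p \<noteq> 0" using cp s by auto
  let ?b = "\<lambda>p. card (blocks (fatten p))"
  show "coeff_a t s (tensor p q) = coeff_a t s p * coeff_a t s q" if q: "q \<in> NC2 (2 * k') (2 * l')"
  proof -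
    have pq: "tensor p q \<in> NC2 (2 * (k + k')) (2 * (l + l'))"
      using tensor_NC2[OF p q] by (simp add: algebra_simps)
    have b: "?b (tensor p q) = ?b p + ?b q"
      unfolding fatten_tensor[OF p q]
      by (rule card_blocks_tensor[OF NC_Part[OF fatten_NC[OF p]] NC_Part[OF fatten_NC[OF q]]])
    have "coeff_a t s (tensor p q) * s ^ (2 * ?b (tensor p q)) =
        (coeff_a t s p * s ^ (2 * ?b p)) * (coeff_a t s q * s ^ (2 * ?b q))"
      unfolding coeff_a_eq[OF t pq] cp coeff_a_eq[OF t q] by (simp add: power_add)
    also have "\<dots> = coeff_a t s p * coeff_a t s q * s ^ (2 * ?b (tensor p q))"
      unfolding b by (simp add: power_add distrib_left)
    finally show ?thesis using s by simp
  qed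
  show "coeff_a t s (compose_diagram q p) * t ^ loops q p =
      coeff_a t s q * coeff_a t s p * (t\<^sup>2) ^ loops (fatten q) (fatten p)"
    if q: "q \<in> NC2 (2 * l) (2 * m)"
  proof -
    let ?d = "compose_diagram q p"
    note d = compose_NC2[OF p q]
    \<comment> \<open>Multiplying by this power clears the factors of all three coefficients by
      \<open>coeff_a_eq\<close>, and what remains is the exponent identity
      \<open>euler_compose\<close>.\<close>
    let ?N = "2 * ?b p + 2 * ?b q + 2 * ?b ?d"
    have "coeff_a t s ?d * t ^ loops q p * s ^ ?N =
        (coeff_a t s ?d * s ^ (2 * ?b ?d)) * s ^ (2 * (loops q p + ?b p + ?b q))"
      unfolding t(2)[symmetric] by (simp add: power_add power_mult[symmetric] distrib_left mult_ac)
    also have "\<dots> = s ^ (k + m) * s ^ (2 * (l + ?b ?d + 2 * loops (fatten q) (fatten p)))"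
      unfolding coeff_a_eq[OF t d] euler_compose[OF p q] ..
    also have "\<dots> = (coeff_a t s q * s ^ (2 * ?b q)) * (coeff_a t s p * s ^ (2 * ?b p)) *
        (s ^ (2 * ?b ?d) * s ^ (4 * loops (fatten q) (fatten p)))"
      unfolding cp coeff_a_eq[OF t q] power_add[symmetric] by (rule arg_cong[of _ _ "(^) s"]) simp
    also have "\<dots> = coeff_a t s q * coeff_a t s p * (t\<^sup>2) ^ loops (fatten q) (fatten p) * s ^ ?N"
      unfolding t(2)[symmetric] by (simp add: power_add power_mult[symmetric] mult_ac)
    finally show ?thesis using s by simp
  qed
qed

section \<open>Linear monoidal categories and their Karoubi envelopes\<close>

text \<open>Linearity is required of all elements of the ambient type, not only of the morphisms.\<close>

locale linear_monoidal_category = strict_monoidal_category C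
  for C :: "('o, 'm::comm_monoid_add, 'z) mcat_scheme" (structure) +
  assumes zero_Hom: "0 \<in> Hom C X Y"
    and add_Hom: "f \<in> Hom C X Y \<Longrightarrow> g \<in> Hom C X Y \<Longrightarrow> f + g \<in> Hom C X Y"
    and Comp_0_left: "Comp C 0 f = 0" and Comp_0_right: "Comp C f 0 = 0"
    and Comp_add_left: "Comp C (f + g) h = Comp C f h + Comp C g h"
    and Comp_add_right: "Comp C h (f + g) = Comp C h f + Comp C h g"
    and TensM_0_left: "TensM C 0 f = 0" and TensM_0_right: "TensM C f 0 = 0"
    and TensM_add_left: "TensM C (f + g) h = TensM C f h + TensM C g h"
    and TensM_add_right: "TensM C h (f + g) = TensM C h f + TensM C h g"
begin

lemma Comp_sum_left: "Comp C (sum f I) h = (\<Sum>i\<in>I. Comp C (f i) h)"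
  by (induction I rule: infinite_finite_induct) (simp_all add: Comp_0_left Comp_add_left)

lemma Comp_sum_right: "Comp C h (sum f I) = (\<Sum>i\<in>I. Comp C h (f i))"
  by (induction I rule: infinite_finite_induct) (simp_all add: Comp_0_right Comp_add_right)

lemma TensM_sum_left: "TensM C (sum f I) h = (\<Sum>i\<in>I. TensM C (f i) h)"
  by (induction I rule: infinite_finite_induct) (simp_all add: TensM_0_left TensM_add_left)

lemma TensM_sum_right: "TensM C h (sum f I) = (\<Sum>i\<in>I. TensM C h (f i))"
  by (induction I rule: infinite_finite_induct) (simp_all add: TensM_0_right TensM_add_right)

lemma sum_Hom: "(\<And>i. i \<in> I \<Longrightarrow> f i \<in> Hom C X Y) \<Longrightarrow> sum f I \<in> Hom C X Y"
  by (induction I rule: infinite_finite_induct) (simp_all add: zero_Hom add_Hom)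

end

section \<open>Lexicographic indices of Kronecker products\<close>

lemma length_tensor_list: "length [f x y. x \<leftarrow> xs, y \<leftarrow> ys] = length xs * length ys"
  by (induction xs) auto

lemma nth_tensor_list:
  "i < length xs * length ys \<Longrightarrow>
    [f x y. x \<leftarrow> xs, y \<leftarrow> ys] ! i = f (xs ! (i div length ys)) (ys ! (i mod length ys))"
proof (induction xs arbitrary: i)
  case (Cons x xs)
  have pos: "length ys > 0" using Cons.prems by (cases ys) auto
  show ?case
  proof (cases "i < length ys")
    case True
    then show ?thesis by (simp add: nth_append)
  next
    case False
    then have le: "length ys \<le> i" by simp
    have "i - length ys < length xs * length ys" using Cons.prems le by simp
    note IH = Cons.IH[OF this]
    have "i div length ys = Suc ((i - length ys) div length ys)" "i mod length ys = (i - length ys) mod length ys"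
      using le pos by (simp_all add: le_div_geq le_mod_geq)
    then show ?thesis using IH False by (simp add: nth_append)
  qed
qed simp

text \<open>The intermediate summands of a composition of Kronecker products are numbered
  lexicographically; the interchange law needs them as pairs.\<close>

lemma sum_div_mod:
  fixes f :: "nat \<Rightarrow> nat \<Rightarrow> 'a::comm_monoid_add"
  shows "(\<Sum>k<m * n. f (k div n) (k mod n)) = (\<Sum>i<m. \<Sum>j<n. f i j)"
proof (induction m)
  case (Suc m)
  have *: "{..<Suc m * n} = {..<m * n} \<union> (\<lambda>j. m * n + j) ` {..<n}"
  proof (intro equalityI subsetI)
    fix k assume "k \<in> {..<Suc m * n}"
    then show "k \<in> {..<m * n} \<union> (\<lambda>j. m * n + j) ` {..<n}"
      by (cases "k < m * n") (auto intro!: image_eqI[of _ _ "k - m * n"])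
  qed auto
  have "(\<Sum>k<Suc m * n. f (k div n) (k mod n)) = (\<Sum>k<m * n. f (k div n) (k mod n)) +
      (\<Sum>k\<in>(\<lambda>j. m * n + j) ` {..<n}. f (k div n) (k mod n))"
    unfolding * by (rule sum.union_disjoint) auto
  also have "(\<Sum>k\<in>(\<lambda>j. m * n + j) ` {..<n}. f (k div n) (k mod n)) = (\<Sum>j<n. f m j)"
    by (subst sum.reindex) (auto simp: inj_on_def intro!: sum.cong)
  finally show ?case using Suc.IH by simp
qed simp

lemma div_less_times: "(i::nat) < m * n \<Longrightarrow> i div n < m"
  by (simp add: less_mult_imp_div_less)

lemma mod_less_times: "(i::nat) < m * n \<Longrightarrow> i mod n < n"
  by (cases "n = 0") auto

text \<open>A triple index decodes to the same three components under both bracketings. This is why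
  the Kronecker product is strictly associative.\<close>

lemma div_mod_assoc:
  fixes i n p :: nat
  shows "i div p div n = i div (n * p)" "i div p mod n = i mod (n * p) div p" "i mod (n * p) mod p = i mod p"
proof -
  show "i div p div n = i div (n * p)" by (simp add: div_mult2_eq mult.commute[of n p])
  show "i div p mod n = i mod (n * p) div p"
    by (cases "p = 0") (simp_all add: mult.commute[of n] mod_mult2_eq)
  show "i mod (n * p) mod p = i mod p" by (simp add: mod_mod_cancel)
qed

section \<open>The additive completion as a strict monoidal category\<close>

context linear_monoidal_category
begin

abbreviation "A \<equiv> additive_completion C"

lemma A_Obj: "X \<in> Obj A \<longleftrightarrow> set X \<subseteq> Obj C"
  by (simp add: additive_completion_def)

lemma A_Hom: "M \<in> Hom A X Y \<longleftrightarrow> M \<in> carrier_mat (length Y) (length X) \<and>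
    (\<forall>i<length Y. \<forall>j<length X. M $$ (i, j) \<in> Hom C (X ! j) (Y ! i))"
  by (simp add: additive_completion_def)

lemma A_HomD:
  assumes "M \<in> Hom A X Y"
  shows "dim_row M = length Y" "dim_col M = length X"
    "i < length Y \<Longrightarrow> j < length X \<Longrightarrow> M $$ (i, j) \<in> Hom C (X ! j) (Y ! i)"
  using assms by (auto simp: A_Hom)

lemma A_HomI:
  assumes "dim_row M = length Y" "dim_col M = length X"
    "\<And>i j. i < length Y \<Longrightarrow> j < length X \<Longrightarrow> M $$ (i, j) \<in> Hom C (X ! j) (Y ! i)"
  shows "M \<in> Hom A X Y"
  using assms by (auto simp: A_Hom)

lemma A_Ident: "Ident A X = mat (length X) (length X) (\<lambda>(i, j). if i = j then Ident C (X ! i) else 0)"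
  by (simp add: additive_completion_def)

lemma A_Comp: "Comp A N M = mat (dim_row N) (dim_col M)
    (\<lambda>(i, j). \<Sum>k<dim_row M. Comp C (N $$ (i, k)) (M $$ (k, j)))"
  by (simp add: additive_completion_def)

lemma A_TensO: "TensO A X Y = [TensO C x y. x \<leftarrow> X, y \<leftarrow> Y]"
  by (simp add: additive_completion_def)

lemma A_TensM: "TensM A M N = mat (dim_row M * dim_row N) (dim_col M * dim_col N)
    (\<lambda>(i, j). TensM C (M $$ (i div dim_row N, j div dim_col N)) (N $$ (i mod dim_row N, j mod dim_col N)))"
  by (simp add: additive_completion_def)

lemma A_UnitO: "UnitO A = [UnitO C]"
  by (simp add: additive_completion_def)

lemma A_nth_Obj: "X \<in> Obj A \<Longrightarrow> i < length X \<Longrightarrow> X ! i \<in> Obj C"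
  using nth_mem by (force simp: A_Obj)

lemma category_A: "category A"
proof
  fix X assume X: "X \<in> Obj A"
  show "Ident A X \<in> Hom A X X"
    by (rule A_HomI) (auto simp: A_Ident zero_Hom Ident_in_Hom A_nth_Obj[OF X])
next
  fix X Y Z M N assume o: "X \<in> Obj A" "Y \<in> Obj A" "Z \<in> Obj A" and M: "M \<in> Hom A X Y" and N: "N \<in> Hom A Y Z"
  note M' = A_HomD[OF M] and N' = A_HomD[OF N]
  show "Comp A N M \<in> Hom A X Z"
  proof (rule A_HomI)
    fix i j assume ij: "i < length Z" "j < length X"
    then show "Comp A N M $$ (i, j) \<in> Hom C (X ! j) (Z ! i)"
      unfolding A_Comp using M' N'
      by (auto intro!: sum_Hom Comp_in_Hom[where Y = "Y ! k" for k] A_nth_Obj o)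
  qed (auto simp: A_Comp M' N')
next
  fix W X Y Z M N P assume o: "W \<in> Obj A" "X \<in> Obj A" "Y \<in> Obj A" "Z \<in> Obj A"
    and M: "M \<in> Hom A W X" and N: "N \<in> Hom A X Y" and P: "P \<in> Hom A Y Z"
  note M' = A_HomD[OF M] and N' = A_HomD[OF N] and P' = A_HomD[OF P]
  show "Comp A P (Comp A N M) = Comp A (Comp A P N) M"
  proof (rule eq_matI)
    fix i j assume "i < dim_row (Comp A (Comp A P N) M)" "j < dim_col (Comp A (Comp A P N) M)"
    then have ij: "i < length Z" "j < length W" by (simp_all add: A_Comp P' M')
    have "Comp A P (Comp A N M) $$ (i, j) =
        (\<Sum>k<length Y. \<Sum>l<length X. Comp C (P $$ (i, k)) (Comp C (N $$ (k, l)) (M $$ (l, j))))"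
      using ij by (simp add: A_Comp P' N' M' Comp_sum_right)
    also have "\<dots> = (\<Sum>k<length Y. \<Sum>l<length X. Comp C (Comp C (P $$ (i, k)) (N $$ (k, l))) (M $$ (l, j)))"
    proof (intro sum.cong refl)
      fix k l assume kl: "k \<in> {..<length Y}" "l \<in> {..<length X}"
      then show "Comp C (P $$ (i, k)) (Comp C (N $$ (k, l)) (M $$ (l, j))) =
          Comp C (Comp C (P $$ (i, k)) (N $$ (k, l))) (M $$ (l, j))"
        using ij by (intro Comp_assoc[of "W ! j" "X ! l" "Y ! k" "Z ! i"] M' N' P' A_nth_Obj o) auto
    qed
    also have "\<dots> = Comp A (Comp A P N) M $$ (i, j)"
      using ij by (subst sum.swap) (simp add: A_Comp P' N' M' Comp_sum_left)
    finally show "Comp A P (Comp A N M) $$ (i, j) = Comp A (Comp A P N) M $$ (i, j)" .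
  qed (simp_all add: A_Comp)
next
  fix X Y M assume o: "X \<in> Obj A" "Y \<in> Obj A" and M: "M \<in> Hom A X Y"
  note M' = A_HomD[OF M]
  show "Comp A (Ident A Y) M = M"
  proof (rule eq_matI)
    fix i j assume "i < dim_row M" "j < dim_col M"
    then have ij: "i < length Y" "j < length X" by (simp_all add: M')
    have "Comp A (Ident A Y) M $$ (i, j) = (\<Sum>k<length Y. Comp C (if i = k then Ident C (Y ! i) else 0) (M $$ (k, j)))"
      using ij by (simp add: A_Comp A_Ident M')
    also have "\<dots> = (\<Sum>k<length Y. if i = k then Comp C (Ident C (Y ! i)) (M $$ (k, j)) else 0)"
      by (rule sum.cong) (auto simp: Comp_0_left)
    also have "\<dots> = M $$ (i, j)"
      using ij Ident_left[OF A_nth_Obj[OF o(1) ij(2)] A_nth_Obj[OF o(2) ij(1)] M'(3)[OF ij]] by (simp add: sum.delta)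
    finally show "Comp A (Ident A Y) M $$ (i, j) = M $$ (i, j)" .
  qed (simp_all add: A_Comp A_Ident M')
  show "Comp A M (Ident A X) = M"
  proof (rule eq_matI)
    fix i j assume "i < dim_row M" "j < dim_col M"
    then have ij: "i < length Y" "j < length X" by (simp_all add: M')
    have "Comp A M (Ident A X) $$ (i, j) = (\<Sum>k<length X. Comp C (M $$ (i, k)) (if k = j then Ident C (X ! k) else 0))"
      using ij by (simp add: A_Comp A_Ident M')
    also have "\<dots> = (\<Sum>k<length X. if k = j then Comp C (M $$ (i, k)) (Ident C (X ! k)) else 0)"
      by (rule sum.cong) (auto simp: Comp_0_right)
    also have "\<dots> = M $$ (i, j)"
      using ij Ident_right[OF A_nth_Obj[OF o(1) ij(2)] A_nth_Obj[OF o(2) ij(1)] M'(3)[OF ij]] by (simp add: sum.delta')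
    finally show "Comp A M (Ident A X) $$ (i, j) = M $$ (i, j)" .
  qed (simp_all add: A_Comp A_Ident M')
qed

lemma A_length_TensO: "length (TensO A X Y) = length X * length Y"
  unfolding A_TensO by (rule length_tensor_list)

lemma A_nth_TensO: "i < length X * length Y \<Longrightarrow>
    TensO A X Y ! i = TensO C (X ! (i div length Y)) (Y ! (i mod length Y))"
  unfolding A_TensO by (rule nth_tensor_list)

lemma strict_monoidal_A: "strict_monoidal_category A"
proof -
  interpret A: category A by (rule category_A)
  show ?thesis
  proof
    show "UnitO A \<in> Obj A" by (simp add: A_UnitO A_Obj UnitO_in_Obj)
    show "TensO A X Y \<in> Obj A" if "X \<in> Obj A" "Y \<in> Obj A" for X Y
      using that TensO_in_Obj by (auto simp: A_Obj A_TensO)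
    show "TensM A M M' \<in> Hom A (TensO A X X') (TensO A Y Y')"
      if o: "X \<in> Obj A" "Y \<in> Obj A" "X' \<in> Obj A" "Y' \<in> Obj A" and M: "M \<in> Hom A X Y" and N: "M' \<in> Hom A X' Y'"
      for X Y X' Y' M M'
    proof (rule A_HomI)
      note M' = A_HomD[OF M] and N' = A_HomD[OF N]
      fix i j assume "i < length (TensO A Y Y')" "j < length (TensO A X X')"
      then have ij: "i < length Y * length Y'" "j < length X * length X'" by (simp_all add: A_length_TensO)
      note b = div_less_times[OF ij(1)] mod_less_times[OF ij(1)] div_less_times[OF ij(2)] mod_less_times[OF ij(2)]
      show "TensM A M M' $$ (i, j) \<in> Hom C (TensO A X X' ! j) (TensO A Y Y' ! i)"
        using ij TensM_in_Hom[OF A_nth_Obj[OF o(1) b(3)] A_nth_Obj[OF o(2) b(1)] A_nth_Obj[OF o(3) b(4)]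
            A_nth_Obj[OF o(4) b(2)] M'(3)[OF b(1,3)] N'(3)[OF b(2,4)]]
        by (simp add: A_TensM A_nth_TensO M' N')
    qed (simp_all add: A_TensM A_length_TensO A_HomD[OF M] A_HomD[OF N])
    show "TensM A (Ident A X) (Ident A Y) = Ident A (TensO A X Y)" if o: "X \<in> Obj A" "Y \<in> Obj A" for X Y
    proof (rule eq_matI)
      fix i j assume "i < dim_row (Ident A (TensO A X Y))" "j < dim_col (Ident A (TensO A X Y))"
      then have ij: "i < length X * length Y" "j < length X * length Y" by (simp_all add: A_Ident A_length_TensO)
      note b = div_less_times[OF ij(1)] mod_less_times[OF ij(1)] div_less_times[OF ij(2)] mod_less_times[OF ij(2)]
      have eq: "i = j \<longleftrightarrow> i div length Y = j div length Y \<and> i mod length Y = j mod length Y"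
        by (metis div_mult_mod_eq)
      show "TensM A (Ident A X) (Ident A Y) $$ (i, j) = Ident A (TensO A X Y) $$ (i, j)"
        using ij b TensM_Ident[OF A_nth_Obj[OF o(1) b(1)] A_nth_Obj[OF o(2) b(2)]]
        by (auto simp: A_TensM A_Ident A_length_TensO A_nth_TensO eq TensM_0_left TensM_0_right)
    qed (simp_all add: A_TensM A_Ident A_length_TensO)
    show "TensM A (Comp A N M) (Comp A N' M') = Comp A (TensM A N N') (TensM A M M')"
      if o: "X \<in> Obj A" "Y \<in> Obj A" "Z \<in> Obj A" "X' \<in> Obj A" "Y' \<in> Obj A" "Z' \<in> Obj A"
        and M: "M \<in> Hom A X Y" and N: "N \<in> Hom A Y Z" and M': "M' \<in> Hom A X' Y'" and N': "N' \<in> Hom A Y' Z'"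
      for X Y Z X' Y' Z' M N M' N'
    proof (rule eq_matI)
      note m = A_HomD[OF M] and n = A_HomD[OF N] and m' = A_HomD[OF M'] and n' = A_HomD[OF N']
      fix i j assume "i < dim_row (Comp A (TensM A N N') (TensM A M M'))"
        "j < dim_col (Comp A (TensM A N N') (TensM A M M'))"
      then have ij: "i < length Z * length Z'" "j < length X * length X'"
        by (simp_all add: A_Comp A_TensM m n m' n')
      note b = div_less_times[OF ij(1)] mod_less_times[OF ij(1)] div_less_times[OF ij(2)] mod_less_times[OF ij(2)]
      let ?i = "i div length Z'" and ?i' = "i mod length Z'" and ?j = "j div length X'" and ?j' = "j mod length X'"
      have "TensM A (Comp A N M) (Comp A N' M') $$ (i, j) =
          TensM C (\<Sum>k<length Y. Comp C (N $$ (?i, k)) (M $$ (k, ?j)))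
            (\<Sum>l<length Y'. Comp C (N' $$ (?i', l)) (M' $$ (l, ?j')))"
        using ij b by (simp add: A_Comp A_TensM m n m' n')
      also have "\<dots> = (\<Sum>k<length Y. \<Sum>l<length Y'.
          TensM C (Comp C (N $$ (?i, k)) (M $$ (k, ?j))) (Comp C (N' $$ (?i', l)) (M' $$ (l, ?j'))))"
        by (simp only: TensM_sum_left) (simp only: TensM_sum_right)
      also have "\<dots> = (\<Sum>k<length Y. \<Sum>l<length Y'.
          Comp C (TensM C (N $$ (?i, k)) (N' $$ (?i', l))) (TensM C (M $$ (k, ?j)) (M' $$ (l, ?j'))))"
      proof (intro sum.cong refl)
        fix k l assume kl: "k \<in> {..<length Y}" "l \<in> {..<length Y'}"
        then show "TensM C (Comp C (N $$ (?i, k)) (M $$ (k, ?j))) (Comp C (N' $$ (?i', l)) (M' $$ (l, ?j'))) =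
          Comp C (TensM C (N $$ (?i, k)) (N' $$ (?i', l))) (TensM C (M $$ (k, ?j)) (M' $$ (l, ?j')))"
          using b by (intro interchange[of "X ! ?j" "Y ! k" "Z ! ?i" "X' ! ?j'" "Y' ! l" "Z' ! ?i'"] m n m' n' A_nth_Obj o) auto
      qed
      also have "\<dots> = (\<Sum>k<length Y * length Y'. Comp C (TensM C (N $$ (?i, k div length Y')) (N' $$ (?i', k mod length Y')))
          (TensM C (M $$ (k div length Y', ?j)) (M' $$ (k mod length Y', ?j'))))"
        by (rule sum_div_mod[symmetric])
      also have "\<dots> = Comp A (TensM A N N') (TensM A M M') $$ (i, j)"
        using ij by (simp add: A_Comp A_TensM m n m' n')
      finally show "TensM A (Comp A N M) (Comp A N' M') $$ (i, j) = Comp A (TensM A N N') (TensM A M M') $$ (i, j)" .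
    qed (simp_all add: A_TensM A_Comp)
    show "TensO A (TensO A X Y) Z = TensO A X (TensO A Y Z)" if o: "X \<in> Obj A" "Y \<in> Obj A" "Z \<in> Obj A" for X Y Z
    proof (rule nth_equalityI)
      fix i assume "i < length (TensO A (TensO A X Y) Z)"
      then have i: "i < length X * length Y * length Z" by (simp add: A_length_TensO)
      then have i': "i < length X * (length Y * length Z)" by (simp add: mult.assoc)
      have a: "i div length Z < length X * length Y" using div_less_times[OF i] .
      have c: "i mod (length Y * length Z) < length Y * length Z" using mod_less_times[OF i'] .
      have "TensO A (TensO A X Y) Z ! i = TensO C (TensO C (X ! (i div length Z div length Y)) (Y ! (i div length Z mod length Y)))
          (Z ! (i mod length Z))"
        using i a by (simp add: A_nth_TensO A_length_TensO)
      also have "\<dots> = TensO C (X ! (i div length Z div length Y)) (TensO C (Y ! (i div length Z mod length Y)) (Z ! (i mod length Z)))"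
        by (intro TensO_assoc A_nth_Obj o div_less_times[OF a] mod_less_times[OF a] mod_less_times[OF i])
      also have "\<dots> = TensO A X (TensO A Y Z) ! i"
        using i' c by (simp add: A_nth_TensO A_length_TensO div_mod_assoc)
      finally show "TensO A (TensO A X Y) Z ! i = TensO A X (TensO A Y Z) ! i" .
    qed (simp add: A_length_TensO mult.assoc)
    show "TensO A (UnitO A) X = X" "TensO A X (UnitO A) = X" if o: "X \<in> Obj A" for X
    proof -
      show "TensO A (UnitO A) X = X"
      proof (rule nth_equalityI)
        fix i assume "i < length (TensO A (UnitO A) X)"
        then have i: "i < length X" by (simp add: A_length_TensO A_UnitO)
        then show "TensO A (UnitO A) X ! i = X ! i"
          using TensO_unit(1)[OF A_nth_Obj[OF o i]] by (simp add: A_nth_TensO A_UnitO)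
      qed (simp add: A_length_TensO A_UnitO)
      show "TensO A X (UnitO A) = X"
      proof (rule nth_equalityI)
        fix i assume "i < length (TensO A X (UnitO A))"
        then have i: "i < length X" by (simp add: A_length_TensO A_UnitO)
        then show "TensO A X (UnitO A) ! i = X ! i"
          using TensO_unit(2)[OF A_nth_Obj[OF o i]] by (simp add: A_nth_TensO A_UnitO)
      qed (simp add: A_length_TensO A_UnitO)
    qed
    show "TensM A (TensM A M M') M'' = TensM A M (TensM A M' M'')"
      if o: "X \<in> Obj A" "Y \<in> Obj A" "X' \<in> Obj A" "Y' \<in> Obj A" "X'' \<in> Obj A" "Y'' \<in> Obj A"
        and M: "M \<in> Hom A X Y" and M': "M' \<in> Hom A X' Y'" and M'': "M'' \<in> Hom A X'' Y''"
      for X Y X' Y' X'' Y'' M M' M''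
    proof (rule eq_matI)
      note m = A_HomD[OF M] and m' = A_HomD[OF M'] and m'' = A_HomD[OF M'']
      fix i j assume "i < dim_row (TensM A M (TensM A M' M''))" "j < dim_col (TensM A M (TensM A M' M''))"
      then have i: "i < length Y * length Y' * length Y''" and j: "j < length X * length X' * length X''"
        by (simp_all add: A_TensM m m' m'' mult.assoc)
      then have i': "i < length Y * (length Y' * length Y'')" and j': "j < length X * (length X' * length X'')"
        by (simp_all add: mult.assoc)
      note a = div_less_times[OF i] div_less_times[OF j] and c = mod_less_times[OF i'] mod_less_times[OF j']
      note b = div_less_times[OF a(1)] mod_less_times[OF a(1)] mod_less_times[OF i]
        div_less_times[OF a(2)] mod_less_times[OF a(2)] mod_less_times[OF j]
      have "TensM A (TensM A M M') M'' $$ (i, j) =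
          TensM C (TensM C (M $$ (i div length Y'' div length Y', j div length X'' div length X'))
            (M' $$ (i div length Y'' mod length Y', j div length X'' mod length X')))
            (M'' $$ (i mod length Y'', j mod length X''))"
        using i j a by (simp add: A_TensM m m' m'')
      also have "\<dots> = TensM C (M $$ (i div length Y'' div length Y', j div length X'' div length X'))
            (TensM C (M' $$ (i div length Y'' mod length Y', j div length X'' mod length X'))
            (M'' $$ (i mod length Y'', j mod length X'')))"
        by (rule TensM_assoc[OF A_nth_Obj[OF o(1) b(4)] A_nth_Obj[OF o(2) b(1)] A_nth_Obj[OF o(3) b(5)]
            A_nth_Obj[OF o(4) b(2)] A_nth_Obj[OF o(5) b(6)] A_nth_Obj[OF o(6) b(3)]
            m(3)[OF b(1,4)] m'(3)[OF b(2,5)] m''(3)[OF b(3,6)]])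
      also have "\<dots> = TensM A M (TensM A M' M'') $$ (i, j)"
        using i' j' c by (simp add: A_TensM m m' m'' div_mod_assoc)
      finally show "TensM A (TensM A M M') M'' $$ (i, j) = TensM A M (TensM A M' M'') $$ (i, j)" .
    qed (simp_all add: A_TensM mult.assoc)
    show "TensM A (Ident A (UnitO A)) M = M" "TensM A M (Ident A (UnitO A)) = M"
      if o: "X \<in> Obj A" "Y \<in> Obj A" and M: "M \<in> Hom A X Y" for X Y M
    proof -
      note m = A_HomD[OF M]
      show "TensM A (Ident A (UnitO A)) M = M"
      proof (rule eq_matI)
        fix i j assume "i < dim_row M" "j < dim_col M"
        then have ij: "i < length Y" "j < length X" by (simp_all add: m)
        then show "TensM A (Ident A (UnitO A)) M $$ (i, j) = M $$ (i, j)"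
          using TensM_unit(1)[OF A_nth_Obj[OF o(1) ij(2)] A_nth_Obj[OF o(2) ij(1)] m(3)[OF ij]]
          by (simp add: A_TensM A_Ident A_UnitO m)
      qed (simp_all add: A_TensM A_Ident A_UnitO)
      show "TensM A M (Ident A (UnitO A)) = M"
      proof (rule eq_matI)
        fix i j assume "i < dim_row M" "j < dim_col M"
        then have ij: "i < length Y" "j < length X" by (simp_all add: m)
        then show "TensM A M (Ident A (UnitO A)) $$ (i, j) = M $$ (i, j)"
          using TensM_unit(2)[OF A_nth_Obj[OF o(1) ij(2)] A_nth_Obj[OF o(2) ij(1)] m(3)[OF ij]]
          by (simp add: A_TensM A_Ident A_UnitO m)
      qed (simp_all add: A_TensM A_Ident A_UnitO)
    qed
  qed
qed

end

lemma strict_monoidal_idempotent_completion: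
  assumes "strict_monoidal_category C"
  shows "strict_monoidal_category (idempotent_completion C)"
proof -
  interpret strict_monoidal_category C by fact
  let ?K = "idempotent_completion C"
  have K: "X \<in> Obj ?K \<longleftrightarrow> fst X \<in> Obj C \<and> snd X \<in> Hom C (fst X) (fst X) \<and> Comp C (snd X) (snd X) = snd X"
    "m \<in> Hom ?K X Y \<longleftrightarrow> m \<in> Hom C (fst X) (fst Y) \<and> Comp C (snd Y) m = m \<and> Comp C m (snd X) = m"
    "Ident ?K X = snd X" "Comp ?K = Comp C" "TensM ?K = TensM C"
    "TensO ?K X Y = (TensO C (fst X) (fst Y), TensM C (snd X) (snd Y))"
    "UnitO ?K = (UnitO C, Ident C (UnitO C))" for X Y m
    by (simp_all add: idempotent_completion_def split: prod.splits)
  show ?thesis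
  proof
    fix X Y Z f g assume "X \<in> Obj ?K" "Y \<in> Obj ?K" "Z \<in> Obj ?K" "f \<in> Hom ?K X Y" "g \<in> Hom ?K Y Z"
    then show "Comp ?K g f \<in> Hom ?K X Z"
      unfolding K using Comp_in_Hom[of "fst X" "fst Y" "fst Z" f g]
        Comp_assoc[of "fst X" "fst Y" "fst Z" "fst Z" f g "snd Z"]
        Comp_assoc[of "fst X" "fst X" "fst Y" "fst Z" "snd X" f g] by simp
  next
    fix W X Y Z f g h assume "W \<in> Obj ?K" "X \<in> Obj ?K" "Y \<in> Obj ?K" "Z \<in> Obj ?K"
      "f \<in> Hom ?K W X" "g \<in> Hom ?K X Y" "h \<in> Hom ?K Y Z"
    then show "Comp ?K h (Comp ?K g f) = Comp ?K (Comp ?K h g) f"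
      unfolding K using Comp_assoc[of "fst W" "fst X" "fst Y" "fst Z" f g h] by simp
  next
    show "UnitO ?K \<in> Obj ?K"
      unfolding K using UnitO_in_Obj Ident_in_Hom[of "UnitO C"] Ident_left[of "UnitO C" "UnitO C"] by simp
  next
    fix X Y assume "X \<in> Obj ?K" "Y \<in> Obj ?K"
    then show "TensO ?K X Y \<in> Obj ?K"
      unfolding K using TensO_in_Obj TensM_in_Hom
        interchange[of "fst X" "fst X" "fst X" "fst Y" "fst Y" "fst Y" "snd X" "snd X" "snd Y" "snd Y"] by simp
  next
    fix X Y X' Y' f f' assume a: "X \<in> Obj ?K" "Y \<in> Obj ?K" "X' \<in> Obj ?K" "Y' \<in> Obj ?K" "f \<in> Hom ?K X Y" "f' \<in> Hom ?K X' Y'"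
    then show "TensM ?K f f' \<in> Hom ?K (TensO ?K X X') (TensO ?K Y Y')"
      unfolding K using TensM_in_Hom
        interchange[of "fst X" "fst Y" "fst Y" "fst X'" "fst Y'" "fst Y'" f "snd Y" f' "snd Y'"]
        interchange[of "fst X" "fst X" "fst Y" "fst X'" "fst X'" "fst Y'" "snd X" f "snd X'" f'] by simp
  next
    fix X Y Z X' Y' Z' f g f' g'
    assume "X \<in> Obj ?K" "Y \<in> Obj ?K" "Z \<in> Obj ?K" "X' \<in> Obj ?K" "Y' \<in> Obj ?K" "Z' \<in> Obj ?K"
      "f \<in> Hom ?K X Y" "g \<in> Hom ?K Y Z" "f' \<in> Hom ?K X' Y'" "g' \<in> Hom ?K Y' Z'"
    then show "TensM ?K (Comp ?K g f) (Comp ?K g' f') = Comp ?K (TensM ?K g g') (TensM ?K f f')"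
      unfolding K using interchange by blast
  next
    fix X Y Z assume "X \<in> Obj ?K" "Y \<in> Obj ?K" "Z \<in> Obj ?K"
    then show "TensO ?K (TensO ?K X Y) Z = TensO ?K X (TensO ?K Y Z)"
      unfolding K using TensO_assoc[of "fst X" "fst Y" "fst Z"]
        TensM_assoc[of "fst X" "fst X" "fst Y" "fst Y" "fst Z" "fst Z" "snd X" "snd Y" "snd Z"] by simp
  next
    fix X assume "X \<in> Obj ?K"
    then show "TensO ?K (UnitO ?K) X = X" "TensO ?K X (UnitO ?K) = X"
      unfolding K using TensO_unit[of "fst X"] TensM_unit[of "fst X" "fst X" "snd X"] by simp_all
  next
    fix X Y X' Y' X'' Y'' f f' f''
    assume "X \<in> Obj ?K" "Y \<in> Obj ?K" "X' \<in> Obj ?K" "Y' \<in> Obj ?K" "X'' \<in> Obj ?K" "Y'' \<in> Obj ?K"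
      "f \<in> Hom ?K X Y" "f' \<in> Hom ?K X' Y'" "f'' \<in> Hom ?K X'' Y''"
    then show "TensM ?K (TensM ?K f f') f'' = TensM ?K f (TensM ?K f' f'')"
      unfolding K using TensM_assoc by blast
  next
    fix X Y f assume "X \<in> Obj ?K" "Y \<in> Obj ?K" "f \<in> Hom ?K X Y"
    then show "TensM ?K (Ident ?K (UnitO ?K)) f = f" "TensM ?K f (Ident ?K (UnitO ?K)) = f"
      unfolding K using TensM_unit[of "fst X" "fst Y" f] by simp_all
  \<comment> \<open>What remains concerns identities. The identity of an object is its idempotent,
    so the unit laws are part of the definition of the hom-sets.\<close>
  qed (simp_all add: K)
qed

section \<open>Isomorphisms of categories\<close>

text \<open>The inverse bijections form a functor that is inverse to \<open>F\<close> on objects and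
  arrows, so identities serve as both natural isomorphisms.\<close>

lemma cat_equivalence_if_bijective:
  assumes C: "category C" and F: "cat_functor C D F"
    and obj: "bij_betw (FO F) (Obj C) (Obj D)"
    and hom: "\<And>X Y. X \<in> Obj C \<Longrightarrow> Y \<in> Obj C \<Longrightarrow> bij_betw (FM F X Y) (Hom C X Y) (Hom D (FO F X) (FO F Y))"
    and D: "category D"
  shows "cat_equivalence C D F"
proof -
  interpret C: category C by fact
  interpret D: category D by fact
  interpret F: cat_functor C D F by fact
  define HO where "HO = inv_into (Obj C) (FO F)"
  \<comment> \<open>Hom-sets may overlap, so arrows are inverted separately for each pair of
    objects.\<close>
  define HM where "HM = (\<lambda>U V. inv_into (Hom C (HO U) (HO V)) (FM F (HO U) (HO V)))"
  define H where "H = \<lparr>FO = HO, FM = HM\<rparr>"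
  have HO: "HO U \<in> Obj C" "FO F (HO U) = U" if "U \<in> Obj D" for U
    using that obj unfolding HO_def bij_betw_def by (auto intro: inv_into_into f_inv_into_f)
  have HOF: "HO (FO F X) = X" if "X \<in> Obj C" for X
    using that obj unfolding HO_def bij_betw_def by simp
  have HM: "HM U V f \<in> Hom C (HO U) (HO V)" "FM F (HO U) (HO V) (HM U V f) = f"
    if "U \<in> Obj D" "V \<in> Obj D" "f \<in> Hom D U V" for U V f
  proof -
    have "FM F (HO U) (HO V) ` Hom C (HO U) (HO V) = Hom D U V"
      using hom[OF HO(1)[OF that(1)] HO(1)[OF that(2)]] HO(2) that(1,2) by (simp add: bij_betw_def)
    then show "HM U V f \<in> Hom C (HO U) (HO V)" "FM F (HO U) (HO V) (HM U V f) = f"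
      using that(3) unfolding HM_def by (auto intro: inv_into_into f_inv_into_f)
  qed
  have HMF: "HM U V (FM F (HO U) (HO V) g) = g" if "U \<in> Obj D" "V \<in> Obj D" "g \<in> Hom C (HO U) (HO V)" for U V g
    using hom[OF HO(1)[OF that(1)] HO(1)[OF that(2)]] that(3) unfolding HM_def bij_betw_def by simp
  have HF: "cat_functor D C H"
  proof
    show "FO H U \<in> Obj C" if "U \<in> Obj D" for U using HO that by (simp add: H_def)
    show "FM H U V f \<in> Hom C (FO H U) (FO H V)" if "U \<in> Obj D" "V \<in> Obj D" "f \<in> Hom D U V" for U V f
      using HM that by (simp add: H_def)
    show "FM H U U (Ident D U) = Ident C (FO H U)" if U: "U \<in> Obj D" for U
    proof -
      have "FM F (HO U) (HO U) (Ident C (HO U)) = Ident D U" using F.FM_Ident HO[OF U] by simp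
      then show ?thesis using HMF[OF U U C.Ident_in_Hom[OF HO(1)[OF U]]] by (simp add: H_def)
    qed
    show "FM H U W (Comp D g f) = Comp C (FM H V W g) (FM H U V f)"
      if o: "U \<in> Obj D" "V \<in> Obj D" "W \<in> Obj D" and f: "f \<in> Hom D U V" and g: "g \<in> Hom D V W" for U V W f g
    proof -
      note h = HM[OF o(1,2) f] HM[OF o(2,3) g] and ho = HO(1)[OF o(1)] HO(1)[OF o(2)] HO(1)[OF o(3)]
      have "FM F (HO U) (HO W) (Comp C (HM V W g) (HM U V f)) = Comp D g f"
        using F.FM_Comp[OF ho h(1,3)] h(2,4) by simp
      then show ?thesis using HMF[OF o(1,3) C.Comp_in_Hom[OF ho h(1,3)]] by (simp add: H_def)
    qed
  qed
  have iso: "is_iso C X X (Ident C X)" if "X \<in> Obj C" for X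
    unfolding is_iso_def using C.Ident_in_Hom[OF that] C.Ident_left[OF that that] by auto
  have isoD: "is_iso D X X (Ident D X)" if "X \<in> Obj D" for X
    unfolding is_iso_def using D.Ident_in_Hom[OF that] D.Ident_left[OF that that] by auto
  have "naturally_isomorphic C C (comp_functor H F) id_functor"
    unfolding naturally_isomorphic_def
  proof (intro exI[of _ "Ident C"] conjI ballI)
    fix X assume X: "X \<in> Obj C"
    then show "is_iso C (FO (comp_functor H F) X) (FO id_functor X) (Ident C X)"
      using iso by (simp add: comp_functor_def id_functor_def H_def HOF)
    fix Y f assume Y: "Y \<in> Obj C" and f: "f \<in> Hom C X Y"
    have "FM (comp_functor H F) X Y f = f"
      using HMF[OF F.FO_in_Obj[OF X] F.FO_in_Obj[OF Y], of f] f X Y by (simp add: comp_functor_def H_def HOF)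
    then show "Comp C (Ident C Y) (FM (comp_functor H F) X Y f) = Comp C (FM id_functor X Y f) (Ident C X)"
      using C.Ident_left[OF X Y f] C.Ident_right[OF X Y f] by (simp add: id_functor_def)
  qed
  moreover have "naturally_isomorphic D D (comp_functor F H) id_functor"
    unfolding naturally_isomorphic_def
  proof (intro exI[of _ "Ident D"] conjI ballI)
    fix X assume X: "X \<in> Obj D"
    then show "is_iso D (FO (comp_functor F H) X) (FO id_functor X) (Ident D X)"
      using isoD by (simp add: comp_functor_def id_functor_def H_def HO)
    fix Y f assume Y: "Y \<in> Obj D" and f: "f \<in> Hom D X Y"
    have "FM (comp_functor F H) X Y f = f"
      using HM(2)[OF X Y f] by (simp add: comp_functor_def H_def)
    then show "Comp D (Ident D Y) (FM (comp_functor F H) X Y f) = Comp D (FM id_functor X Y f) (Ident D X)"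
      using D.Ident_left[OF X Y f] D.Ident_right[OF X Y f] by (simp add: id_functor_def)
  qed
  ultimately show ?thesis unfolding cat_equivalence_def using F HF by blast
qed

section \<open>Extending linear monoidal isomorphisms to Karoubi envelopes\<close>

text \<open>One map \<open>L\<close> serves all hom-sets, so that it can be applied to every entry
  of a matrix by \<open>map_mat\<close>.\<close>

locale linear_isomorphism = C: linear_monoidal_category C + D: linear_monoidal_category D
  for C :: "('o, 'm::comm_monoid_add, 'z) mcat_scheme" and D :: "('p, 'n::comm_monoid_add, 'w) mcat_scheme" +
  fixes ob :: "'o \<Rightarrow> 'p" and L :: "'m \<Rightarrow> 'n"
  assumes ob_bij: "bij_betw ob (Obj C) (Obj D)"
    and ob_TensO: "X \<in> Obj C \<Longrightarrow> Y \<in> Obj C \<Longrightarrow> ob (TensO C X Y) = TensO D (ob X) (ob Y)"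
    and ob_UnitO: "ob (UnitO C) = UnitO D"
    and L_0: "L 0 = 0" and L_add: "L (f + g) = L f + L g"
    and L_bij: "X \<in> Obj C \<Longrightarrow> Y \<in> Obj C \<Longrightarrow> bij_betw L (Hom C X Y) (Hom D (ob X) (ob Y))"
    and L_Ident: "X \<in> Obj C \<Longrightarrow> L (Ident C X) = Ident D (ob X)"
    and L_Comp: "\<lbrakk>X \<in> Obj C; Y \<in> Obj C; Z \<in> Obj C; f \<in> Hom C X Y; g \<in> Hom C Y Z\<rbrakk>
      \<Longrightarrow> L (Comp C g f) = Comp D (L g) (L f)"
    and L_TensM: "\<lbrakk>X \<in> Obj C; Y \<in> Obj C; X' \<in> Obj C; Y' \<in> Obj C; f \<in> Hom C X Y; f' \<in> Hom C X' Y'\<rbrakk>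
      \<Longrightarrow> L (TensM C f f') = TensM D (L f) (L f')"
begin

abbreviation "AC \<equiv> additive_completion C"
abbreviation "AD \<equiv> additive_completion D"
abbreviation "KC \<equiv> karoubi_envelope C"
abbreviation "KD \<equiv> karoubi_envelope D"

lemma L_sum: "L (sum f I) = (\<Sum>i\<in>I. L (f i))"
  by (induction I rule: infinite_finite_induct) (simp_all add: L_0 L_add)

lemma L_Hom: "X \<in> Obj C \<Longrightarrow> Y \<in> Obj C \<Longrightarrow> f \<in> Hom C X Y \<Longrightarrow> L f \<in> Hom D (ob X) (ob Y)"
  using L_bij by (auto simp: bij_betw_def)

lemma ob_list: "X \<in> Obj AC \<Longrightarrow> map ob X \<in> Obj AD"
  using ob_bij by (auto simp: C.A_Obj D.A_Obj bij_betw_def)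

lemma map_L_Hom:
  assumes o: "X \<in> Obj AC" "Y \<in> Obj AC" and M: "M \<in> Hom AC X Y"
  shows "map_mat L M \<in> Hom AD (map ob X) (map ob Y)"
  by (rule D.A_HomI) (auto simp: C.A_HomD[OF M] intro!: L_Hom C.A_nth_Obj o)

lemma map_L_Ident:
  assumes "X \<in> Obj AC"
  shows "map_mat L (Ident AC X) = Ident AD (map ob X)"
  by (rule eq_matI) (auto simp: C.A_Ident D.A_Ident L_0 L_Ident C.A_nth_Obj[OF assms])

lemma map_L_Comp:
  assumes o: "X \<in> Obj AC" "Y \<in> Obj AC" "Z \<in> Obj AC" and M: "M \<in> Hom AC X Y" and N: "N \<in> Hom AC Y Z"
  shows "map_mat L (Comp AC N M) = Comp AD (map_mat L N) (map_mat L M)"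
proof (rule eq_matI)
  note m = C.A_HomD[OF M] and n = C.A_HomD[OF N]
  fix i j assume "i < dim_row (Comp AD (map_mat L N) (map_mat L M))" "j < dim_col (Comp AD (map_mat L N) (map_mat L M))"
  then have ij: "i < length Z" "j < length X" by (simp_all add: D.A_Comp m n)
  have "map_mat L (Comp AC N M) $$ (i, j) = (\<Sum>k<length Y. L (Comp C (N $$ (i, k)) (M $$ (k, j))))"
    using ij by (simp add: C.A_Comp m n L_sum)
  also have "\<dots> = (\<Sum>k<length Y. Comp D (L (N $$ (i, k))) (L (M $$ (k, j))))"
  proof (intro sum.cong refl)
    fix k assume "k \<in> {..<length Y}"
    then show "L (Comp C (N $$ (i, k)) (M $$ (k, j))) = Comp D (L (N $$ (i, k))) (L (M $$ (k, j)))"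
      using ij by (intro L_Comp[of "X ! j" "Y ! k" "Z ! i"] C.A_nth_Obj o m n) auto
  qed
  also have "\<dots> = Comp AD (map_mat L N) (map_mat L M) $$ (i, j)"
    using ij by (simp add: D.A_Comp m n)
  finally show "map_mat L (Comp AC N M) $$ (i, j) = Comp AD (map_mat L N) (map_mat L M) $$ (i, j)" .
qed (simp_all add: C.A_Comp D.A_Comp)

lemma map_L_TensM:
  assumes o: "X \<in> Obj AC" "Y \<in> Obj AC" "X' \<in> Obj AC" "Y' \<in> Obj AC"
    and M: "M \<in> Hom AC X Y" and N: "N \<in> Hom AC X' Y'"
  shows "map_mat L (TensM AC M N) = TensM AD (map_mat L M) (map_mat L N)"
proof (rule eq_matI)
  note m = C.A_HomD[OF M] and n = C.A_HomD[OF N]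
  fix i j assume "i < dim_row (TensM AD (map_mat L M) (map_mat L N))" "j < dim_col (TensM AD (map_mat L M) (map_mat L N))"
  then have ij: "i < length Y * length Y'" "j < length X * length X'" by (simp_all add: D.A_TensM m n)
  note b = div_less_times[OF ij(1)] mod_less_times[OF ij(1)] div_less_times[OF ij(2)] mod_less_times[OF ij(2)]
  have "L (TensM C (M $$ (i div length Y', j div length X')) (N $$ (i mod length Y', j mod length X'))) =
      TensM D (L (M $$ (i div length Y', j div length X'))) (L (N $$ (i mod length Y', j mod length X')))"
    by (rule L_TensM[OF C.A_nth_Obj[OF o(1) b(3)] C.A_nth_Obj[OF o(2) b(1)] C.A_nth_Obj[OF o(3) b(4)]
        C.A_nth_Obj[OF o(4) b(2)] m(3)[OF b(1,3)] n(3)[OF b(2,4)]])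
  then show "map_mat L (TensM AC M N) $$ (i, j) = TensM AD (map_mat L M) (map_mat L N) $$ (i, j)"
    using ij b by (simp add: C.A_TensM D.A_TensM m n)
qed (simp_all add: C.A_TensM D.A_TensM)

lemma map_ob_TensO:
  assumes o: "X \<in> Obj AC" "Y \<in> Obj AC"
  shows "map ob (TensO AC X Y) = TensO AD (map ob X) (map ob Y)"
proof (rule nth_equalityI)
  fix i assume "i < length (map ob (TensO AC X Y))"
  then have i: "i < length X * length Y" by (simp add: C.A_length_TensO)
  then show "map ob (TensO AC X Y) ! i = TensO AD (map ob X) (map ob Y) ! i"
    using div_less_times[OF i] mod_less_times[OF i] o
    by (simp add: C.A_length_TensO C.A_nth_TensO D.A_nth_TensO ob_TensO C.A_nth_Obj)
qed (simp add: C.A_length_TensO D.A_length_TensO)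

lemma map_L_inj:
  assumes o: "X \<in> Obj AC" "Y \<in> Obj AC" and M: "M \<in> Hom AC X Y" and N: "N \<in> Hom AC X Y"
    and eq: "map_mat L M = map_mat L N"
  shows "M = N"
proof (rule eq_matI)
  note m = C.A_HomD[OF M] and n = C.A_HomD[OF N]
  fix i j assume "i < dim_row N" "j < dim_col N"
  then have ij: "i < length Y" "j < length X" by (simp_all add: n)
  have "L (M $$ (i, j)) = L (N $$ (i, j))"
    using arg_cong[OF eq, of "\<lambda>M. M $$ (i, j)"] ij by (simp add: m n)
  then show "M $$ (i, j) = N $$ (i, j)"
    using L_bij[OF C.A_nth_Obj[OF o(1) ij(2)] C.A_nth_Obj[OF o(2) ij(1)]] m(3)[OF ij] n(3)[OF ij]
    by (auto simp: bij_betw_def dest: inj_onD)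
qed (simp_all add: C.A_HomD[OF M] C.A_HomD[OF N])

lemma map_L_surj:
  assumes o: "X \<in> Obj AC" "Y \<in> Obj AC" and N: "N \<in> Hom AD (map ob X) (map ob Y)"
  shows "\<exists>M\<in>Hom AC X Y. map_mat L M = N"
proof -
  note n = D.A_HomD[OF N]
  define g where "g = (\<lambda>i j. inv_into (Hom C (X ! j) (Y ! i)) L (N $$ (i, j)))"
  have g: "g i j \<in> Hom C (X ! j) (Y ! i)" "L (g i j) = N $$ (i, j)" if "i < length Y" "j < length X" for i j
  proof -
    have "N $$ (i, j) \<in> L ` Hom C (X ! j) (Y ! i)"
      using n(3)[of i j] that L_bij[OF C.A_nth_Obj[OF o(1) that(2)] C.A_nth_Obj[OF o(2) that(1)]]
      by (simp add: bij_betw_def)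
    then show "g i j \<in> Hom C (X ! j) (Y ! i)" "L (g i j) = N $$ (i, j)"
      unfolding g_def by (rule inv_into_into, rule f_inv_into_f)
  qed
  show ?thesis
  proof (rule bexI)
    show "map_mat L (mat (length Y) (length X) (\<lambda>(i, j). g i j)) = N"
      by (rule eq_matI) (simp_all add: n g)
    show "mat (length Y) (length X) (\<lambda>(i, j). g i j) \<in> Hom AC X Y"
      by (rule C.A_HomI) (simp_all add: g)
  qed
qed

lemma ob_list_surj:
  assumes "Y \<in> Obj AD"
  shows "\<exists>X\<in>Obj AC. map ob X = Y"
proof -
  have "set Y \<subseteq> ob ` Obj C" using assms ob_bij by (simp add: D.A_Obj bij_betw_def)
  then have "map ob (map (inv_into (Obj C) ob) Y) = Y" "set (map (inv_into (Obj C) ob) Y) \<subseteq> Obj C"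
    by (auto simp: map_idI f_inv_into_f inv_into_into subset_iff)
  then show ?thesis
    by (intro bexI[of _ "map (inv_into (Obj C) ob) Y"]) (simp_all only: C.A_Obj)
qed

lemma ob_list_inj: "X \<in> Obj AC \<Longrightarrow> Y \<in> Obj AC \<Longrightarrow> map ob X = map ob Y \<Longrightarrow> X = Y"
  using ob_bij by (auto simp: C.A_Obj bij_betw_def intro!: map_inj_on[of ob X Y] elim!: inj_on_subset)

lemma K_simps:
  "X \<in> Obj (karoubi_envelope B) \<longleftrightarrow> fst X \<in> Obj (additive_completion B) \<and>
    snd X \<in> Hom (additive_completion B) (fst X) (fst X) \<and> Comp (additive_completion B) (snd X) (snd X) = snd X"
  "m \<in> Hom (karoubi_envelope B) X Y \<longleftrightarrow> m \<in> Hom (additive_completion B) (fst X) (fst Y) \<and>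
    Comp (additive_completion B) (snd Y) m = m \<and> Comp (additive_completion B) m (snd X) = m"
  "Ident (karoubi_envelope B) X = snd X" "Comp (karoubi_envelope B) = Comp (additive_completion B)"
  "TensM (karoubi_envelope B) = TensM (additive_completion B)"
  "TensO (karoubi_envelope B) X Y = (TensO (additive_completion B) (fst X) (fst Y), TensM (additive_completion B) (snd X) (snd Y))"
  "UnitO (karoubi_envelope B) = (UnitO (additive_completion B), Ident (additive_completion B) (UnitO (additive_completion B)))"
  by (simp_all add: karoubi_envelope_def idempotent_completion_def split: prod.splits)

text \<open>The fields have the shape of \<open>G_functor\<close>, so that for
  \<open>ob = (\<lambda>k. k div 2)\<close> and \<open>L = G_lin t s\<close> the two agree by
  unfolding.\<close>

definition KF :: "('o list \<times> 'm mat, 'm mat, 'p list \<times> 'n mat, 'n mat) mfunc" where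
  "KF = \<lparr>FO = (\<lambda>(X, e). (map ob X, map_mat L e)), FM = (\<lambda>X Y. map_mat L),
     coh_mult = (\<lambda>X Y. Ident KD (case TensO KC X Y of (X, e) \<Rightarrow> (map ob X, map_mat L e))),
     coh_unit = Ident KD (UnitO KD)\<rparr>"

lemma KF_simps:
  "FO KF X = (map ob (fst X), map_mat L (snd X))" "FM KF X Y = map_mat L"
  "coh_mult KF X Y = Ident KD (FO KF (TensO KC X Y))" "coh_unit KF = Ident KD (UnitO KD)"
  by (simp_all add: KF_def split: prod.splits)

text \<open>Entrywise, \<open>L\<close> is bijective and compatible with all operations, so
  idempotents and the conditions cutting out hom-sets are both preserved and reflected. Tensor
  products of objects are preserved on the nose, which reduces the coherence laws to
  identities.\<close>

lemma monoidal_equivalence_KF: "monoidal_equivalence KC KD KF"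
proof -
  interpret KC: strict_monoidal_category KC
    unfolding karoubi_envelope_def
    by (intro strict_monoidal_idempotent_completion C.strict_monoidal_A)
  interpret KD: strict_monoidal_category KD
    unfolding karoubi_envelope_def
    by (intro strict_monoidal_idempotent_completion D.strict_monoidal_A)
  have FO: "FO KF X \<in> Obj KD" if "X \<in> Obj KC" for X
    using that map_L_Comp[of "fst X" "fst X" "fst X" "snd X" "snd X"]
    unfolding K_simps KF_simps by (simp add: ob_list map_L_Hom)
  have F: "cat_functor KC KD KF"
  proof
    show "FM KF X Y f \<in> Hom KD (FO KF X) (FO KF Y)" if "X \<in> Obj KC" "Y \<in> Obj KC" "f \<in> Hom KC X Y" for X Y f
      using that map_L_Comp[of "fst X" "fst Y" "fst Y" f "snd Y"] map_L_Comp[of "fst X" "fst X" "fst Y" "snd X" f]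
      unfolding K_simps KF_simps by (simp add: map_L_Hom)
    show "FM KF X X (Ident KC X) = Ident KD (FO KF X)" for X
      by (simp add: K_simps KF_simps)
    show "FM KF X Z (Comp KC g f) = Comp KD (FM KF Y Z g) (FM KF X Y f)"
      if "X \<in> Obj KC" "Y \<in> Obj KC" "Z \<in> Obj KC" "f \<in> Hom KC X Y" "g \<in> Hom KC Y Z" for X Y Z f g
      using that map_L_Comp[of "fst X" "fst Y" "fst Z" f g] unfolding K_simps KF_simps by simp
  qed (rule FO)
  interpret F: cat_functor KC KD KF by (rule F)
  have obj: "bij_betw (FO KF) (Obj KC) (Obj KD)"
    unfolding bij_betw_def
  proof (intro conjI equalityI subsetI inj_onI)
    fix X Y assume XY: "X \<in> Obj KC" "Y \<in> Obj KC" "FO KF X = FO KF Y"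
    then have f: "fst X = fst Y" unfolding K_simps KF_simps using ob_list_inj by auto
    then have "snd X = snd Y"
      using XY map_L_inj[of "fst X" "fst X" "snd X" "snd Y"] unfolding K_simps KF_simps by simp
    then show "X = Y" using f by (simp add: prod_eq_iff)
  next
    fix Y assume "Y \<in> FO KF ` Obj KC"
    then show "Y \<in> Obj KD" using FO by auto
  next
    fix Y assume Y: "Y \<in> Obj KD"
    then obtain A where A: "A \<in> Obj AC" "map ob A = fst Y" using ob_list_surj[of "fst Y"] unfolding K_simps by auto
    then obtain e where e: "e \<in> Hom AC A A" "map_mat L e = snd Y"
      using map_L_surj[of A A "snd Y"] Y unfolding K_simps by auto
    interpret category AC by (rule C.category_A)
    have "Comp AC e e = e"
      by (rule map_L_inj[OF A(1) A(1) Comp_in_Hom[OF A(1) A(1) A(1) e(1) e(1)] e(1)])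
        (use map_L_Comp[OF A(1) A(1) A(1) e(1) e(1)] e(2) Y in \<open>simp add: K_simps\<close>)
    then have "(A, e) \<in> Obj KC" unfolding K_simps using A e by simp
    moreover have "FO KF (A, e) = Y" unfolding KF_simps using A e by simp
    ultimately show "Y \<in> FO KF ` Obj KC" by (metis imageI)
  qed
  have hom: "bij_betw (FM KF X Y) (Hom KC X Y) (Hom KD (FO KF X) (FO KF Y))" if o: "X \<in> Obj KC" "Y \<in> Obj KC" for X Y
    unfolding bij_betw_def
  proof (intro conjI equalityI subsetI inj_onI)
    fix f g assume "f \<in> Hom KC X Y" "g \<in> Hom KC X Y" "FM KF X Y f = FM KF X Y g"
    then show "f = g" using map_L_inj[of "fst X" "fst Y" f g] o unfolding K_simps KF_simps by simp
  next
    fix f assume "f \<in> FM KF X Y ` Hom KC X Y"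
    then show "f \<in> Hom KD (FO KF X) (FO KF Y)" using F.FM_in_Hom[OF o] by auto
  next
    fix g assume g: "g \<in> Hom KD (FO KF X) (FO KF Y)"
    have oo: "fst X \<in> Obj AC" "fst Y \<in> Obj AC" "snd X \<in> Hom AC (fst X) (fst X)" "snd Y \<in> Hom AC (fst Y) (fst Y)"
      using o unfolding K_simps by auto
    have g': "g \<in> Hom AD (map ob (fst X)) (map ob (fst Y))" "Comp AD (map_mat L (snd Y)) g = g"
      "Comp AD g (map_mat L (snd X)) = g" using g unfolding K_simps KF_simps by auto
    obtain f where f: "f \<in> Hom AC (fst X) (fst Y)" "map_mat L f = g"
      using map_L_surj[OF oo(1,2) g'(1)] by auto
    interpret category AC by (rule C.category_A)
    have "Comp AC (snd Y) f = f"
      by (rule map_L_inj[OF oo(1,2) Comp_in_Hom[OF oo(1,2,2) f(1) oo(4)] f(1)])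
        (use map_L_Comp[OF oo(1,2,2) f(1) oo(4)] f(2) g' in simp)
    moreover have "Comp AC f (snd X) = f"
      by (rule map_L_inj[OF oo(1,2) Comp_in_Hom[OF oo(1,1,2,3) f(1)] f(1)])
        (use map_L_Comp[OF oo(1,1,2,3) f(1)] f(2) g' in simp)
    ultimately have "f \<in> Hom KC X Y" unfolding K_simps using f by simp
    moreover have "FM KF X Y f = g" using f by (simp add: KF_simps)
    ultimately show "g \<in> FM KF X Y ` Hom KC X Y" by blast
  qed
  have eq: "cat_equivalence KC KD KF"
    by (rule cat_equivalence_if_bijective[OF KC.category_axioms F obj hom KD.category_axioms])
  have T: "FO KF (TensO KC X Y) = TensO KD (FO KF X) (FO KF Y)" if "X \<in> Obj KC" "Y \<in> Obj KC" for X Y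
    using that map_ob_TensO[of "fst X" "fst Y"] map_L_TensM[of "fst X" "fst X" "fst Y" "fst Y" "snd X" "snd Y"]
    unfolding K_simps KF_simps by simp
  have U: "FO KF (UnitO KC) = UnitO KD"
  proof -
    have "UnitO AC \<in> Obj AC" using KC.UnitO_in_Obj unfolding K_simps by simp
    then show ?thesis unfolding K_simps KF_simps using map_L_Ident by (simp add: C.A_UnitO D.A_UnitO ob_UnitO)
  qed
  have iso: "is_iso KD X X (Ident KD X)" if "X \<in> Obj KD" for X
    unfolding is_iso_def using KD.Ident_in_Hom[OF that] KD.Ident_left[OF that that] by auto
  have idid: "Comp KD (Ident KD X) (Ident KD X) = Ident KD X" if "X \<in> Obj KD" for X
    using KD.Ident_left[OF that that KD.Ident_in_Hom[OF that]] .
  have c: "coh_mult KF X Y = Ident KD (TensO KD (FO KF X) (FO KF Y))" if "X \<in> Obj KC" "Y \<in> Obj KC" for X Y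
    using KF_simps(3) T[OF that] by simp
  have "monoidal_functor KC KD KF"
  proof
    fix X Y assume o: "X \<in> Obj KC" "Y \<in> Obj KC"
    show "is_iso KD (TensO KD (FO KF X) (FO KF Y)) (FO KF (TensO KC X Y)) (coh_mult KF X Y)"
      unfolding c[OF o] T[OF o] by (intro iso KD.TensO_in_Obj FO o)
  next
    show "is_iso KD (UnitO KD) (FO KF (UnitO KC)) (coh_unit KF)"
      unfolding U KF_simps(4) by (intro iso KD.UnitO_in_Obj)
  next
    fix X Y X' Y' f f' assume o: "X \<in> Obj KC" "Y \<in> Obj KC" "X' \<in> Obj KC" "Y' \<in> Obj KC"
      and f: "f \<in> Hom KC X Y" "f' \<in> Hom KC X' Y'"
    have t: "FM KF (TensO KC X X') (TensO KC Y Y') (TensM KC f f') = TensM KD (FM KF X Y f) (FM KF X' Y' f')"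
      using o f map_L_TensM[of "fst X" "fst Y" "fst X'" "fst Y'" f f'] unfolding K_simps KF_simps by simp
    have h: "TensM KD (FM KF X Y f) (FM KF X' Y' f') \<in> Hom KD (TensO KD (FO KF X) (FO KF X')) (TensO KD (FO KF Y) (FO KF Y'))"
      using KD.TensM_in_Hom[OF FO[OF o(1)] FO[OF o(2)] FO[OF o(3)] FO[OF o(4)] F.FM_in_Hom[OF o(1,2) f(1)] F.FM_in_Hom[OF o(3,4) f(2)]] .
    have TO: "TensO KD (FO KF X) (FO KF X') \<in> Obj KD" "TensO KD (FO KF Y) (FO KF Y') \<in> Obj KD"
      by (intro KD.TensO_in_Obj FO o)+
    show "Comp KD (coh_mult KF Y Y') (TensM KD (FM KF X Y f) (FM KF X' Y' f')) =
        Comp KD (FM KF (TensO KC X X') (TensO KC Y Y') (TensM KC f f')) (coh_mult KF X X')"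
      unfolding t c[OF o(1,3)] c[OF o(2,4)] KD.Ident_left[OF TO h] KD.Ident_right[OF TO h] ..
  next
    fix X Y Z assume o: "X \<in> Obj KC" "Y \<in> Obj KC" "Z \<in> Obj KC"
    note f = FO[OF o(1)] FO[OF o(2)] FO[OF o(3)]
    have XY: "TensO KC X Y \<in> Obj KC" "TensO KC Y Z \<in> Obj KC" by (intro KC.TensO_in_Obj o)+
    show "Comp KD (coh_mult KF (TensO KC X Y) Z) (TensM KD (coh_mult KF X Y) (Ident KD (FO KF Z))) =
        Comp KD (coh_mult KF X (TensO KC Y Z)) (TensM KD (Ident KD (FO KF X)) (coh_mult KF Y Z))"
      unfolding c[OF o(1,2)] c[OF o(2,3)] c[OF XY(1) o(3)] c[OF o(1) XY(2)] T[OF o(1,2)] T[OF o(2,3)]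
        KD.TensM_Ident[OF KD.TensO_in_Obj[OF f(1,2)] f(3)] KD.TensM_Ident[OF f(1) KD.TensO_in_Obj[OF f(2,3)]]
        KD.TensO_assoc[OF f] ..
  next
    fix X assume o: "X \<in> Obj KC"
    note f = FO[OF o]
    show "Comp KD (coh_mult KF (UnitO KC) X) (TensM KD (coh_unit KF) (Ident KD (FO KF X))) = Ident KD (FO KF X)"
      unfolding c[OF KC.UnitO_in_Obj o] U KF_simps(4) KD.TensM_Ident[OF KD.UnitO_in_Obj f] KD.TensO_unit(1)[OF f]
      by (rule idid[OF f])
    show "Comp KD (coh_mult KF X (UnitO KC)) (TensM KD (Ident KD (FO KF X)) (coh_unit KF)) = Ident KD (FO KF X)"
      unfolding c[OF o KC.UnitO_in_Obj] U KF_simps(4) KD.TensM_Ident[OF f KD.UnitO_in_Obj] KD.TensO_unit(2)[OF f]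
      by (rule idid[OF f])
  qed
  then show ?thesis unfolding monoidal_equivalence_def
    using KC.strict_monoidal_category_axioms KD.strict_monoidal_category_axioms eq by blast
qed

end

section \<open>Formal linear combinations of diagrams\<close>

abbreviation "keys \<equiv> Poly_Mapping.keys"
abbreviation "single \<equiv> Poly_Mapping.single"
abbreviation "lookup \<equiv> Poly_Mapping.lookup"

definition lin_ext :: "('a \<Rightarrow> 'b) \<Rightarrow> ('a \<Rightarrow> complex) \<Rightarrow> ('a \<Rightarrow>\<^sub>0 complex) \<Rightarrow> ('b \<Rightarrow>\<^sub>0 complex)" where
  "lin_ext \<phi> c f = (\<Sum>p\<in>keys f. single (\<phi> p) (c p * lookup f p))"

text \<open>Cancellation can shrink the support of a sum. Additivity is therefore proved over a
  common finite set that contains all supports.\<close>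

lemma lin_ext_superset:
  assumes "finite S" "keys f \<subseteq> S"
  shows "lin_ext \<phi> c f = (\<Sum>p\<in>S. single (\<phi> p) (c p * lookup f p))"
  unfolding lin_ext_def
  by (rule sum.mono_neutral_left) (use assms in \<open>auto simp: in_keys_iff\<close>)

lemma lin_ext_add: "lin_ext \<phi> c (f + g) = lin_ext \<phi> c f + lin_ext \<phi> c g"
proof -
  let ?S = "keys f \<union> keys g"
  have "keys (f + g) \<subseteq> ?S" by (rule Poly_Mapping.keys_add)
  then show ?thesis
    by (simp add: lin_ext_superset[of ?S] lookup_add distrib_left single_add sum.distrib)
qed

lemma lin_ext_0 [simp]: "lin_ext \<phi> c 0 = 0"
  by (simp add: lin_ext_def)

lemma lin_ext_single [simp]: "lin_ext \<phi> c (single p a) = single (\<phi> p) (c p * a)"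
  by (cases "a = 0") (simp_all add: lin_ext_def)

text \<open>Covers both operations of \<open>Rep0\<close>: composition has the weight
  \<open>t ^ loops q p\<close>, the tensor product the weight 1.\<close>

definition bilin_ext ::
  "('a \<Rightarrow> 'b \<Rightarrow> 'c) \<Rightarrow> ('a \<Rightarrow> 'b \<Rightarrow> complex) \<Rightarrow> ('a \<Rightarrow>\<^sub>0 complex) \<Rightarrow> ('b \<Rightarrow>\<^sub>0 complex) \<Rightarrow> ('c \<Rightarrow>\<^sub>0 complex)" where
  "bilin_ext \<beta> w g f = (\<Sum>q\<in>keys g. \<Sum>p\<in>keys f.
     single (\<beta> q p) (lookup g q * lookup f p * w q p))"

lemma bilin_ext_superset:
  assumes "finite S" "keys g \<subseteq> S" "finite T" "keys f \<subseteq> T"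
  shows "bilin_ext \<beta> w g f = (\<Sum>q\<in>S. \<Sum>p\<in>T.
     single (\<beta> q p) (lookup g q * lookup f p * w q p))"
proof -
  have "bilin_ext \<beta> w g f = (\<Sum>q\<in>keys g. \<Sum>p\<in>T.
     single (\<beta> q p) (lookup g q * lookup f p * w q p))"
    unfolding bilin_ext_def
    by (intro sum.cong refl sum.mono_neutral_left) (use assms in \<open>auto simp: in_keys_iff\<close>)
  also have "\<dots> = (\<Sum>q\<in>S. \<Sum>p\<in>T.
     single (\<beta> q p) (lookup g q * lookup f p * w q p))"
    by (rule sum.mono_neutral_left) (use assms in \<open>auto simp: in_keys_iff\<close>)
  finally show ?thesis .
qed

lemma bilin_ext_add_left: "bilin_ext \<beta> w (g + g') f = bilin_ext \<beta> w g f + bilin_ext \<beta> w g' f"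
proof -
  let ?S = "keys g \<union> keys g'"
  have "keys (g + g') \<subseteq> ?S" by (rule Poly_Mapping.keys_add)
  then show ?thesis
    by (simp add: bilin_ext_superset[of ?S _ "keys f"] lookup_add distrib_right single_add sum.distrib)
qed

lemma bilin_ext_add_right: "bilin_ext \<beta> w g (f + f') = bilin_ext \<beta> w g f + bilin_ext \<beta> w g f'"
proof -
  let ?S = "keys f \<union> keys f'"
  have "keys (f + f') \<subseteq> ?S" by (rule Poly_Mapping.keys_add)
  then show ?thesis
    by (simp add: bilin_ext_superset[of "keys g" _ ?S] lookup_add distrib_left distrib_right single_add sum.distrib)
qed

lemma bilin_ext_0 [simp]: "bilin_ext \<beta> w 0 f = 0" "bilin_ext \<beta> w g 0 = 0"
  by (simp_all add: bilin_ext_def)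

lemma bilin_ext_single [simp]:
  "bilin_ext \<beta> w (single q a) (single p b) = single (\<beta> q p) (a * b * w q p)"
  by (cases "a = 0"; cases "b = 0") (simp_all add: bilin_ext_def)

text \<open>Multilinear identities need only be checked on scalar multiples of single diagrams, with
  the support fixing which diagrams occur; this is applied to one argument at a time.\<close>

lemma keys_induct [consumes 1, case_names zero add single]:
  fixes f :: "'a \<Rightarrow>\<^sub>0 'b::comm_monoid_add"
  assumes "keys f \<subseteq> S" and "P 0" and "\<And>f g. P f \<Longrightarrow> P g \<Longrightarrow> P (f + g)"
    and "\<And>p a. p \<in> S \<Longrightarrow> P (single p a)"
  shows "P f"
proof -
  have "P (\<Sum>p\<in>K. single p (lookup f p))" if "finite K" "K \<subseteq> S" for K
    using that by (induction K rule: finite_induct) (auto intro: assms(2-4))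
  then have "P (\<Sum>p\<in>keys f. single p (lookup f p))"
    using assms(1) by simp
  moreover have "(\<Sum>p\<in>keys f. single p (lookup f p)) = f"
    by (rule poly_mapping_eqI) (simp add: lookup_sum lookup_single when_def in_keys_iff)
  ultimately show ?thesis by simp
qed

lemma keys_add_subset: "keys f \<subseteq> S \<Longrightarrow> keys g \<subseteq> S \<Longrightarrow> keys (f + g) \<subseteq> S"
  using Poly_Mapping.keys_add[of f g] by blast

lemma keys_lin_ext:
  assumes "keys f \<subseteq> S" "\<And>p. p \<in> S \<Longrightarrow> \<phi> p \<in> T"
  shows "keys (lin_ext \<phi> c f) \<subseteq> T"
  using assms(1)
proof (induction rule: keys_induct)
  case (add f g)
  then show ?case by (simp add: lin_ext_add keys_add_subset)
qed (simp_all add: assms(2))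

lemma keys_bilin_ext:
  assumes "keys g \<subseteq> S" "keys f \<subseteq> T" "\<And>q p. q \<in> S \<Longrightarrow> p \<in> T \<Longrightarrow> \<beta> q p \<in> U"
  shows "keys (bilin_ext \<beta> w g f) \<subseteq> U"
  using assms(1)
proof (induction rule: keys_induct)
  case (add g g')
  then show ?case by (simp add: bilin_ext_add_left keys_add_subset)
next
  case (single q a)
  show ?case using assms(2)
  proof (induction rule: keys_induct)
    case (add f f')
    then show ?case by (simp add: bilin_ext_add_right keys_add_subset)
  qed (simp_all add: assms(3) single)
qed simp

lemma bij_betw_lin_ext:
  assumes \<phi>: "bij_betw \<phi> S T" and c: "\<And>p. p \<in> S \<Longrightarrow> c p \<noteq> 0"
  shows "bij_betw (lin_ext \<phi> c) {f. keys f \<subseteq> S} {f. keys f \<subseteq> T}"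
proof (rule bij_betw_byWitness)
  let ?\<psi> = "inv_into S \<phi>"
  let ?d = "\<lambda>r. 1 / c (?\<psi> r)"
  have \<psi>: "?\<psi> (\<phi> p) = p" if "p \<in> S" for p using that \<phi> by (simp add: bij_betw_def)
  have \<psi>T: "?\<psi> r \<in> S" "\<phi> (?\<psi> r) = r" if "r \<in> T" for r
    using that \<phi> by (auto simp: bij_betw_def intro: inv_into_into f_inv_into_f)
  show "\<forall>f\<in>{f. keys f \<subseteq> S}. lin_ext ?\<psi> ?d (lin_ext \<phi> c f) = f"
  proof
    fix f :: "_ \<Rightarrow>\<^sub>0 complex" assume "f \<in> {f. keys f \<subseteq> S}"
    then have "keys f \<subseteq> S" by simp
    then show "lin_ext ?\<psi> ?d (lin_ext \<phi> c f) = f"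
      by (induction rule: keys_induct) (simp_all add: lin_ext_add \<psi> c)
  qed
  show "\<forall>f\<in>{f. keys f \<subseteq> T}. lin_ext \<phi> c (lin_ext ?\<psi> ?d f) = f"
  proof
    fix f :: "_ \<Rightarrow>\<^sub>0 complex" assume "f \<in> {f. keys f \<subseteq> T}"
    then have "keys f \<subseteq> T" by simp
    then show "lin_ext \<phi> c (lin_ext ?\<psi> ?d f) = f"
      by (induction rule: keys_induct) (simp_all add: lin_ext_add \<psi>T c)
  qed
  have "\<phi> p \<in> T" if "p \<in> S" for p using that \<phi> by (auto simp: bij_betw_def)
  then show "lin_ext \<phi> c ` {f. keys f \<subseteq> S} \<subseteq> {f. keys f \<subseteq> T}"
    using keys_lin_ext[of _ S \<phi> T c] by auto
  show "lin_ext ?\<psi> ?d ` {f. keys f \<subseteq> T} \<subseteq> {f. keys f \<subseteq> S}"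
    using keys_lin_ext[of _ T ?\<psi> S ?d] \<psi>T by auto
qed

section \<open>The functor on linear combinations of diagrams\<close>

lemma G_lin_eq: "G_lin t s = lin_ext fatten (coeff_a t s)"
  by (rule ext) (simp add: G_lin_def lin_ext_def)

lemma Rep0_simps:
  "Obj (Rep0 \<C> t) = UNIV" "Hom (Rep0 \<C> t) k l = {f. keys f \<subseteq> \<C> k l}"
  "Ident (Rep0 \<C> t) k = single (id_diagram k) 1"
  "Comp (Rep0 \<C> t) = bilin_ext compose_diagram (\<lambda>q p. t ^ loops q p)"
  "TensO (Rep0 \<C> t) = (+)" "TensM (Rep0 \<C> t) = bilin_ext tensor (\<lambda>p q. 1)" "UnitO (Rep0 \<C> t) = 0"
  by (simp_all add: Rep0_def bilin_ext_def fun_eq_iff)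

lemma full_subcategory_simps:
  "Obj (full_subcategory B P) = {X \<in> Obj B. P X}" "Hom (full_subcategory B P) = Hom B"
  "Ident (full_subcategory B P) = Ident B" "Comp (full_subcategory B P) = Comp B"
  "TensO (full_subcategory B P) = TensO B" "TensM (full_subcategory B P) = TensM B"
  "UnitO (full_subcategory B P) = UnitO B"
  by (simp_all add: full_subcategory_def)

text \<open>The predicate \<open>P\<close> lets one proof treat both sides: all objects for
  \<open>NC\<close>, and the even ones for \<open>NC2\<close>, where \<open>compose_NC2\<close>
  supplies closure under composition for even numbers of points.\<close>

lemma linear_monoidal_Rep0:
  assumes Part: "\<And>k l. \<C> k l \<subseteq> Part k l"
    and P0: "P 0" and P_add: "\<And>k l. P k \<Longrightarrow> P l \<Longrightarrow> P (k + l)"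
    and id: "\<And>k. id_diagram k \<in> \<C> k k"
    and comp: "\<And>k l m p q. P k \<Longrightarrow> P l \<Longrightarrow> P m \<Longrightarrow> p \<in> \<C> k l \<Longrightarrow> q \<in> \<C> l m \<Longrightarrow> compose_diagram q p \<in> \<C> k m"
    and tens: "\<And>k l k' l' p q. p \<in> \<C> k l \<Longrightarrow> q \<in> \<C> k' l' \<Longrightarrow> tensor p q \<in> \<C> (k + k') (l + l')"
  shows "linear_monoidal_category (full_subcategory (Rep0 \<C> t) P)"
proof -
  note S = full_subcategory_simps Rep0_simps mem_Collect_eq
  let ?c = "bilin_ext compose_diagram (\<lambda>q p. t ^ loops q p)"
  let ?t = "bilin_ext tensor (\<lambda>p q. 1)"
  note B = bilin_ext_add_left bilin_ext_add_right
  show ?thesis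
  proof (unfold_locales; unfold S)
    fix X :: nat
    show "keys (single (id_diagram X) (1::complex)) \<subseteq> \<C> X X" using id by simp
  next
    fix X Y Z and f g :: "diagram \<Rightarrow>\<^sub>0 complex"
    assume o: "X \<in> UNIV \<and> P X" "Y \<in> UNIV \<and> P Y" "Z \<in> UNIV \<and> P Z"
      and f: "keys f \<subseteq> \<C> X Y" and g: "keys g \<subseteq> \<C> Y Z"
    show "keys (?c g f) \<subseteq> \<C> X Z"
      by (rule keys_bilin_ext[OF g f]) (use o comp in blast)
  next
    fix W X Y Z :: nat and f g h :: "diagram \<Rightarrow>\<^sub>0 complex"
    assume f: "keys f \<subseteq> \<C> W X" and g: "keys g \<subseteq> \<C> X Y" and h: "keys h \<subseteq> \<C> Y Z"
    show "?c h (?c g f) = ?c (?c h g) f"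
      using f
    proof (induction rule: keys_induct)
      case (single p a)
      then have p: "p \<in> Part W X" using Part by blast
      show ?case using g
      proof (induction rule: keys_induct)
        case (single q b)
        then have q: "q \<in> Part X Y" using Part by blast
        show ?case using h
        proof (induction rule: keys_induct)
          case (single r c)
          then have r: "r \<in> Part Y Z" using Part by blast
          have "t ^ loops q p * t ^ loops r (compose_diagram q p) = t ^ loops r q * t ^ loops (compose_diagram r q) p"
            unfolding power_add[symmetric] loops_assoc[OF p q r] ..
          then show ?case by (simp add: compose_assoc[OF p q r] mult_ac)
        qed (simp_all add: B)
      qed (simp_all add: B)
    qed (simp_all add: B)
  next
    fix X Y :: nat and f :: "diagram \<Rightarrow>\<^sub>0 complex"
    assume f: "keys f \<subseteq> \<C> X Y"
    show "?c (single (id_diagram Y) 1) f = f"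
      using f
    proof (induction rule: keys_induct)
      case (single p a)
      then have "p \<in> Part X Y" using Part by blast
      then show ?case by (simp add: compose_id_left loops_id_left)
    qed (simp_all add: B)
    show "?c f (single (id_diagram X) 1) = f"
      using f
    proof (induction rule: keys_induct)
      case (single p a)
      then have "p \<in> Part X Y" using Part by blast
      then show ?case by (simp add: compose_id_right loops_id_right)
    qed (simp_all add: B)
    show "?t (single (id_diagram 0) 1) f = f" "?t f (single (id_diagram 0) 1) = f"
      using f by (induction rule: keys_induct) (simp_all add: B)
  next
    fix X Y X' Y' :: nat and f f' :: "diagram \<Rightarrow>\<^sub>0 complex"
    assume f: "keys f \<subseteq> \<C> X Y" and f': "keys f' \<subseteq> \<C> X' Y'"
    show "keys (?t f f') \<subseteq> \<C> (X + X') (Y + Y')"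
      by (rule keys_bilin_ext[OF f f']) (rule tens)
  next
    fix X Y :: nat
    show "?t (single (id_diagram X) 1) (single (id_diagram Y) 1) =
        single (id_diagram (X + Y)) 1"
      by (simp add: tensor_id)
  next
    fix X Y Z X' Y' Z' :: nat and f g f' g' :: "diagram \<Rightarrow>\<^sub>0 complex"
    assume f: "keys f \<subseteq> \<C> X Y" and g: "keys g \<subseteq> \<C> Y Z"
      and f': "keys f' \<subseteq> \<C> X' Y'" and g': "keys g' \<subseteq> \<C> Y' Z'"
    show "?t (?c g f) (?c g' f') = ?c (?t g g') (?t f f')"
      using f
    proof (induction rule: keys_induct)
      case (single p a)
      then have p: "p \<in> Part X Y" using Part by blast
      show ?case using g
      proof (induction rule: keys_induct)
        case (single q b)
        then have q: "q \<in> Part Y Z" using Part by blast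
        show ?case using f'
        proof (induction rule: keys_induct)
          case (single p' a')
          then have p': "p' \<in> Part X' Y'" using Part by blast
          show ?case using g'
          proof (induction rule: keys_induct)
            case (single q' b')
            then have q': "q' \<in> Part Y' Z'" using Part by blast
            show ?case
              by (simp add: compose_tensor[OF p q p' q'] loops_tensor[OF p q p' q'] power_add mult_ac)
          qed (simp_all add: B)
        qed (simp_all add: B)
      qed (simp_all add: B)
    qed (simp_all add: B)
  next
    fix X Y X' Y' X'' Y'' :: nat and f f' f'' :: "diagram \<Rightarrow>\<^sub>0 complex"
    assume f: "keys f \<subseteq> \<C> X Y" and f': "keys f' \<subseteq> \<C> X' Y'" and f'': "keys f'' \<subseteq> \<C> X'' Y''"
    show "?t (?t f f') f'' = ?t f (?t f' f'')"
      using f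
    proof (induction rule: keys_induct)
      case (single p a)
      show ?case using f'
      proof (induction rule: keys_induct)
        case (single p' a')
        show ?case using f''
          by (induction rule: keys_induct) (simp_all add: B tensor_assoc mult_ac)
      qed (simp_all add: B)
    qed (simp_all add: B)
  qed (use P0 P_add in \<open>simp_all add: B keys_add_subset add_ac\<close>)
qed

lemma full_subcategory_karoubi:
  "full_subcategory (karoubi_envelope B) (\<lambda>(A, e). \<forall>X\<in>set A. P X) = karoubi_envelope (full_subcategory B P)"
  by (auto simp: full_subcategory_def karoubi_envelope_def idempotent_completion_def additive_completion_def)

theorem lemma5p22:
  fixes t s :: complex
  assumes "t \<noteq> 0" and "s\<^sup>2 = t"
  shows "monoidal_equivalence (Rep_O_even t) (Rep_S (t\<^sup>2)) (G_functor t s)"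
proof -
  let ?C = "full_subcategory (Rep0 NC2 t) even" and ?D = "Rep0 NC (t\<^sup>2)"
  have C: "linear_monoidal_category ?C"
    by (rule linear_monoidal_Rep0)
      (auto simp: NC2_Part id_NC2 tensor_NC2 compose_NC2 elim!: evenE)
  have "linear_monoidal_category (full_subcategory ?D (\<lambda>_. True))"
    by (rule linear_monoidal_Rep0) (auto simp: NC_Part NC2_NC[OF id_NC2] tensor_NC compose_NC)
  moreover have "full_subcategory ?D (\<lambda>_. True) = ?D"
    by (simp add: full_subcategory_def Rep0_def)
  ultimately have D: "linear_monoidal_category ?D" by simp
  interpret C: linear_monoidal_category ?C by (rule C)
  interpret D: linear_monoidal_category ?D by (rule D)
  note S = full_subcategory_simps Rep0_simps mem_Collect_eq
  note B = bilin_ext_add_left bilin_ext_add_right lin_ext_add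
  interpret linear_isomorphism ?C ?D "\<lambda>k. k div 2" "G_lin t s"
  proof (unfold_locales; unfold S G_lin_eq)
    show "bij_betw (\<lambda>k. k div 2) {k \<in> UNIV. even k} (UNIV :: nat set)"
      by (rule bij_betw_byWitness[of _ "\<lambda>k. 2 * k"]) auto
  next
    fix X Y :: nat assume "X \<in> UNIV \<and> even X" "Y \<in> UNIV \<and> even Y"
    then obtain k l where kl: "X = 2 * k" "Y = 2 * l" by (auto elim!: evenE)
    show "(X + Y) div 2 = X div 2 + Y div 2" using kl by simp
    show "bij_betw (lin_ext fatten (coeff_a t s)) {f. keys f \<subseteq> NC2 X Y} {f. keys f \<subseteq> NC (X div 2) (Y div 2)}"
      unfolding kl using bij_betw_lin_ext[OF fatten_bij coeff_a_nonzero[OF assms]] by simp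
  next
    fix X :: nat assume "X \<in> UNIV \<and> even X"
    then obtain k where k: "X = 2 * k" by (auto elim!: evenE)
    \<comment> \<open>The fattened identity has \<open>k\<close> blocks, so
      \<open>coeff_a_eq\<close> has the same power of \<open>s\<close> on both sides and the
      coefficient is 1.\<close>
    have "coeff_a t s (id_diagram (2 * k)) * s ^ (2 * card (blocks (id_diagram k))) = s ^ (k + k)"
      using coeff_a_eq[OF assms id_NC2] fatten_id by simp
    moreover have "card (blocks (id_diagram k)) = k"
      by (simp add: card_image inj_on_def doubleton_eq_iff)
    moreover have "s \<noteq> 0" using assms by auto
    ultimately have "coeff_a t s (id_diagram (2 * k)) = 1" by (simp add: mult_2)
    then show "lin_ext fatten (coeff_a t s) (single (id_diagram X) 1) = single (id_diagram (X div 2)) 1"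
      unfolding k by (simp add: fatten_id)
  next
    fix X Y Z :: nat and f g :: "diagram \<Rightarrow>\<^sub>0 complex"
    assume "X \<in> UNIV \<and> even X" "Y \<in> UNIV \<and> even Y" "Z \<in> UNIV \<and> even Z"
      and fg: "keys f \<subseteq> NC2 X Y" "keys g \<subseteq> NC2 Y Z"
    then obtain k l m where klm: "X = 2 * k" "Y = 2 * l" "Z = 2 * m" by (auto elim!: evenE)
    show "lin_ext fatten (coeff_a t s) (bilin_ext compose_diagram (\<lambda>q p. t ^ loops q p) g f) =
        bilin_ext compose_diagram (\<lambda>q p. (t\<^sup>2) ^ loops q p) (lin_ext fatten (coeff_a t s) g) (lin_ext fatten (coeff_a t s) f)"
      using fg(1)
    proof (induction rule: keys_induct)
      case (single p a)
      then have p: "p \<in> NC2 (2 * k) (2 * l)" using klm by simp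
      show ?case using fg(2)
      proof (induction rule: keys_induct)
        case (single q b)
        then have q: "q \<in> NC2 (2 * l) (2 * m)" using klm by simp
        show ?case
          using coeff_a_compose[OF assms p q] by (simp add: fatten_compose[OF p q] mult_ac)
      qed (simp_all add: B)
    qed (simp_all add: B)
  next
    fix X Y X' Y' :: nat and f f' :: "diagram \<Rightarrow>\<^sub>0 complex"
    assume "X \<in> UNIV \<and> even X" "Y \<in> UNIV \<and> even Y" "X' \<in> UNIV \<and> even X'" "Y' \<in> UNIV \<and> even Y'"
      and ff: "keys f \<subseteq> NC2 X Y" "keys f' \<subseteq> NC2 X' Y'"
    then obtain k l k' l' where kl: "X = 2 * k" "Y = 2 * l" "X' = 2 * k'" "Y' = 2 * l'" by (auto elim!: evenE)
    show "lin_ext fatten (coeff_a t s) (bilin_ext tensor (\<lambda>p q. 1) f f') =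
        bilin_ext tensor (\<lambda>p q. 1) (lin_ext fatten (coeff_a t s) f) (lin_ext fatten (coeff_a t s) f')"
      using ff(1)
    proof (induction rule: keys_induct)
      case (single p a)
      then have p: "p \<in> NC2 (2 * k) (2 * l)" using kl by simp
      show ?case using ff(2)
      proof (induction rule: keys_induct)
        case (single q b)
        then have q: "q \<in> NC2 (2 * k') (2 * l')" using kl by simp
        show ?case
          using coeff_a_tensor[OF assms p q] by (simp add: fatten_tensor[OF p q] mult_ac)
      qed (simp_all add: B)
    qed (simp_all add: B)
  qed (simp_all add: lin_ext_add)
  have O: "Rep_O_even t = karoubi_envelope ?C"
    unfolding Rep_O_even_def Rep_O_def Rep_def by (rule full_subcategory_karoubi)
  have RS: "Rep_S (t\<^sup>2) = karoubi_envelope ?D" by (simp add: Rep_S_def Rep_def)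
  have "G_functor t s = KF"
    unfolding G_functor_def KF_def G_obj_def O RS ..
  then show ?thesis using monoidal_equivalence_KF unfolding O RS by simp
qed

end
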